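(* Let $Q$ be a ground quantum type and let $t_1,t_2$ be closed well-formed terms of type $Q$, i.e. $\vdash t_1:Q$ and $\vdash t_2:Q$. Then $$\vdash t_1=t_2:Q\quad\text{(derivable in the equational theory)}\qquad\text{if and only if}\qquad [\![\vdash t_1:Q]\!]=[\![\vdash t_2:Q]\!].$$
   Context: **Syntax.** Ground quantum types: $Q::=I\mid Q\oplus Q\mid Q\otimes Q\mid\mathrm{qnat}$, with $\mathrm{qbit}:=I\oplus I$. Unitary types: $U(Q_1,Q_2)$. Let $x$ range over variables and $\alpha$ over complex scalars; all index sets are finite. Basis values: $b::=*\mid x\mid\mathrm{inl}\,b\mid\mathrm{inr}\,b\mid b\otimes b\mid 0\mid S\,b$ (a total order on them is fixed). Values: $v::=\sum_{i\in I}(\alpha_i\cdot b_i)$ with the $b_i$ in increasing order and all $\alpha_i\neq 0$. Expressions: $e::=*\mid x\mid\mathrm{inl}\,e\mid\mathrm{inr}\,e\mid e\otimes e\mid 0\mid S\,e\mid\sum_{i\in I}(\alpha_i\cdot e_i)$. Unitaries: $u::=\{b_1\mapsto e_1\mid\dots\mid b_n\mapsto e_n\}\mid u\otimes u\mid u\oplus u\mid u\circ u\mid u^*\mid\mathrm{ctrl}\,u$. Terms: $t::=*\mid x\mid\mathrm{inl}\,t\mid\mathrm{inr}\,t\mid t\otimes t\mid 0\mid S\,t\mid u\,t\mid\sum_{i\in I}(\alpha_i\cdot t_i)$. **Orthogonality** $\perp$ is the smallest symmetric relation on terms such that: $\mathrm{inl}\,t_1\perp\mathrm{inr}\,t_2$;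 $0\perp S\,t$; if $t_1\perp t_2$ then $S\,t_1\perp S\,t_2$, $\mathrm{inl}\,t_1\perp\mathrm{inl}\,t_2$, $\mathrm{inr}\,t_1\perp\mathrm{inr}\,t_2$, $u\,t_1\perp u\,t_2$, and, for all $t,t'$, $t\otimes t_1\perp t'\otimes t_2$ and $t_1\otimes t\perp t_2\otimes t'$; if $t\perp t_i$ for all $i\in I$ then $t\perp\sum_{i\in I}(\alpha_i\cdot t_i)$; if $t\perp t_i$ for all $i\in I$, $\alpha_\star=0$ and $t_\star=t$, then $t\perp\sum_{i\in I\cup\{\star\}}(\alpha_i\cdot t_i)$; if $t_i\perp t_j$ for all $i\ne j\in I$, $J,K\subseteq I$ and $\sum_{i\in J\cap K}\overline{\alpha_i}\beta_i=0$, then $\sum_{j\in J}(\alpha_j\cdot t_j)\perp\sum_{k\in K}(\beta_k\cdot t_k)$. **Orthonormal bases.** For a set $S$ of elements of the form $b\otimes b'$, $\pi_1(S),\pi_2(S)$ are the sets of first, resp. second, components, $S^1_b=\{b'\mid b\otimes b'\in S\}$ and $S^2_b=\{b'\mid b'\otimes b\in S\}$. $\mathrm{ONB}_Q$ is the smallest predicate on finite sets of basis values with: $\mathrm{ONB}_Q(\{x\})$; $\mathrm{ONB}_I(\{*\})$; if $\mathrm{ONB}_{Q_1}(S)$ and $\mathrm{ONB}_{Q_2}(T)$ then $\mathrm{ONB}_{Q_1\oplus Q_2}(\{\mathrm{inl}\,b\mid b\in S\}\cup\{\mathrm{inr}\,b\mid b\in T\})$; if $\mathrm{ONB}_{\mathrm{qnat}}(S)$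 then $\mathrm{ONB}_{\mathrm{qnat}}(\{0\}\cup\{S\,b\mid b\in S\})$; $\mathrm{ONB}_{Q_1\otimes Q_2}(S)$ if $\mathrm{ONB}_{Q_2}(\pi_2(S))$ and $\mathrm{ONB}_{Q_1}(S^2_b)$ for all $b\in\pi_2(S)$; $\mathrm{ONB}_{Q_1\otimes Q_2}(S)$ if $\mathrm{ONB}_{Q_1}(\pi_1(S))$ and $\mathrm{ONB}_{Q_2}(S^1_b)$ for all $b\in\pi_1(S)$. $\mathrm{ONB}^e_Q$ is the predicate on finite sets of expressions generated by the same rules (for expressions) together with: if $\mathrm{ONB}^e_Q(S)$ and $(\alpha_{e,e'})_{(e,e')\in S\times S}$ is a unitary matrix then $\mathrm{ONB}^e_Q(\{\sum_{e'\in S}(\alpha_{e,e'}\cdot e')\mid e\in S\})$. **Typing** (contexts $\Gamma$ are finite sets of pairs $x:Q$, used strictly linearly; comma is disjoint union). $\vdash *:I$; $x:Q\vdash x:Q$; $\Gamma_1,\Gamma_2\vdash t_1\otimes t_2:Q_1\otimes Q_2$ if $\Gamma_i\vdash t_i:Q_i$; $\Gamma\vdash\mathrm{inl}\,t:Q_1\oplus Q_2$ if $\Gamma\vdash t:Q_1$; $\Gamma\vdash\mathrm{inr}\,t:Q_1\oplus Q_2$ if $\Gamma\vdash t:Q_2$; $\vdash 0:\mathrm{qnat}$; $\Gamma\vdash S\,t:\mathrm{qnat}$ if $\Gamma\vdash t:\mathrm{qnat}$; $\Gamma\vdash\sum_i(\alpha_i\cdot t_i):Q$ if $\Gamma\vdash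 t_i:Q$ for all $i$, $\sum_i|\alpha_i|^2=1$ and $t_i\perp t_j$ for $i\neq j$; $\Gamma\vdash u\,t:Q_2$ if $\Vdash u:U(Q_1,Q_2)$ and $\Gamma\vdash t:Q_1$. Unitaries: $\Vdash\{b_1\mapsto e_1\mid\dots\mid b_n\mapsto e_n\}:U(Q_1,Q_2)$ if there are $\Gamma_i$ with $\Gamma_i\vdash b_i:Q_1$, $\Gamma_i\vdash e_i:Q_2$, $\mathrm{ONB}_{Q_1}(\{b_1,\dots,b_n\})$ and $\mathrm{ONB}^e_{Q_2}(\{e_1,\dots,e_n\})$ (the $b_i$ pairwise distinct, the $e_i$ pairwise distinct); $u^*:U(Q_2,Q_1)$ if $u:U(Q_1,Q_2)$; $u_2\circ u_1:U(Q_1,Q_3)$ if $u_1:U(Q_1,Q_2)$, $u_2:U(Q_2,Q_3)$; $u_1\otimes u_2:U(Q_1\otimes Q_3,Q_2\otimes Q_4)$ and $u_1\oplus u_2:U(Q_1\oplus Q_3,Q_2\oplus Q_4)$ if $u_1:U(Q_1,Q_2)$, $u_2:U(Q_3,Q_4)$; $\mathrm{ctrl}\,u:U(\mathrm{qbit}\otimes Q,\mathrm{qbit}\otimes Q)$ if $u:U(Q,Q)$. **Matching and substitution.** A valuation $\sigma$ is a finite partial map from variables to expressions; $\sigma(t)$ is $t$ with each variable replaced by its image (and $\sigma(u\,t)=u\,\sigma(t)$). $\mathrm{match}(\sigma,b,b')$ for basis values: $\mathrm{match}(\emptyset,*,* )$; $\mathrm{match}(\{x\mapsto b'\},x,b')$;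 $\mathrm{match}(\emptyset,0,0)$; $\mathrm{match}(\sigma,b,b')$ implies $\mathrm{match}(\sigma,\mathrm{inl}\,b,\mathrm{inl}\,b')$, $\mathrm{match}(\sigma,\mathrm{inr}\,b,\mathrm{inr}\,b')$, $\mathrm{match}(\sigma,S\,b,S\,b')$; $\mathrm{match}(\sigma_1,b_1,b_1')$, $\mathrm{match}(\sigma_2,b_2,b_2')$ with disjoint supports imply $\mathrm{match}(\sigma_1\cup\sigma_2,b_1\otimes b_2,b_1'\otimes b_2')$. **Equational theory.** Judgements $\Gamma\vdash t_1=t_2:Q$ generated by reflexivity (for well-formed terms), symmetry, transitivity and the following. Linear algebra (left-hand sides or their displayed components assumed well-formed): $\sum_i(\alpha_i\cdot t_i)=\sum_i(\alpha_{\ell(i)}\cdot t_{\ell(i)})$ for $\ell$ a permutation of indices; $\sum_{i=1}^n(\alpha_i\cdot t_i)=\sum_{i=1}^{n-1}(\alpha_i\cdot t_i)$ if $\alpha_n=0$; $\sum_{i=1}^1(1\cdot t)=t$; $\sum_i(\alpha_i\cdot\sum_j(\beta_{ij}\cdot t_j))=\sum_j((\sum_i\alpha_i\beta_{ij})\cdot t_j)$; $\sum_i(\alpha_i\cdot\sum_j(\beta_{ij}\cdot t_{ij}))=\sum_{ij}(\alpha_i\beta_{ij}\cdot t_{ij})$ provided the right-hand side is well-formed; $C[\sum_i(\alpha_i\cdot t_i)]=\sum_i(\alpha_i\cdot C[t_i])$ for $C[-]$ one of $u\,-$, $\mathrm{inl}\,-$, $\mathrm{inr}\,-$, $S\,-$,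 $t\otimes-$, $-\otimes t$. Congruence: from $\Gamma\vdash t_1=t_2$ infer $C[t_1]=C[t_2]$ for the same $C$ (with $u$, $t$ well-formed, contexts joined for $\otimes$); from $\Gamma\vdash\sum_i(\alpha_i\cdot t_i):Q$ and $\Gamma\vdash t_i=t_i':Q$ for all $i$ infer $\Gamma\vdash\sum_i(\alpha_i\cdot t_i)=\sum_i(\alpha_i\cdot t'_i):Q$. Computation (all well-formed, $b,b',b_i$ basis values, closed except in the rule for $\circ$, $v$ a value): $\{b_1\mapsto e_1\mid\dots\mid b_n\mapsto e_n\}\,b'=\sigma(e_i)$ if $\mathrm{match}(\sigma,b_i,b')$; from $\vdash u\,b=v$ infer $\vdash u^*\,v=b$; $(u_2\circ u_1)\,b=u_2\,(u_1\,b)$; $(u_1\otimes u_2)\,(b_1\otimes b_2)=(u_1\,b_1)\otimes(u_2\,b_2)$; $(u_1\oplus u_2)(\mathrm{inl}\,b)=\mathrm{inl}\,(u_1\,b)$; $(u_1\oplus u_2)(\mathrm{inr}\,b)=\mathrm{inr}\,(u_2\,b)$; $(\mathrm{ctrl}\,u)((\mathrm{inl}\,* )\otimes b)=(\mathrm{inl}\,* )\otimes b$; $(\mathrm{ctrl}\,u)((\mathrm{inr}\,* )\otimes b)=(\mathrm{inr}\,* )\otimes(u\,b)$. **Denotational semantics** in countably-dimensional complex Hilbert spaces. $[\![I]\!]=\mathbb C$, $[\![Q_1\oplus Q_2]\!]=[\![Q_1]\!]\oplus[\![Q_2]\!]$, $[\![Q_1\otimes Q_2]\!]=[\![Q_1]\!]\otimes[\![Q_2]\!]$,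 $[\![\mathrm{qnat}]\!]=\ell^2(\mathbb N)$; a context is interpreted as the tensor product of its types (up to canonical permutations). $[\![\Gamma\vdash t:Q]\!]:[\![\Gamma]\!]\to[\![Q]\!]$ is: $[\![*]\!]=\mathrm{id}_{\mathbb C}$, $[\![x]\!]=\mathrm{id}$, $[\![\mathrm{inl}\,t]\!]=\iota_l\circ[\![t]\!]$, $[\![\mathrm{inr}\,t]\!]=\iota_r\circ[\![t]\!]$ (direct-sum injections), $[\![t\otimes t']\!]=[\![t]\!]\otimes[\![t']\!]$, $[\![0]\!]=|0\rangle$, $[\![S\,t]\!]=\mathrm{succ}\circ[\![t]\!]$ with $\mathrm{succ}|n\rangle=|n+1\rangle$, $[\![\sum_i(\alpha_i\cdot t_i)]\!]=\sum_i\alpha_i[\![t_i]\!]$, $[\![u\,t]\!]=[\![u]\!]\circ[\![t]\!]$. For unitaries: $[\![\{b_i\mapsto e_i\}_i]\!]=\sum_i[\![e_i]\!]\circ[\![b_i]\!]^*$; $\circ,\otimes,\oplus,(-)^*$ are interpreted by the same operations on operators; $[\![\mathrm{ctrl}\,u]\!]=|0\rangle\langle0|\otimes\mathrm{id}+|1\rangle\langle1|\otimes[\![u]\!]$. *)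

theory Defs
  imports "HOL-Analysis.Analysis" "HOL-Combinatorics.Permutations"
begin

section \<open>Syntax\<close>

datatype qty = QI | QPlus qty qty | QTensor qty qty | QNat

definition qbit :: qty where
  "qbit = QPlus QI QI"

type_synonym var = nat

text \<open>
  Basis values, values and expressions are the subclasses \<open>basis_value\<close>, \<open>is_value\<close>,
  \<open>expression\<close> of terms.  A formal sum over a finite index set is the list of its
  (scalar, term) pairs.  The constructor \<open>Clauses\<close> takes arbitrary terms; the typing rule
  restricts its left-hand sides to basis values and its right-hand sides to expressions,
  through \<open>ONB\<close> and \<open>ONBe\<close>.
\<close>

datatype tm =
    Star | Var var | Inl tm | Inr tm | Tensor tm tm | Zero | Succ tm
  | App un tm | Sum "(complex \<times> tm) list"
and un =
    Clauses "(tm \<times> tm) list" | UTensor un un | UPlus un un | UComp un un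
  | UInv un | UCtrl un

fun basis_value :: "tm \<Rightarrow> bool" where
  "basis_value Star = True"
| "basis_value (Var x) = True"
| "basis_value (Inl b) = basis_value b"
| "basis_value (Inr b) = basis_value b"
| "basis_value (Tensor b b') = (basis_value b \<and> basis_value b')"
| "basis_value Zero = True"
| "basis_value (Succ b) = basis_value b"
| "basis_value (App u t) = False"
| "basis_value (Sum ts) = False"

fun expression :: "tm \<Rightarrow> bool" where
  "expression Star = True"
| "expression (Var x) = True"
| "expression (Inl e) = expression e"
| "expression (Inr e) = expression e"
| "expression (Tensor e e') = (expression e \<and> expression e')"
| "expression Zero = True"
| "expression (Succ e) = expression e"
| "expression (App u t) = False"
| "expression (Sum es) = (\<forall>p\<in>set es. expression (snd p))"

text \<open>The relation \<open>r\<close> is the fixed total order on basis values.\<close>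

definition is_value :: "(tm \<times> tm) set \<Rightarrow> tm \<Rightarrow> bool" where
  "is_value r v \<longleftrightarrow> (\<exists>bs. v = Sum bs \<and>
     (\<forall>(\<alpha>, b)\<in>set bs. \<alpha> \<noteq> 0 \<and> basis_value b) \<and>
     sorted_wrt (\<lambda>b b'. (b, b') \<in> r \<and> b \<noteq> b') (map snd bs))"

fun subst :: "(var \<rightharpoonup> tm) \<Rightarrow> tm \<Rightarrow> tm" where
  "subst \<sigma> Star = Star"
| "subst \<sigma> (Var x) = (case \<sigma> x of None \<Rightarrow> Var x | Some e \<Rightarrow> e)"
| "subst \<sigma> (Inl t) = Inl (subst \<sigma> t)"
| "subst \<sigma> (Inr t) = Inr (subst \<sigma> t)"
| "subst \<sigma> (Tensor t t') = Tensor (subst \<sigma> t) (subst \<sigma> t')"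
| "subst \<sigma> Zero = Zero"
| "subst \<sigma> (Succ t) = Succ (subst \<sigma> t)"
| "subst \<sigma> (App u t) = App u (subst \<sigma> t)"
| "subst \<sigma> (Sum ts) = Sum (map (\<lambda>(\<alpha>, t). (\<alpha>, subst \<sigma> t)) ts)"

inductive match :: "(var \<rightharpoonup> tm) \<Rightarrow> tm \<Rightarrow> tm \<Rightarrow> bool" where
  match_star: "match Map.empty Star Star"
| match_var: "basis_value b' \<Longrightarrow> match [x \<mapsto> b'] (Var x) b'"
| match_zero: "match Map.empty Zero Zero"
| match_inl: "match \<sigma> b b' \<Longrightarrow> match \<sigma> (Inl b) (Inl b')"
| match_inr: "match \<sigma> b b' \<Longrightarrow> match \<sigma> (Inr b) (Inr b')"
| match_succ: "match \<sigma> b b' \<Longrightarrow> match \<sigma> (Succ b) (Succ b')"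
| match_tensor: "\<lbrakk>match \<sigma>\<^sub>1 b\<^sub>1 b\<^sub>1'; match \<sigma>\<^sub>2 b\<^sub>2 b\<^sub>2'; dom \<sigma>\<^sub>1 \<inter> dom \<sigma>\<^sub>2 = {}\<rbrakk>
    \<Longrightarrow> match (\<sigma>\<^sub>1 ++ \<sigma>\<^sub>2) (Tensor b\<^sub>1 b\<^sub>2) (Tensor b\<^sub>1' b\<^sub>2')"


section \<open>Orthogonality and orthonormal bases\<close>

inductive orth :: "tm \<Rightarrow> tm \<Rightarrow> bool" (infix "\<bottom>\<^sub>t" 50) where
  orth_sym: "t\<^sub>1 \<bottom>\<^sub>t t\<^sub>2 \<Longrightarrow> t\<^sub>2 \<bottom>\<^sub>t t\<^sub>1"
| orth_inl_inr: "Inl t\<^sub>1 \<bottom>\<^sub>t Inr t\<^sub>2"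
| orth_zero_succ: "Zero \<bottom>\<^sub>t Succ t"
| orth_succ: "t\<^sub>1 \<bottom>\<^sub>t t\<^sub>2 \<Longrightarrow> Succ t\<^sub>1 \<bottom>\<^sub>t Succ t\<^sub>2"
| orth_inl: "t\<^sub>1 \<bottom>\<^sub>t t\<^sub>2 \<Longrightarrow> Inl t\<^sub>1 \<bottom>\<^sub>t Inl t\<^sub>2"
| orth_inr: "t\<^sub>1 \<bottom>\<^sub>t t\<^sub>2 \<Longrightarrow> Inr t\<^sub>1 \<bottom>\<^sub>t Inr t\<^sub>2"
| orth_app: "t\<^sub>1 \<bottom>\<^sub>t t\<^sub>2 \<Longrightarrow> App u t\<^sub>1 \<bottom>\<^sub>t App u t\<^sub>2"
| orth_tensor_right: "t\<^sub>1 \<bottom>\<^sub>t t\<^sub>2 \<Longrightarrow> Tensor t t\<^sub>1 \<bottom>\<^sub>t Tensor t' t\<^sub>2"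
| orth_tensor_left: "t\<^sub>1 \<bottom>\<^sub>t t\<^sub>2 \<Longrightarrow> Tensor t\<^sub>1 t \<bottom>\<^sub>t Tensor t\<^sub>2 t'"
| orth_sum: "\<forall>p\<in>set ts. t \<bottom>\<^sub>t snd p \<Longrightarrow> t \<bottom>\<^sub>t Sum ts"
| orth_sum_zero: "\<forall>p\<in>set ts \<union> set ts'. t \<bottom>\<^sub>t snd p \<Longrightarrow> t \<bottom>\<^sub>t Sum (ts @ (0, t) # ts')"
| orth_sums: "\<lbrakk>finite (I :: nat set); \<forall>i\<in>I. \<forall>j\<in>I. i \<noteq> j \<longrightarrow> t i \<bottom>\<^sub>t t j;
     distinct js; distinct ks; set js \<subseteq> I; set ks \<subseteq> I;
     (\<Sum>i\<in>set js \<inter> set ks. cnj (\<alpha> i) * \<beta> i) = 0\<rbrakk>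
    \<Longrightarrow> Sum (map (\<lambda>j. (\<alpha> j, t j)) js) \<bottom>\<^sub>t Sum (map (\<lambda>k. (\<beta> k, t k)) ks)"

definition tensor_set :: "tm set \<Rightarrow> bool" where
  "tensor_set S \<longleftrightarrow> (\<forall>s\<in>S. \<exists>b b'. s = Tensor b b')"

definition proj1 :: "tm set \<Rightarrow> tm set" where
  "proj1 S = {b. \<exists>b'. Tensor b b' \<in> S}"

definition proj2 :: "tm set \<Rightarrow> tm set" where
  "proj2 S = {b'. \<exists>b. Tensor b b' \<in> S}"

definition slice1 :: "tm set \<Rightarrow> tm \<Rightarrow> tm set" where
  "slice1 S b = {b'. Tensor b b' \<in> S}"

definition slice2 :: "tm set \<Rightarrow> tm \<Rightarrow> tm set" where
  "slice2 S b = {b'. Tensor b' b \<in> S}"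

inductive ONB :: "qty \<Rightarrow> tm set \<Rightarrow> bool" where
  ONB_var: "ONB Q {Var x}"
| ONB_star: "ONB QI {Star}"
| ONB_plus: "\<lbrakk>ONB Q\<^sub>1 S; ONB Q\<^sub>2 T\<rbrakk> \<Longrightarrow> ONB (QPlus Q\<^sub>1 Q\<^sub>2) (Inl ` S \<union> Inr ` T)"
| ONB_nat: "ONB QNat S \<Longrightarrow> ONB QNat ({Zero} \<union> Succ ` S)"
| ONB_tensor2: "\<lbrakk>tensor_set S; ONB Q\<^sub>2 (proj2 S); \<forall>b\<in>proj2 S. ONB Q\<^sub>1 (slice2 S b)\<rbrakk>
    \<Longrightarrow> ONB (QTensor Q\<^sub>1 Q\<^sub>2) S"
| ONB_tensor1: "\<lbrakk>tensor_set S; ONB Q\<^sub>1 (proj1 S); \<forall>b\<in>proj1 S. ONB Q\<^sub>2 (slice1 S b)\<rbrakk>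
    \<Longrightarrow> ONB (QTensor Q\<^sub>1 Q\<^sub>2) S"

definition unitary_on :: "'a set \<Rightarrow> ('a \<Rightarrow> 'a \<Rightarrow> complex) \<Rightarrow> bool" where
  "unitary_on S \<alpha> \<longleftrightarrow>
     (\<forall>a\<in>S. \<forall>b\<in>S. (\<Sum>c\<in>S. \<alpha> a c * cnj (\<alpha> b c)) = (if a = b then 1 else 0)) \<and>
     (\<forall>a\<in>S. \<forall>b\<in>S. (\<Sum>c\<in>S. cnj (\<alpha> c a) * \<alpha> c b) = (if a = b then 1 else 0))"

text \<open>In \<open>ONBe_unitary\<close>, \<open>en e\<close> lists the unordered index set \<open>S\<close> of the sum built for \<open>e\<close>.\<close>

inductive ONBe :: "qty \<Rightarrow> tm set \<Rightarrow> bool" where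
  ONBe_var: "ONBe Q {Var x}"
| ONBe_star: "ONBe QI {Star}"
| ONBe_plus: "\<lbrakk>ONBe Q\<^sub>1 S; ONBe Q\<^sub>2 T\<rbrakk> \<Longrightarrow> ONBe (QPlus Q\<^sub>1 Q\<^sub>2) (Inl ` S \<union> Inr ` T)"
| ONBe_nat: "ONBe QNat S \<Longrightarrow> ONBe QNat ({Zero} \<union> Succ ` S)"
| ONBe_tensor2: "\<lbrakk>tensor_set S; ONBe Q\<^sub>2 (proj2 S); \<forall>e\<in>proj2 S. ONBe Q\<^sub>1 (slice2 S e)\<rbrakk>
    \<Longrightarrow> ONBe (QTensor Q\<^sub>1 Q\<^sub>2) S"
| ONBe_tensor1: "\<lbrakk>tensor_set S; ONBe Q\<^sub>1 (proj1 S); \<forall>e\<in>proj1 S. ONBe Q\<^sub>2 (slice1 S e)\<rbrakk>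
    \<Longrightarrow> ONBe (QTensor Q\<^sub>1 Q\<^sub>2) S"
| ONBe_unitary: "\<lbrakk>ONBe Q S; unitary_on S \<alpha>; \<forall>e\<in>S. distinct (en e) \<and> set (en e) = S\<rbrakk>
    \<Longrightarrow> ONBe Q ((\<lambda>e. Sum (map (\<lambda>e'. (\<alpha> e e', e')) (en e))) ` S)"

lemma ONB_basis_value: "ONB Q S \<Longrightarrow> b \<in> S \<Longrightarrow> basis_value b"
proof (induction arbitrary: b rule: ONB.induct)
  case (ONB_tensor2 S Q\<^sub>2 Q\<^sub>1)
  then show ?case
    unfolding tensor_set_def proj2_def slice2_def by fastforce
next
  case (ONB_tensor1 S Q\<^sub>1 Q\<^sub>2)
  then show ?case
    unfolding tensor_set_def proj1_def slice1_def by fastforce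
qed auto

lemma ONBe_expression: "ONBe Q S \<Longrightarrow> e \<in> S \<Longrightarrow> expression e"
proof (induction arbitrary: e rule: ONBe.induct)
  case (ONBe_tensor2 S Q\<^sub>2 Q\<^sub>1)
  then show ?case
    unfolding tensor_set_def proj2_def slice2_def by fastforce
next
  case (ONBe_tensor1 S Q\<^sub>1 Q\<^sub>2)
  then show ?case
    unfolding tensor_set_def proj1_def slice1_def by fastforce
qed auto


section \<open>Typing\<close>

type_synonym ctx = "var \<rightharpoonup> qty"

inductive typed :: "ctx \<Rightarrow> tm \<Rightarrow> qty \<Rightarrow> bool" ("_ \<turnstile> _ \<Colon> _" [51, 51, 51] 50)
  and utyped :: "un \<Rightarrow> qty \<Rightarrow> qty \<Rightarrow> bool" ("\<tturnstile> _ \<Colon> U'(_, _')" [51, 0, 0] 50)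
where
  ty_star: "Map.empty \<turnstile> Star \<Colon> QI"
| ty_var: "[x \<mapsto> Q] \<turnstile> Var x \<Colon> Q"
| ty_tensor: "\<lbrakk>\<Gamma>\<^sub>1 \<turnstile> t\<^sub>1 \<Colon> Q\<^sub>1; \<Gamma>\<^sub>2 \<turnstile> t\<^sub>2 \<Colon> Q\<^sub>2; dom \<Gamma>\<^sub>1 \<inter> dom \<Gamma>\<^sub>2 = {}\<rbrakk>
    \<Longrightarrow> \<Gamma>\<^sub>1 ++ \<Gamma>\<^sub>2 \<turnstile> Tensor t\<^sub>1 t\<^sub>2 \<Colon> QTensor Q\<^sub>1 Q\<^sub>2"
| ty_inl: "\<Gamma> \<turnstile> t \<Colon> Q\<^sub>1 \<Longrightarrow> \<Gamma> \<turnstile> Inl t \<Colon> QPlus Q\<^sub>1 Q\<^sub>2"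
| ty_inr: "\<Gamma> \<turnstile> t \<Colon> Q\<^sub>2 \<Longrightarrow> \<Gamma> \<turnstile> Inr t \<Colon> QPlus Q\<^sub>1 Q\<^sub>2"
| ty_zero: "Map.empty \<turnstile> Zero \<Colon> QNat"
| ty_succ: "\<Gamma> \<turnstile> t \<Colon> QNat \<Longrightarrow> \<Gamma> \<turnstile> Succ t \<Colon> QNat"
| ty_sum: "\<lbrakk>\<forall>i<length ts. \<Gamma> \<turnstile> snd (ts ! i) \<Colon> Q;
     (\<Sum>i<length ts. (cmod (fst (ts ! i)))\<^sup>2) = 1;
     \<forall>i<length ts. \<forall>j<length ts. i \<noteq> j \<longrightarrow> snd (ts ! i) \<bottom>\<^sub>t snd (ts ! j)\<rbrakk>
    \<Longrightarrow> \<Gamma> \<turnstile> Sum ts \<Colon> Q"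
| ty_app: "\<lbrakk>\<tturnstile> u \<Colon> U(Q\<^sub>1, Q\<^sub>2); \<Gamma> \<turnstile> t \<Colon> Q\<^sub>1\<rbrakk> \<Longrightarrow> \<Gamma> \<turnstile> App u t \<Colon> Q\<^sub>2"
| ty_clauses: "\<lbrakk>\<forall>i<length cs. \<Delta> i \<turnstile> fst (cs ! i) \<Colon> Q\<^sub>1 \<and> \<Delta> i \<turnstile> snd (cs ! i) \<Colon> Q\<^sub>2;
     distinct (map fst cs); distinct (map snd cs);
     ONB Q\<^sub>1 (set (map fst cs)); ONBe Q\<^sub>2 (set (map snd cs))\<rbrakk>
    \<Longrightarrow> \<tturnstile> Clauses cs \<Colon> U(Q\<^sub>1, Q\<^sub>2)"
| ty_inv: "\<tturnstile> u \<Colon> U(Q\<^sub>1, Q\<^sub>2) \<Longrightarrow> \<tturnstile> UInv u \<Colon> U(Q\<^sub>2, Q\<^sub>1)"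
| ty_comp: "\<lbrakk>\<tturnstile> u\<^sub>1 \<Colon> U(Q\<^sub>1, Q\<^sub>2); \<tturnstile> u\<^sub>2 \<Colon> U(Q\<^sub>2, Q\<^sub>3)\<rbrakk> \<Longrightarrow> \<tturnstile> UComp u\<^sub>2 u\<^sub>1 \<Colon> U(Q\<^sub>1, Q\<^sub>3)"
| ty_utensor: "\<lbrakk>\<tturnstile> u\<^sub>1 \<Colon> U(Q\<^sub>1, Q\<^sub>2); \<tturnstile> u\<^sub>2 \<Colon> U(Q\<^sub>3, Q\<^sub>4)\<rbrakk>
    \<Longrightarrow> \<tturnstile> UTensor u\<^sub>1 u\<^sub>2 \<Colon> U(QTensor Q\<^sub>1 Q\<^sub>3, QTensor Q\<^sub>2 Q\<^sub>4)"
| ty_uplus: "\<lbrakk>\<tturnstile> u\<^sub>1 \<Colon> U(Q\<^sub>1, Q\<^sub>2); \<tturnstile> u\<^sub>2 \<Colon> U(Q\<^sub>3, Q\<^sub>4)\<rbrakk>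
    \<Longrightarrow> \<tturnstile> UPlus u\<^sub>1 u\<^sub>2 \<Colon> U(QPlus Q\<^sub>1 Q\<^sub>3, QPlus Q\<^sub>2 Q\<^sub>4)"
| ty_ctrl: "\<tturnstile> u \<Colon> U(Q, Q) \<Longrightarrow> \<tturnstile> UCtrl u \<Colon> U(QTensor qbit Q, QTensor qbit Q)"


section \<open>Equational theory\<close>

inductive eqn :: "(tm \<times> tm) set \<Rightarrow> ctx \<Rightarrow> tm \<Rightarrow> tm \<Rightarrow> qty \<Rightarrow> bool"
  for r :: "(tm \<times> tm) set"
where
  eq_refl: "\<Gamma> \<turnstile> t \<Colon> Q \<Longrightarrow> eqn r \<Gamma> t t Q"
| eq_sym: "eqn r \<Gamma> t\<^sub>1 t\<^sub>2 Q \<Longrightarrow> eqn r \<Gamma> t\<^sub>2 t\<^sub>1 Q"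
| eq_trans: "\<lbrakk>eqn r \<Gamma> t\<^sub>1 t\<^sub>2 Q; eqn r \<Gamma> t\<^sub>2 t\<^sub>3 Q\<rbrakk> \<Longrightarrow> eqn r \<Gamma> t\<^sub>1 t\<^sub>3 Q"
  \<comment> \<open>linear algebra\<close>
| eq_permute: "\<lbrakk>\<Gamma> \<turnstile> Sum ts \<Colon> Q; l permutes {..<length ts}\<rbrakk>
    \<Longrightarrow> eqn r \<Gamma> (Sum ts) (Sum (permute_list l ts)) Q"
| eq_zero: "\<Gamma> \<turnstile> Sum (ts @ [(0, t)]) \<Colon> Q \<Longrightarrow> eqn r \<Gamma> (Sum (ts @ [(0, t)])) (Sum ts) Q"
| eq_single: "\<Gamma> \<turnstile> Sum [(1, t)] \<Colon> Q \<Longrightarrow> eqn r \<Gamma> (Sum [(1, t)]) t Q"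
| eq_distrib:
    "\<Gamma> \<turnstile> Sum (map (\<lambda>i. (\<alpha> i, Sum (map (\<lambda>j. (\<beta> i j, t j)) [0..<n]))) [0..<m]) \<Colon> Q
    \<Longrightarrow> eqn r \<Gamma>
          (Sum (map (\<lambda>i. (\<alpha> i, Sum (map (\<lambda>j. (\<beta> i j, t j)) [0..<n]))) [0..<m]))
          (Sum (map (\<lambda>j. (\<Sum>i<m. \<alpha> i * \<beta> i j, t j)) [0..<n])) Q"
| eq_flatten:
    "\<lbrakk>\<Gamma> \<turnstile> Sum (map (\<lambda>i. (\<alpha> i, Sum (map (\<lambda>j. (\<beta> i j, t i j)) [0..<n]))) [0..<m]) \<Colon> Q;
      \<Gamma> \<turnstile> Sum (map (\<lambda>(i, j). (\<alpha> i * \<beta> i j, t i j)) (List.product [0..<m] [0..<n])) \<Colon> Q\<rbrakk>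
    \<Longrightarrow> eqn r \<Gamma>
          (Sum (map (\<lambda>i. (\<alpha> i, Sum (map (\<lambda>j. (\<beta> i j, t i j)) [0..<n]))) [0..<m]))
          (Sum (map (\<lambda>(i, j). (\<alpha> i * \<beta> i j, t i j)) (List.product [0..<m] [0..<n]))) Q"
| eq_app_sum: "\<Gamma> \<turnstile> App u (Sum ts) \<Colon> Q
    \<Longrightarrow> eqn r \<Gamma> (App u (Sum ts)) (Sum (map (\<lambda>(\<alpha>, t). (\<alpha>, App u t)) ts)) Q"
| eq_inl_sum: "\<Gamma> \<turnstile> Inl (Sum ts) \<Colon> Q
    \<Longrightarrow> eqn r \<Gamma> (Inl (Sum ts)) (Sum (map (\<lambda>(\<alpha>, t). (\<alpha>, Inl t)) ts)) Q"
| eq_inr_sum: "\<Gamma> \<turnstile> Inr (Sum ts) \<Colon> Q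
    \<Longrightarrow> eqn r \<Gamma> (Inr (Sum ts)) (Sum (map (\<lambda>(\<alpha>, t). (\<alpha>, Inr t)) ts)) Q"
| eq_succ_sum: "\<Gamma> \<turnstile> Succ (Sum ts) \<Colon> Q
    \<Longrightarrow> eqn r \<Gamma> (Succ (Sum ts)) (Sum (map (\<lambda>(\<alpha>, t). (\<alpha>, Succ t)) ts)) Q"
| eq_tensor_sum_right: "\<Gamma> \<turnstile> Tensor s (Sum ts) \<Colon> Q
    \<Longrightarrow> eqn r \<Gamma> (Tensor s (Sum ts)) (Sum (map (\<lambda>(\<alpha>, t). (\<alpha>, Tensor s t)) ts)) Q"
| eq_tensor_sum_left: "\<Gamma> \<turnstile> Tensor (Sum ts) s \<Colon> Q
    \<Longrightarrow> eqn r \<Gamma> (Tensor (Sum ts) s) (Sum (map (\<lambda>(\<alpha>, t). (\<alpha>, Tensor t s)) ts)) Q"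
  \<comment> \<open>congruence\<close>
| eq_app_cong: "\<lbrakk>\<tturnstile> u \<Colon> U(Q\<^sub>1, Q\<^sub>2); eqn r \<Gamma> t\<^sub>1 t\<^sub>2 Q\<^sub>1\<rbrakk> \<Longrightarrow> eqn r \<Gamma> (App u t\<^sub>1) (App u t\<^sub>2) Q\<^sub>2"
| eq_inl_cong: "eqn r \<Gamma> t\<^sub>1 t\<^sub>2 Q\<^sub>1 \<Longrightarrow> eqn r \<Gamma> (Inl t\<^sub>1) (Inl t\<^sub>2) (QPlus Q\<^sub>1 Q\<^sub>2)"
| eq_inr_cong: "eqn r \<Gamma> t\<^sub>1 t\<^sub>2 Q\<^sub>2 \<Longrightarrow> eqn r \<Gamma> (Inr t\<^sub>1) (Inr t\<^sub>2) (QPlus Q\<^sub>1 Q\<^sub>2)"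
| eq_succ_cong: "eqn r \<Gamma> t\<^sub>1 t\<^sub>2 QNat \<Longrightarrow> eqn r \<Gamma> (Succ t\<^sub>1) (Succ t\<^sub>2) QNat"
| eq_tensor_cong_right: "\<lbrakk>\<Gamma> \<turnstile> t \<Colon> Q\<^sub>1; eqn r \<Gamma>' t\<^sub>1 t\<^sub>2 Q\<^sub>2; dom \<Gamma> \<inter> dom \<Gamma>' = {}\<rbrakk>
    \<Longrightarrow> eqn r (\<Gamma> ++ \<Gamma>') (Tensor t t\<^sub>1) (Tensor t t\<^sub>2) (QTensor Q\<^sub>1 Q\<^sub>2)"
| eq_tensor_cong_left: "\<lbrakk>eqn r \<Gamma> t\<^sub>1 t\<^sub>2 Q\<^sub>1; \<Gamma>' \<turnstile> t \<Colon> Q\<^sub>2; dom \<Gamma> \<inter> dom \<Gamma>' = {}\<rbrakk>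
    \<Longrightarrow> eqn r (\<Gamma> ++ \<Gamma>') (Tensor t\<^sub>1 t) (Tensor t\<^sub>2 t) (QTensor Q\<^sub>1 Q\<^sub>2)"
| eq_sum_cong: "\<lbrakk>\<Gamma> \<turnstile> Sum (map (\<lambda>i. (\<alpha> i, t i)) [0..<n]) \<Colon> Q; \<forall>i<n. eqn r \<Gamma> (t i) (t' i) Q\<rbrakk>
    \<Longrightarrow> eqn r \<Gamma> (Sum (map (\<lambda>i. (\<alpha> i, t i)) [0..<n])) (Sum (map (\<lambda>i. (\<alpha> i, t' i)) [0..<n])) Q"
  \<comment> \<open>computation; typability in the empty context expresses closedness\<close>
| eq_clauses: "\<lbrakk>\<tturnstile> Clauses cs \<Colon> U(Q\<^sub>1, Q\<^sub>2); basis_value b'; Map.empty \<turnstile> b' \<Colon> Q\<^sub>1;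
     (b, e) \<in> set cs; match \<sigma> b b'\<rbrakk>
    \<Longrightarrow> eqn r Map.empty (App (Clauses cs) b') (subst \<sigma> e) Q\<^sub>2"
| eq_inv: "\<lbrakk>\<tturnstile> u \<Colon> U(Q\<^sub>1, Q\<^sub>2); basis_value b; Map.empty \<turnstile> b \<Colon> Q\<^sub>1;
     is_value r v; Map.empty \<turnstile> v \<Colon> Q\<^sub>2; eqn r Map.empty (App u b) v Q\<^sub>2\<rbrakk>
    \<Longrightarrow> eqn r Map.empty (App (UInv u) v) b Q\<^sub>1"
| eq_comp: "\<lbrakk>\<tturnstile> u\<^sub>1 \<Colon> U(Q\<^sub>1, Q\<^sub>2); \<tturnstile> u\<^sub>2 \<Colon> U(Q\<^sub>2, Q\<^sub>3); basis_value b; \<Gamma> \<turnstile> b \<Colon> Q\<^sub>1\<rbrakk>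
    \<Longrightarrow> eqn r \<Gamma> (App (UComp u\<^sub>2 u\<^sub>1) b) (App u\<^sub>2 (App u\<^sub>1 b)) Q\<^sub>3"
| eq_utensor: "\<lbrakk>\<tturnstile> u\<^sub>1 \<Colon> U(Q\<^sub>1, Q\<^sub>2); \<tturnstile> u\<^sub>2 \<Colon> U(Q\<^sub>3, Q\<^sub>4);
     basis_value b\<^sub>1; Map.empty \<turnstile> b\<^sub>1 \<Colon> Q\<^sub>1; basis_value b\<^sub>2; Map.empty \<turnstile> b\<^sub>2 \<Colon> Q\<^sub>3\<rbrakk>
    \<Longrightarrow> eqn r Map.empty (App (UTensor u\<^sub>1 u\<^sub>2) (Tensor b\<^sub>1 b\<^sub>2)) (Tensor (App u\<^sub>1 b\<^sub>1) (App u\<^sub>2 b\<^sub>2))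
          (QTensor Q\<^sub>2 Q\<^sub>4)"
| eq_uplus_inl: "\<lbrakk>\<tturnstile> u\<^sub>1 \<Colon> U(Q\<^sub>1, Q\<^sub>2); \<tturnstile> u\<^sub>2 \<Colon> U(Q\<^sub>3, Q\<^sub>4); basis_value b; Map.empty \<turnstile> b \<Colon> Q\<^sub>1\<rbrakk>
    \<Longrightarrow> eqn r Map.empty (App (UPlus u\<^sub>1 u\<^sub>2) (Inl b)) (Inl (App u\<^sub>1 b)) (QPlus Q\<^sub>2 Q\<^sub>4)"
| eq_uplus_inr: "\<lbrakk>\<tturnstile> u\<^sub>1 \<Colon> U(Q\<^sub>1, Q\<^sub>2); \<tturnstile> u\<^sub>2 \<Colon> U(Q\<^sub>3, Q\<^sub>4); basis_value b; Map.empty \<turnstile> b \<Colon> Q\<^sub>3\<rbrakk>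
    \<Longrightarrow> eqn r Map.empty (App (UPlus u\<^sub>1 u\<^sub>2) (Inr b)) (Inr (App u\<^sub>2 b)) (QPlus Q\<^sub>2 Q\<^sub>4)"
| eq_ctrl_inl: "\<lbrakk>\<tturnstile> u \<Colon> U(Q, Q); basis_value b; Map.empty \<turnstile> b \<Colon> Q\<rbrakk>
    \<Longrightarrow> eqn r Map.empty (App (UCtrl u) (Tensor (Inl Star) b)) (Tensor (Inl Star) b)
          (QTensor qbit Q)"
| eq_ctrl_inr: "\<lbrakk>\<tturnstile> u \<Colon> U(Q, Q); basis_value b; Map.empty \<turnstile> b \<Colon> Q\<rbrakk>
    \<Longrightarrow> eqn r Map.empty (App (UCtrl u) (Tensor (Inr Star) b)) (Tensor (Inr Star) (App u b))
          (QTensor qbit Q)"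


section \<open>Hilbert spaces and operators\<close>

text \<open>
  The Hilbert space with orthonormal basis \<open>A\<close> is \<open>\<ell>\<^sup>2(A)\<close>, its vectors being the
  square-summable functions vanishing outside \<open>A\<close>.  An operator out of \<open>\<ell>\<^sup>2(A)\<close> is a function
  with arbitrary value \<open>undefined\<close> outside \<open>ell2 A\<close> (\<open>restrict\<close>), so that HOL equality
  is equality of operators.
\<close>

definition ell2 :: "'i set \<Rightarrow> ('i \<Rightarrow> complex) set" where
  "ell2 A = {f. (\<forall>i. i \<notin> A \<longrightarrow> f i = 0) \<and> (\<lambda>i. (cmod (f i))\<^sup>2) summable_on UNIV}"

definition inner2 :: "('i \<Rightarrow> complex) \<Rightarrow> ('i \<Rightarrow> complex) \<Rightarrow> complex" where
  "inner2 f g = (\<Sum>\<^sub>\<infinity>i. cnj (f i) * g i)"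

definition ket :: "'i \<Rightarrow> 'i \<Rightarrow> complex" where
  "ket a = (\<lambda>i. if i = a then 1 else 0)"

text \<open>
  The adjoint of a bounded operator \<open>T\<close> from \<open>\<ell>\<^sup>2(A)\<close> to \<open>\<ell>\<^sup>2(B)\<close>, given by its coordinates
  \<open>\<langle>a|T\<^sup>*y\<rangle> = \<langle>T a|y\<rangle>\<close>.
\<close>

definition adj :: "'a set \<Rightarrow> 'b set \<Rightarrow> (('a \<Rightarrow> complex) \<Rightarrow> 'b \<Rightarrow> complex) \<Rightarrow> ('b \<Rightarrow> complex) \<Rightarrow> 'a \<Rightarrow> complex"
  where "adj A B T = (\<lambda>y\<in>ell2 B. \<lambda>a. if a \<in> A then inner2 (T (ket a)) y else 0)"

lemma ket_ell2: "a \<in> A \<Longrightarrow> ket a \<in> ell2 A"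
  unfolding ell2_def ket_def
  by (auto intro!: finite_nonzero_values_imp_summable_on intro: finite_subset[of _ "{a}"])

lemma inner2_ket: "inner2 (ket a) f = f a"
proof -
  have "inner2 (ket a) f = (\<Sum>\<^sub>\<infinity>i\<in>{a}. cnj (ket a i) * f i)"
    unfolding inner2_def by (rule infsum_cong_neutral) (auto simp: ket_def)
  then show ?thesis by (simp add: ket_def)
qed

lemma adj_unique:
  assumes S: "S \<in> ell2 B \<rightarrow>\<^sub>E ell2 A"
    and adjoint: "\<And>x y. x \<in> ell2 A \<Longrightarrow> y \<in> ell2 B \<Longrightarrow> inner2 (T x) y = inner2 x (S y)"
  shows "S = adj A B T"
proof
  fix y
  show "S y = adj A B T y"
  proof (cases "y \<in> ell2 B")
    case True
    then have "S y \<in> ell2 A" using S by auto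
    then have "S y a = (if a \<in> A then inner2 (T (ket a)) y else 0)" for a
      using adjoint[OF ket_ell2 True, of a] inner2_ket[of a "S y"] by (auto simp: ell2_def)
    then show ?thesis using True by (auto simp: adj_def)
  next
    case False
    then show ?thesis using S by (auto simp: adj_def PiE_def extensional_def)
  qed
qed

datatype idx = IStar | IInl idx | IInr idx | IPair idx idx | INum nat

fun ix :: "qty \<Rightarrow> idx set" where
  "ix QI = {IStar}"
| "ix (QPlus Q\<^sub>1 Q\<^sub>2) = IInl ` ix Q\<^sub>1 \<union> IInr ` ix Q\<^sub>2"
| "ix (QTensor Q\<^sub>1 Q\<^sub>2) = (\<lambda>(i, j). IPair i j) ` (ix Q\<^sub>1 \<times> ix Q\<^sub>2)"
| "ix QNat = range INum"

text \<open>
  A basis vector of the unordered tensor product \<open>\<Otimes>\<^sub>x \<lbrakk>\<Gamma>(x)\<rbrakk>\<close> chooses a basis vector of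
  \<open>\<lbrakk>\<Gamma>(x)\<rbrakk>\<close> for each \<open>x\<close>; for the empty context this gives \<open>\<complex>\<close>.
\<close>

definition cix :: "ctx \<Rightarrow> (var \<rightharpoonup> idx) set" where
  "cix \<Gamma> = {\<rho>. dom \<rho> = dom \<Gamma> \<and> (\<forall>x Q i. \<Gamma> x = Some Q \<longrightarrow> \<rho> x = Some i \<longrightarrow> i \<in> ix Q)}"

definition hilb :: "qty \<Rightarrow> (idx \<Rightarrow> complex) set" where
  "hilb Q = ell2 (ix Q)"

definition chilb :: "ctx \<Rightarrow> ((var \<rightharpoonup> idx) \<Rightarrow> complex) set" where
  "chilb \<Gamma> = ell2 (cix \<Gamma>)"

definition inj_l :: "(idx \<Rightarrow> complex) \<Rightarrow> idx \<Rightarrow> complex" where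
  "inj_l f = (\<lambda>k. case k of IInl i \<Rightarrow> f i | _ \<Rightarrow> 0)"

definition inj_r :: "(idx \<Rightarrow> complex) \<Rightarrow> idx \<Rightarrow> complex" where
  "inj_r f = (\<lambda>k. case k of IInr i \<Rightarrow> f i | _ \<Rightarrow> 0)"

definition shift :: "(idx \<Rightarrow> complex) \<Rightarrow> idx \<Rightarrow> complex" where
  "shift f = (\<lambda>k. case k of INum (Suc n) \<Rightarrow> f (INum n) | _ \<Rightarrow> 0)"

definition projector :: "'i \<Rightarrow> ('i \<Rightarrow> complex) \<Rightarrow> 'i \<Rightarrow> complex" where
  "projector a f = (\<lambda>i. if i = a then f i else 0)"

definition op_plus :: "((idx \<Rightarrow> complex) \<Rightarrow> idx \<Rightarrow> complex) \<Rightarrow> ((idx \<Rightarrow> complex) \<Rightarrow> idx \<Rightarrow> complex)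
    \<Rightarrow> (idx \<Rightarrow> complex) \<Rightarrow> idx \<Rightarrow> complex" where
  "op_plus S T f = (\<lambda>k. inj_l (S (\<lambda>i. f (IInl i))) k + inj_r (T (\<lambda>i. f (IInr i))) k)"

text \<open>
  \<open>S \<otimes> T\<close> is computed as \<open>(S \<otimes> id) \<circ> (id \<otimes> T)\<close>: first \<open>T\<close> is applied in the second coordinate,
  then \<open>S\<close> in the first.
\<close>

definition op_tensor :: "(('a \<Rightarrow> complex) \<Rightarrow> idx \<Rightarrow> complex) \<Rightarrow> (('b \<Rightarrow> complex) \<Rightarrow> idx \<Rightarrow> complex)
    \<Rightarrow> ('a \<times> 'b \<Rightarrow> complex) \<Rightarrow> idx \<Rightarrow> complex" where
  "op_tensor S T h = (\<lambda>k. case k of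
      IPair i j \<Rightarrow> S (\<lambda>a. T (\<lambda>b. h (a, b)) j) i
    | _ \<Rightarrow> 0)"

lemma op_tensor_simple:
  assumes "\<And>c f. f \<in> ell2 A \<Longrightarrow> S (\<lambda>a. c * f a) = (\<lambda>i. c * S f i)"
    and "\<And>c g. g \<in> ell2 B \<Longrightarrow> T (\<lambda>b. c * g b) = (\<lambda>j. c * T g j)"
    and "f \<in> ell2 A" "g \<in> ell2 B"
  shows "op_tensor S T (\<lambda>(a, b). f a * g b) (IPair i j) = S f i * T g j"
  using assms(1)[of f "T g j"] assms(2)[of g] assms(3,4)
  by (simp add: op_tensor_def mult.commute)

definition uncurry_idx :: "(idx \<Rightarrow> complex) \<Rightarrow> idx \<times> idx \<Rightarrow> complex" where
  "uncurry_idx f = (\<lambda>(i, j). f (IPair i j))"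

text \<open>The canonical isomorphism \<open>\<lbrakk>\<Gamma>\<^sub>1, \<Gamma>\<^sub>2\<rbrakk> \<cong> \<lbrakk>\<Gamma>\<^sub>1\<rbrakk> \<otimes> \<lbrakk>\<Gamma>\<^sub>2\<rbrakk>\<close>, \<open>|\<rho>\<^sub>1 ++ \<rho>\<^sub>2\<rangle> \<mapsto> |\<rho>\<^sub>1\<rangle> \<otimes> |\<rho>\<^sub>2\<rangle>\<close>.\<close>

definition split_ctx :: "ctx \<Rightarrow> ctx \<Rightarrow> ((var \<rightharpoonup> idx) \<Rightarrow> complex)
    \<Rightarrow> (var \<rightharpoonup> idx) \<times> (var \<rightharpoonup> idx) \<Rightarrow> complex" where
  "split_ctx \<Gamma>\<^sub>1 \<Gamma>\<^sub>2 f = (\<lambda>(\<rho>\<^sub>1, \<rho>\<^sub>2). if \<rho>\<^sub>1 \<in> cix \<Gamma>\<^sub>1 \<and> \<rho>\<^sub>2 \<in> cix \<Gamma>\<^sub>2 then f (\<rho>\<^sub>1 ++ \<rho>\<^sub>2) else 0)"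


section \<open>Denotational semantics\<close>

text \<open>
  \<open>den \<Gamma> t Q F\<close> holds if \<open>F\<close> is the interpretation of some derivation of \<open>\<Gamma> \<turnstile> t \<Colon> Q\<close>.
  Derivations of one judgement can differ in the intermediate types at \<open>App\<close> and \<open>UComp\<close>;
  their interpretations agree.
\<close>

inductive den :: "ctx \<Rightarrow> tm \<Rightarrow> qty \<Rightarrow> (((var \<rightharpoonup> idx) \<Rightarrow> complex) \<Rightarrow> idx \<Rightarrow> complex) \<Rightarrow> bool"
  and uden :: "un \<Rightarrow> qty \<Rightarrow> qty \<Rightarrow> ((idx \<Rightarrow> complex) \<Rightarrow> idx \<Rightarrow> complex) \<Rightarrow> bool"
where
  den_star: "den Map.empty Star QI (\<lambda>f\<in>chilb Map.empty. \<lambda>i. f Map.empty * ket IStar i)"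
| den_var: "den [x \<mapsto> Q] (Var x) Q (\<lambda>f\<in>chilb [x \<mapsto> Q]. \<lambda>i. f [x \<mapsto> i])"
| den_tensor: "\<lbrakk>den \<Gamma>\<^sub>1 t\<^sub>1 Q\<^sub>1 F\<^sub>1; den \<Gamma>\<^sub>2 t\<^sub>2 Q\<^sub>2 F\<^sub>2; dom \<Gamma>\<^sub>1 \<inter> dom \<Gamma>\<^sub>2 = {}\<rbrakk>
    \<Longrightarrow> den (\<Gamma>\<^sub>1 ++ \<Gamma>\<^sub>2) (Tensor t\<^sub>1 t\<^sub>2) (QTensor Q\<^sub>1 Q\<^sub>2)
          (\<lambda>f\<in>chilb (\<Gamma>\<^sub>1 ++ \<Gamma>\<^sub>2). op_tensor F\<^sub>1 F\<^sub>2 (split_ctx \<Gamma>\<^sub>1 \<Gamma>\<^sub>2 f))"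
| den_inl: "den \<Gamma> t Q\<^sub>1 F \<Longrightarrow> den \<Gamma> (Inl t) (QPlus Q\<^sub>1 Q\<^sub>2) (compose (chilb \<Gamma>) inj_l F)"
| den_inr: "den \<Gamma> t Q\<^sub>2 F \<Longrightarrow> den \<Gamma> (Inr t) (QPlus Q\<^sub>1 Q\<^sub>2) (compose (chilb \<Gamma>) inj_r F)"
| den_zero: "den Map.empty Zero QNat (\<lambda>f\<in>chilb Map.empty. \<lambda>i. f Map.empty * ket (INum 0) i)"
| den_succ: "den \<Gamma> t QNat F \<Longrightarrow> den \<Gamma> (Succ t) QNat (compose (chilb \<Gamma>) shift F)"
| den_sum: "\<lbrakk>\<Gamma> \<turnstile> Sum ts \<Colon> Q; \<forall>i<length ts. den \<Gamma> (snd (ts ! i)) Q (F i)\<rbrakk>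
    \<Longrightarrow> den \<Gamma> (Sum ts) Q (\<lambda>f\<in>chilb \<Gamma>. \<lambda>k. \<Sum>i<length ts. fst (ts ! i) * F i f k)"
| den_app: "\<lbrakk>uden u Q\<^sub>1 Q\<^sub>2 T; den \<Gamma> t Q\<^sub>1 F\<rbrakk> \<Longrightarrow> den \<Gamma> (App u t) Q\<^sub>2 (compose (chilb \<Gamma>) T F)"
| uden_clauses: "\<lbrakk>\<tturnstile> Clauses cs \<Colon> U(Q\<^sub>1, Q\<^sub>2);
     \<forall>i<length cs. den (\<Delta> i) (fst (cs ! i)) Q\<^sub>1 (B i) \<and> den (\<Delta> i) (snd (cs ! i)) Q\<^sub>2 (E i)\<rbrakk>
    \<Longrightarrow> uden (Clauses cs) Q\<^sub>1 Q\<^sub>2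
          (\<lambda>f\<in>hilb Q\<^sub>1. \<lambda>k. \<Sum>i<length cs. E i (adj (cix (\<Delta> i)) (ix Q\<^sub>1) (B i) f) k)"
| uden_inv: "uden u Q\<^sub>1 Q\<^sub>2 T \<Longrightarrow> uden (UInv u) Q\<^sub>2 Q\<^sub>1 (adj (ix Q\<^sub>1) (ix Q\<^sub>2) T)"
| uden_comp: "\<lbrakk>uden u\<^sub>1 Q\<^sub>1 Q\<^sub>2 T\<^sub>1; uden u\<^sub>2 Q\<^sub>2 Q\<^sub>3 T\<^sub>2\<rbrakk>
    \<Longrightarrow> uden (UComp u\<^sub>2 u\<^sub>1) Q\<^sub>1 Q\<^sub>3 (compose (hilb Q\<^sub>1) T\<^sub>2 T\<^sub>1)"
| uden_utensor: "\<lbrakk>uden u\<^sub>1 Q\<^sub>1 Q\<^sub>2 T\<^sub>1; uden u\<^sub>2 Q\<^sub>3 Q\<^sub>4 T\<^sub>2\<rbrakk>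
    \<Longrightarrow> uden (UTensor u\<^sub>1 u\<^sub>2) (QTensor Q\<^sub>1 Q\<^sub>3) (QTensor Q\<^sub>2 Q\<^sub>4)
          (\<lambda>f\<in>hilb (QTensor Q\<^sub>1 Q\<^sub>3). op_tensor T\<^sub>1 T\<^sub>2 (uncurry_idx f))"
| uden_uplus: "\<lbrakk>uden u\<^sub>1 Q\<^sub>1 Q\<^sub>2 T\<^sub>1; uden u\<^sub>2 Q\<^sub>3 Q\<^sub>4 T\<^sub>2\<rbrakk>
    \<Longrightarrow> uden (UPlus u\<^sub>1 u\<^sub>2) (QPlus Q\<^sub>1 Q\<^sub>3) (QPlus Q\<^sub>2 Q\<^sub>4)
          (\<lambda>f\<in>hilb (QPlus Q\<^sub>1 Q\<^sub>3). op_plus T\<^sub>1 T\<^sub>2 f)"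
| uden_ctrl: "uden u Q Q T
    \<Longrightarrow> uden (UCtrl u) (QTensor qbit Q) (QTensor qbit Q)
          (\<lambda>f\<in>hilb (QTensor qbit Q). \<lambda>k.
             op_tensor (projector (IInl IStar)) (\<lambda>g. g) (uncurry_idx f) k +
             op_tensor (projector (IInr IStar)) T (uncurry_idx f) k)"

definition sem :: "ctx \<Rightarrow> tm \<Rightarrow> qty \<Rightarrow> ((var \<rightharpoonup> idx) \<Rightarrow> complex) \<Rightarrow> idx \<Rightarrow> complex"
    ("\<lbrakk>_ \<turnstile> _ \<Colon> _\<rbrakk>") where
  "\<lbrakk>\<Gamma> \<turnstile> t \<Colon> Q\<rbrakk> = (THE F. den \<Gamma> t Q F)"

lemma typed_imp_den:
  "\<Gamma> \<turnstile> t \<Colon> Q \<Longrightarrow> \<exists>F. den \<Gamma> t Q F"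
  "\<tturnstile> u \<Colon> U(Q\<^sub>1, Q\<^sub>2) \<Longrightarrow> \<exists>T. uden u Q\<^sub>1 Q\<^sub>2 T"
proof (induction rule: typed_utyped.inducts)
  case (ty_sum ts \<Gamma> Q)
  then have "\<Gamma> \<turnstile> Sum ts \<Colon> Q" by (auto intro: typed_utyped.ty_sum)
  moreover obtain F where "\<forall>i<length ts. den \<Gamma> (snd (ts ! i)) Q (F i)"
    using ty_sum by metis
  ultimately show ?case by (blast intro: den_sum)
next
  case (ty_clauses cs \<Delta> Q\<^sub>1 Q\<^sub>2)
  then have "\<tturnstile> Clauses cs \<Colon> U(Q\<^sub>1, Q\<^sub>2)" by (auto intro: typed_utyped.ty_clauses)
  moreover obtain B where "\<forall>i<length cs. den (\<Delta> i) (fst (cs ! i)) Q\<^sub>1 (B i)"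
    using ty_clauses by metis
  moreover obtain E where "\<forall>i<length cs. den (\<Delta> i) (snd (cs ! i)) Q\<^sub>2 (E i)"
    using ty_clauses by metis
  ultimately show ?case by (blast intro: uden_clauses)
qed (blast intro: den_uden.intros)+

end

theory Submission
  imports Defs "HOL-Library.Groups_Big_Fun"
begin

text \<open>
  Every unitary denotes a matrix with finitely many nonzero entries in each row and column, because
  clauses send basis values to finite sums; hence all computations with coordinates are finite, and
  square summability matters only for seeing that a unitary matrix preserves it.  Reading terms
  as coordinate vectors gives a semantics that does not depend on types, agrees with the
  denotational one on closed terms, and is invariant under the equations.  Conversely every closed
  term is provably equal to the sum of basis values with its coordinates as coefficients, so that
  closed terms with the same denotation have the same normal form.  This rests on two facts:
  syntactic orthogonality implies orthogonality of the denotations, which keeps the sums arising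
  during normalization well-formed, and an orthonormal basis in the syntactic sense denotes one,
  which makes the interpretation of clauses unitary and so allows \<open>u\<^sup>*\<close> to be evaluated.
\<close>

section \<open>Finitary matrices\<close>

text \<open>Terms and unitaries are mutually recursive, but unitarity can be settled before any
  claim about general terms: both sides of a clause are expressions, which contain no applications.
  A genuine circle joins norms and orthogonality. A well-formed sum has norm one because its
  summands are orthogonal, while two sums over shared summands are orthogonal only if those summands
  have norm one; a bound on the size of terms breaks this circle. A further obstacle is that
  \<open>App u t\<close> does not record the source type of \<open>u\<close>; it is recovered from
  the nonzero rows of the matrix of \<open>u\<close>. Normalization is no rewriting argument but an
  induction on typing derivations. As right-hand sides of clauses are open, the claim for terms
  quantifies over all ways of closing them by basis values, and the claim for a unitary concerns
  only its action on closed basis values; linearity gives the rest. Summands are expanded over one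
  common list of basis values, zero coefficients included, so that the distributive law for shared
  terms applies.\<close>

text \<open>
  Vectors are arbitrary functions and \<open>Sum_any\<close> is \<open>0\<close> on families of infinite support, so the
  definitions below carry their usual meaning only when the supports involved are finite.
\<close>

definition mapp :: "('a \<Rightarrow> 'b \<Rightarrow> complex) \<Rightarrow> ('a \<Rightarrow> complex) \<Rightarrow> 'b \<Rightarrow> complex" where
  "mapp M f k = Sum_any (\<lambda>i. f i * M i k)"

definition madj :: "('a \<Rightarrow> 'b \<Rightarrow> complex) \<Rightarrow> 'b \<Rightarrow> 'a \<Rightarrow> complex" where
  "madj M k i = cnj (M i k)"

definition ip :: "('a \<Rightarrow> complex) \<Rightarrow> ('a \<Rightarrow> complex) \<Rightarrow> complex" where
  "ip v w = Sum_any (\<lambda>k. cnj (v k) * w k)"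

definition isometric :: "'a set \<Rightarrow> 'b set \<Rightarrow> ('a \<Rightarrow> 'b \<Rightarrow> complex) \<Rightarrow> bool" where
  "isometric A B M \<longleftrightarrow>
     (\<forall>i\<in>A. finite {k. M i k \<noteq> 0} \<and> {k. M i k \<noteq> 0} \<subseteq> B) \<and>
     (\<forall>i\<in>A. \<forall>j\<in>A. ip (M i) (M j) = (if i = j then 1 else 0))"

text \<open>The row \<open>M i\<close> is the image of the basis vector \<open>i\<close>. For
  infinite index sets orthonormal rows do not imply orthonormal columns, so both are demanded. The
  two support conditions together make every entry vanish that joins \<open>A\<close> to the outside
  of \<open>B\<close> or \<open>B\<close> to the outside of \<open>A\<close>.\<close>

definition unitary_mat :: "'a set \<Rightarrow> 'b set \<Rightarrow> ('a \<Rightarrow> 'b \<Rightarrow> complex) \<Rightarrow> bool" where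
  "unitary_mat A B M \<longleftrightarrow> isometric A B M \<and> isometric B A (madj M)"

section \<open>Finitely supported sums, inner products and composition of matrices\<close>

lemma Sum_any_eq_sum: "finite A \<Longrightarrow> (\<And>a. a \<notin> A \<Longrightarrow> g a = 0) \<Longrightarrow> Sum_any g = sum g A"
  by (rule Sum_any.expand_superset) auto

lemma Sum_any_zero: "(\<And>a. g a = 0) \<Longrightarrow> Sum_any g = 0"
  by simp

lemma cnj_Sum_any: "cnj (Sum_any g) = Sum_any (\<lambda>a. cnj (g a))"
  by (simp add: Sum_any.expand_set)

lemma Sum_any_nonzero: "Sum_any g \<noteq> 0 \<Longrightarrow> \<exists>a. g a \<noteq> 0"
  by (erule Sum_any.not_neutral_obtains_not_neutral) blast

lemma mapp_eq_sum:
  "finite A \<Longrightarrow> (\<And>i. i \<notin> A \<Longrightarrow> f i = 0 \<or> M i k = 0) \<Longrightarrow> mapp M f k = (\<Sum>i\<in>A. f i * M i k)"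
  unfolding mapp_def by (rule Sum_any_eq_sum) auto

lemma ip_eq_sum:
  "finite A \<Longrightarrow> (\<And>i. i \<notin> A \<Longrightarrow> v i = 0 \<or> w i = 0) \<Longrightarrow> ip v w = (\<Sum>i\<in>A. cnj (v i) * w i)"
  unfolding ip_def by (rule Sum_any_eq_sum) auto

lemma mapp_nonzero: "mapp M f k \<noteq> 0 \<Longrightarrow> \<exists>i. f i \<noteq> 0 \<and> M i k \<noteq> 0"
  unfolding mapp_def by (drule Sum_any_nonzero) auto

lemma ip_nonzero: "ip v w \<noteq> 0 \<Longrightarrow> \<exists>i. v i \<noteq> 0 \<and> w i \<noteq> 0"
  unfolding ip_def by (drule Sum_any_nonzero) auto

lemma cnj_ip: "cnj (ip v w) = ip w v"
  unfolding ip_def cnj_Sum_any by (simp add: mult.commute)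

lemma ip_commute_zero: "ip v w = 0 \<Longrightarrow> ip w v = 0"
  by (metis cnj_ip complex_cnj_zero)

lemma ket_nonzero_iff [simp]: "ket a k \<noteq> 0 \<longleftrightarrow> k = a"
  by (simp add: ket_def)

lemma ket_zero_iff [simp]: "ket a k = 0 \<longleftrightarrow> k \<noteq> a"
  by (simp add: ket_def)

lemma ket_apply: "ket a k = (if k = a then 1 else 0)"
  by (simp add: ket_def)

lemma ip_ket_left: "ip (ket a) w = w a"
  by (subst ip_eq_sum[of "{a}"]) (auto simp: ket_def)

lemma ip_ket_right: "ip v (ket a) = cnj (v a)"
  by (subst ip_eq_sum[of "{a}"]) (auto simp: ket_def)

lemma mapp_ket: "mapp M (ket a) = M a"
  by (rule ext, subst mapp_eq_sum[of "{a}"]) (auto simp: ket_def)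

lemma isometricD:
  assumes "isometric A B M" "i \<in> A"
  shows "finite {k. M i k \<noteq> 0}" "M i k \<noteq> 0 \<Longrightarrow> k \<in> B"
    "j \<in> A \<Longrightarrow> ip (M i) (M j) = (if i = j then 1 else 0)"
  using assms unfolding isometric_def by auto

lemma isometricI:
  assumes "\<And>i. i \<in> A \<Longrightarrow> finite {k. M i k \<noteq> 0}"
    and "\<And>i k. i \<in> A \<Longrightarrow> M i k \<noteq> 0 \<Longrightarrow> k \<in> B"
    and "\<And>i j. i \<in> A \<Longrightarrow> j \<in> A \<Longrightarrow> ip (M i) (M j) = (if i = j then 1 else 0)"
  shows "isometric A B M"
  using assms unfolding isometric_def by blast

lemma isometric_row_nonzero:
  assumes "isometric A B M" "i \<in> A"
  shows "\<exists>k. M i k \<noteq> 0"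
proof -
  have "ip (M i) (M i) \<noteq> 0" using isometricD(3)[OF assms assms(2)] by simp
  then show ?thesis using ip_nonzero by blast
qed

lemma madj_madj [simp]: "madj (madj M) = M"
  by (simp add: madj_def fun_eq_iff)

lemma madj_nonzero [simp]: "madj M k i = 0 \<longleftrightarrow> M i k = 0"
  by (simp add: madj_def)

lemma unitary_adj: "unitary_mat A B M \<Longrightarrow> unitary_mat B A (madj M)"
  by (simp add: unitary_mat_def)

lemma unitaryD:
  assumes "unitary_mat A B M"
  shows "i \<in> A \<Longrightarrow> finite {k. M i k \<noteq> 0}" "k \<in> B \<Longrightarrow> finite {i. M i k \<noteq> 0}"
    "i \<in> A \<Longrightarrow> M i k \<noteq> 0 \<Longrightarrow> k \<in> B" "k \<in> B \<Longrightarrow> M i k \<noteq> 0 \<Longrightarrow> i \<in> A"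
  using assms unfolding unitary_mat_def isometric_def by auto

text \<open>Rows in \<open>A\<close> are nonzero with support in \<open>B\<close>, and columns in
  \<open>B\<close> are supported in \<open>A'\<close>; hence \<open>A \<subseteq> A'\<close>, and
  symmetrically. This recovers the source type hidden in an application.\<close>

lemma unitary_source_unique:
  assumes "unitary_mat A B M" "unitary_mat A' B M"
  shows "A = A'"
proof -
  have "A \<subseteq> A'" if "unitary_mat A B M" "unitary_mat A' B M" for A A'
    using that unitaryD(3,4) isometric_row_nonzero unfolding unitary_mat_def by (metis subsetI unitary_mat_def)
  then show ?thesis using assms by blast
qed

lemma mapp_supp:
  assumes "isometric A B M" "{i. f i \<noteq> 0} \<subseteq> A"
  shows "{k. mapp M f k \<noteq> 0} \<subseteq> B"
  using assms isometricD(2) mapp_nonzero by fastforce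

lemma mapp_finite:
  assumes "isometric A B M" "{i. f i \<noteq> 0} \<subseteq> A" "finite {i. f i \<noteq> 0}"
  shows "finite {k. mapp M f k \<noteq> 0}"
proof (rule finite_subset)
  show "{k. mapp M f k \<noteq> 0} \<subseteq> (\<Union>i\<in>{i. f i \<noteq> 0}. {k. M i k \<noteq> 0})"
    using mapp_nonzero by fastforce
  show "finite (\<Union>i\<in>{i. f i \<noteq> 0}. {k. M i k \<noteq> 0})"
    using assms isometricD(1) by fastforce
qed

text \<open>Both vectors are finite combinations of rows, so the inner product expands into a finite
  triple sum in which orthonormality of the rows leaves the diagonal.\<close>

lemma ip_mapp:
  assumes M: "isometric A B M" and v: "{i. v i \<noteq> 0} \<subseteq> A" "finite {i. v i \<noteq> 0}"
    and w: "{i. w i \<noteq> 0} \<subseteq> A" "finite {i. w i \<noteq> 0}"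
  shows "ip (mapp M v) (mapp M w) = ip v w"
proof -
  let ?I = "{i. v i \<noteq> 0} \<union> {i. w i \<noteq> 0}"
  let ?K = "\<Union>i\<in>?I. {k. M i k \<noteq> 0}"
  have I: "finite ?I" "?I \<subseteq> A" using v w by auto
  have K: "finite ?K" using I isometricD(1)[OF M] by blast
  have mv: "mapp M v k = (\<Sum>i\<in>?I. v i * M i k)" and mw: "mapp M w k = (\<Sum>i\<in>?I. w i * M i k)" for k
    using I by (auto intro!: mapp_eq_sum)
  have "ip (mapp M v) (mapp M w) = (\<Sum>k\<in>?K. cnj (mapp M v k) * mapp M w k)"
    by (rule ip_eq_sum[OF K]) (use mapp_nonzero in fastforce)
  also have "\<dots> = (\<Sum>k\<in>?K. \<Sum>i\<in>?I. \<Sum>j\<in>?I. cnj (v i) * w j * (cnj (M i k) * M j k))"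
    unfolding mv mw cnj_sum sum_product by (intro sum.cong refl) simp
  also have "\<dots> = (\<Sum>i\<in>?I. \<Sum>j\<in>?I. \<Sum>k\<in>?K. cnj (v i) * w j * (cnj (M i k) * M j k))"
    by (subst sum.swap, rule sum.cong, rule refl, rule sum.swap)
  also have "\<dots> = (\<Sum>i\<in>?I. \<Sum>j\<in>?I. cnj (v i) * w j * ip (M i) (M j))"
  proof (intro sum.cong refl)
    fix i j assume ij: "i \<in> ?I" "j \<in> ?I"
    have "ip (M i) (M j) = (\<Sum>k\<in>?K. cnj (M i k) * M j k)"
      by (rule ip_eq_sum[OF K]) (use ij in auto)
    then show "(\<Sum>k\<in>?K. cnj (v i) * w j * (cnj (M i k) * M j k)) = cnj (v i) * w j * ip (M i) (M j)"
      by (simp add: sum_distrib_left)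
  qed
  also have "\<dots> = (\<Sum>i\<in>?I. \<Sum>j\<in>?I. if i = j then cnj (v i) * w j else 0)"
    by (intro sum.cong refl, subst isometricD(3)[OF M]) (use I(2) in auto)
  also have "\<dots> = (\<Sum>i\<in>?I. cnj (v i) * w i)"
    using I(1) by (simp add: sum.delta')
  also have "\<dots> = ip v w"
    by (rule ip_eq_sum[symmetric, OF I(1)]) auto
  finally show ?thesis .
qed

text \<open>The support of \<open>f\<close> may be infinite. For a fixed output index, finiteness of
  the columns of \<open>N\<close> leaves finitely many intermediate indices, and finiteness of the
  columns of \<open>M\<close> then finitely many indices of \<open>f\<close>; both sides are the
  same finite double sum.\<close>

lemma mapp_assoc:
  assumes M: "unitary_mat A B M" and N: "unitary_mat B C N" and f: "\<And>i. i \<notin> A \<Longrightarrow> f i = 0"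
  shows "mapp N (mapp M f) = mapp (\<lambda>i. mapp N (M i)) f"
proof
  fix k
  let ?J = "{j\<in>B. N j k \<noteq> 0}"
  let ?I = "\<Union>j\<in>?J. {i\<in>A. M i j \<noteq> 0}"
  have J: "finite ?J"
  proof (cases "k \<in> C")
    case True
    then show ?thesis using unitaryD(2)[OF N] by (rule_tac finite_subset[of _ "{j. N j k \<noteq> 0}"]) auto
  next
    case False
    then have "?J = {}" using unitaryD(3)[OF N] by auto
    then show ?thesis by (metis finite.emptyI)
  qed
  have "finite {i\<in>A. M i j \<noteq> 0}" if "j \<in> B" for j
    using unitaryD(2)[OF M that] by (rule rev_finite_subset) auto
  then have I: "finite ?I" using J by blast
  have 1: "mapp M f j = (\<Sum>i\<in>?I. f i * M i j)" if "j \<in> ?J" for j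
    by (rule mapp_eq_sum[OF I]) (use that f in blast)
  have 2: "mapp N (M i) k = (\<Sum>j\<in>?J. M i j * N j k)" if "i \<in> A" for i
    by (rule mapp_eq_sum[OF J]) (use unitaryD(3)[OF M that] in blast)
  have "mapp N (mapp M f) k = (\<Sum>j\<in>?J. mapp M f j * N j k)"
  proof (rule mapp_eq_sum[OF J])
    fix j assume "j \<notin> ?J"
    moreover have "j \<in> B" if "mapp M f j \<noteq> 0"
      using mapp_nonzero[OF that] f unitaryD(3)[OF M] by blast
    ultimately show "mapp M f j = 0 \<or> N j k = 0" by blast
  qed
  also have "\<dots> = (\<Sum>j\<in>?J. \<Sum>i\<in>?I. f i * M i j * N j k)"
    using 1 by (simp add: sum_distrib_right)
  also have "\<dots> = (\<Sum>i\<in>?I. \<Sum>j\<in>?J. f i * M i j * N j k)"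
    by (rule sum.swap)
  also have "\<dots> = (\<Sum>i\<in>?I. f i * mapp N (M i) k)"
    using 2 by (intro sum.cong refl) (auto simp: sum_distrib_left mult_ac)
  also have "\<dots> = mapp (\<lambda>i. mapp N (M i)) f k"
  proof (rule mapp_eq_sum[symmetric, OF I])
    fix i assume i: "i \<notin> ?I"
    show "f i = 0 \<or> mapp N (M i) k = 0"
    proof (rule ccontr)
      assume "\<not> ?thesis"
      then have "f i \<noteq> 0" "mapp N (M i) k \<noteq> 0" by auto
      then obtain j where "M i j \<noteq> 0" "N j k \<noteq> 0" "i \<in> A" using mapp_nonzero f by metis
      then have "i \<in> ?I" using unitaryD(3)[OF M] by blast
      then show False using i by blast
    qed
  qed
  finally show "mapp N (mapp M f) k = mapp (\<lambda>i. mapp N (M i)) f k" .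
qed

lemma isometric_comp:
  assumes "isometric A B M" "isometric B C N"
  shows "isometric A C (\<lambda>i. mapp N (M i))"
  unfolding isometric_def
proof (intro conjI ballI)
  fix i assume i: "i \<in> A"
  have s: "{k. M i k \<noteq> 0} \<subseteq> B" "finite {k. M i k \<noteq> 0}" if "i \<in> A" for i
    using isometricD[OF assms(1) that] by auto
  show "finite {k. mapp N (M i) k \<noteq> 0}" by (rule mapp_finite[OF assms(2) s[OF i]])
  show "{k. mapp N (M i) k \<noteq> 0} \<subseteq> C" by (rule mapp_supp[OF assms(2) s(1)[OF i]])
  fix j assume "j \<in> A"
  then show "ip (mapp N (M i)) (mapp N (M j)) = (if i = j then 1 else 0)"
    using ip_mapp[OF assms(2) s[OF i] s] isometricD(3)[OF assms(1) i] by simp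
qed

lemma unitary_comp:
  assumes "unitary_mat A B M" "unitary_mat B C N"
  shows "unitary_mat A C (\<lambda>i. mapp N (M i))"
proof -
  have "madj (\<lambda>i. mapp N (M i)) = (\<lambda>k. mapp (madj M) (madj N k))"
    by (simp add: fun_eq_iff madj_def mapp_def cnj_Sum_any mult.commute)
  then show ?thesis
    using assms isometric_comp unfolding unitary_mat_def by metis
qed

text \<open>The coordinate at \<open>a\<close> is the conjugate of the inner product of the rows
  \<open>i\<close> and \<open>a\<close>. This serves to evaluate the inverse of a unitary, to
  isolate the clause that matches an input, and to expand basis vectors in the rows of a
  unitary.\<close>

lemma unitary_mapp_adj:
  assumes "unitary_mat A B M" "i \<in> A"
  shows "mapp (madj M) (M i) = ket i"
proof
  fix a
  have "mapp (madj M) (M i) a = cnj (ip (M i) (M a))"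
    by (simp add: mapp_def ip_def madj_def cnj_Sum_any)
  also have "\<dots> = ket i a"
  proof (cases "a \<in> A")
    case True
    then show ?thesis
      using isometricD(3)[of A B M i a] assms by (auto simp: unitary_mat_def ket_def)
  next
    case False
    have "ip (M i) (M a) = 0"
    proof (rule ccontr)
      assume "ip (M i) (M a) \<noteq> 0"
      then obtain k where "M i k \<noteq> 0" "M a k \<noteq> 0" using ip_nonzero by metis
      then show False using assms False unitaryD(3,4) by metis
    qed
    then show ?thesis using False assms(2) by (auto simp: ket_def)
  qed
  finally show "mapp (madj M) (M i) a = ket i a" .
qed


section \<open>Direct sums, tensor products, shift and control in coordinates\<close>

lemma Sum_any_reindex:
  assumes "inj h" "\<And>k. k \<notin> range h \<Longrightarrow> g k = 0"
  shows "Sum_any g = Sum_any (\<lambda>a. g (h a))"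
proof -
  have "{k. g k \<noteq> 0} = h ` {a. g (h a) \<noteq> 0}" using assms(2) by fastforce
  then show ?thesis
    using sum.reindex[of h "{a. g (h a) \<noteq> 0}" g] inj_on_subset[OF assms(1)]
    by (simp add: Sum_any.expand_set)
qed

lemma Sum_any_mult:
  fixes f g :: "_ \<Rightarrow> complex"
  assumes "finite {a. f a \<noteq> 0}" "finite {b. g b \<noteq> 0}"
  shows "Sum_any (\<lambda>(a, b). f a * g b) = Sum_any f * Sum_any g"
proof -
  have "Sum_any (\<lambda>(a, b). f a * g b) = (\<Sum>(a, b)\<in>{a. f a \<noteq> 0} \<times> {b. g b \<noteq> 0}. f a * g b)"
    using assms by (intro Sum_any_eq_sum) auto
  also have "\<dots> = (\<Sum>a | f a \<noteq> 0. \<Sum>b | g b \<noteq> 0. f a * g b)"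
    by (simp add: sum.cartesian_product)
  finally show ?thesis by (simp add: Sum_any.expand_set sum_product)
qed

lemma mapp_add_scaled:
  assumes "finite {i. f i \<noteq> 0}" "finite {i. g i \<noteq> 0}"
  shows "mapp M (\<lambda>i. f i + a * g i) k = mapp M f k + a * mapp M g k"
proof -
  let ?S = "{i. f i \<noteq> 0} \<union> {i. g i \<noteq> 0}"
  have S: "finite ?S" using assms by simp
  have "mapp M h k = (\<Sum>i\<in>?S. h i * M i k)" if "\<And>i. i \<notin> ?S \<Longrightarrow> h i = 0" for h
    by (rule mapp_eq_sum[OF S]) (use that in blast)
  then show ?thesis by (simp add: sum_distrib_left sum.distrib algebra_simps)
qed

lemma IPair_image_iff [simp]: "IPair i j \<in> (\<lambda>(i, j). IPair i j) ` (A \<times> B) \<longleftrightarrow> i \<in> A \<and> j \<in> B"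
  by auto

definition tvec :: "(idx \<Rightarrow> complex) \<Rightarrow> (idx \<Rightarrow> complex) \<Rightarrow> idx \<Rightarrow> complex" where
  "tvec v w k = (case k of IPair i j \<Rightarrow> v i * w j | _ \<Rightarrow> 0)"

lemma tvec_simps [simp]:
  "tvec v w (IPair i j) = v i * w j" "tvec v w IStar = 0" "tvec v w (IInl i) = 0"
  "tvec v w (IInr i) = 0" "tvec v w (INum n) = 0"
  by (simp_all add: tvec_def)

lemma inj_l_simps [simp]:
  "inj_l v (IPair i j) = 0" "inj_l v IStar = 0" "inj_l v (IInl i) = v i"
  "inj_l v (IInr i) = 0" "inj_l v (INum n) = 0"
  by (simp_all add: inj_l_def)

lemma inj_r_simps [simp]:
  "inj_r v (IPair i j) = 0" "inj_r v IStar = 0" "inj_r v (IInl i) = 0"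
  "inj_r v (IInr i) = v i" "inj_r v (INum n) = 0"
  by (simp_all add: inj_r_def)

lemma shift_simps [simp]:
  "shift v (IPair i j) = 0" "shift v IStar = 0" "shift v (IInl i) = 0"
  "shift v (IInr i) = 0" "shift v (INum 0) = 0" "shift v (INum (Suc n)) = v (INum n)"
  by (simp_all add: shift_def)

lemma tvec_nonzero: "tvec v w k \<noteq> 0 \<longleftrightarrow> (\<exists>i j. k = IPair i j \<and> v i \<noteq> 0 \<and> w j \<noteq> 0)"
  by (cases k) auto

lemma inj_l_nonzero: "inj_l v k \<noteq> 0 \<longleftrightarrow> (\<exists>i. k = IInl i \<and> v i \<noteq> 0)"
  by (cases k) auto

lemma inj_r_nonzero: "inj_r v k \<noteq> 0 \<longleftrightarrow> (\<exists>i. k = IInr i \<and> v i \<noteq> 0)"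
  by (cases k) auto

lemma shift_nonzero: "shift v k \<noteq> 0 \<longleftrightarrow> (\<exists>n. k = INum (Suc n) \<and> v (INum n) \<noteq> 0)"
proof (cases k)
  case (INum n)
  then show ?thesis by (cases n) auto
qed auto

lemma finite_tvec:
  assumes "finite {i. v i \<noteq> 0}" "finite {j. w j \<noteq> 0}"
  shows "finite {k. tvec v w k \<noteq> 0}"
proof -
  have "{k. tvec v w k \<noteq> 0} = (\<lambda>(i, j). IPair i j) ` ({i. v i \<noteq> 0} \<times> {j. w j \<noteq> 0})"
    by (auto simp: tvec_nonzero)
  then show ?thesis using assms by simp
qed

lemma finite_inj_l: "finite {i. v i \<noteq> 0} \<Longrightarrow> finite {k. inj_l v k \<noteq> 0}"
  by (rule finite_subset[of _ "IInl ` {i. v i \<noteq> 0}"]) (auto simp: inj_l_nonzero)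

lemma finite_inj_r: "finite {i. v i \<noteq> 0} \<Longrightarrow> finite {k. inj_r v k \<noteq> 0}"
  by (rule finite_subset[of _ "IInr ` {i. v i \<noteq> 0}"]) (auto simp: inj_r_nonzero)

lemma finite_shift: "finite {i. v i \<noteq> 0} \<Longrightarrow> finite {k. shift v k \<noteq> 0}"
  by (rule finite_subset[of _ "(\<lambda>i. case i of INum n \<Rightarrow> INum (Suc n) | _ \<Rightarrow> i) ` {i. v i \<noteq> 0}"])
    (auto simp: shift_nonzero image_iff intro!: exI[of _ "INum _"])

lemma ip_tvec:
  assumes "finite {i. v i \<noteq> 0}" "finite {j. w j \<noteq> 0}"
  shows "ip (tvec v w) (tvec v' w') = ip v v' * ip w w'"
proof -
  have "ip (tvec v w) (tvec v' w') =
      Sum_any (\<lambda>p. cnj (tvec v w (case p of (i, j) \<Rightarrow> IPair i j)) * tvec v' w' (case p of (i, j) \<Rightarrow> IPair i j))"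
    unfolding ip_def
  proof (rule Sum_any_reindex)
    show "inj (\<lambda>p. case p of (i, j) \<Rightarrow> IPair i j)" by (auto simp: inj_on_def)
    fix k assume "k \<notin> range (\<lambda>p. case p of (i, j) \<Rightarrow> IPair i j)"
    then show "cnj (tvec v w k) * tvec v' w' k = 0" by (cases k) auto
  qed
  also have "\<dots> = Sum_any (\<lambda>(i, j). (cnj (v i) * v' i) * (cnj (w j) * w' j))"
    by (simp add: case_prod_beta mult_ac)
  also have "\<dots> = ip v v' * ip w w'"
    unfolding ip_def by (rule Sum_any_mult) (use assms in \<open>auto elim: rev_finite_subset\<close>)
  finally show ?thesis .
qed

lemma ip_inj_l: "ip (inj_l v) (inj_l w) = ip v w"
  unfolding ip_def
  by (subst Sum_any_reindex[of IInl]) (auto simp: inj_on_def image_iff, metis inj_l_nonzero)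

lemma ip_inj_r: "ip (inj_r v) (inj_r w) = ip v w"
  unfolding ip_def
  by (subst Sum_any_reindex[of IInr]) (auto simp: inj_on_def image_iff, metis inj_r_nonzero)

lemma ip_inj_l_inj_r [simp]: "ip (inj_l v) (inj_r w) = 0" "ip (inj_r v) (inj_l w) = 0"
  using ip_nonzero[of "inj_l v" "inj_r w"] ip_nonzero[of "inj_r v" "inj_l w"]
  by (auto simp: inj_l_nonzero inj_r_nonzero)

text \<open>\<open>shift\<close> discards all coordinates outside \<open>range INum\<close>, so
  inner products survive only if one of the two vectors has none there.\<close>

lemma ip_shift:
  assumes "{i. v i \<noteq> 0} \<subseteq> range INum"
  shows "ip (shift v) (shift w) = ip v w"
proof -
  have "ip (shift v) (shift w) = Sum_any (\<lambda>n. cnj (v (INum n)) * w (INum n))"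
    unfolding ip_def
    by (subst Sum_any_reindex[of "\<lambda>n. INum (Suc n)"])
      (auto simp: inj_on_def image_iff, metis shift_nonzero)
  also have "\<dots> = ip v w"
    unfolding ip_def by (rule Sum_any_reindex[symmetric]) (use assms in \<open>auto simp: inj_on_def\<close>)
  finally show ?thesis .
qed

definition tmat :: "(idx \<Rightarrow> idx \<Rightarrow> complex) \<Rightarrow> (idx \<Rightarrow> idx \<Rightarrow> complex) \<Rightarrow> idx \<Rightarrow> idx \<Rightarrow> complex" where
  "tmat M N k = (case k of IPair i j \<Rightarrow> tvec (M i) (N j) | _ \<Rightarrow> (\<lambda>_. 0))"

definition pmat :: "(idx \<Rightarrow> idx \<Rightarrow> complex) \<Rightarrow> (idx \<Rightarrow> idx \<Rightarrow> complex) \<Rightarrow> idx \<Rightarrow> idx \<Rightarrow> complex" where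
  "pmat M N k = (case k of IInl i \<Rightarrow> inj_l (M i) | IInr i \<Rightarrow> inj_r (N i) | _ \<Rightarrow> (\<lambda>_. 0))"

definition cmat :: "(idx \<Rightarrow> idx \<Rightarrow> complex) \<Rightarrow> idx \<Rightarrow> idx \<Rightarrow> complex" where
  "cmat M k = (case k of IPair i j \<Rightarrow>
      if i = IInl IStar then tvec (ket i) (ket j)
      else if i = IInr IStar then tvec (ket i) (M j) else (\<lambda>_. 0)
    | _ \<Rightarrow> (\<lambda>_. 0))"

lemma madj_tmat: "madj (tmat M N) = tmat (madj M) (madj N)"
proof (intro ext)
  fix k i
  show "madj (tmat M N) k i = tmat (madj M) (madj N) k i"
    by (cases k; cases i) (simp_all add: madj_def tmat_def)
qed

lemma madj_pmat: "madj (pmat M N) = pmat (madj M) (madj N)"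
proof (intro ext)
  fix k i
  show "madj (pmat M N) k i = pmat (madj M) (madj N) k i"
    by (cases k; cases i) (simp_all add: madj_def pmat_def)
qed

lemma madj_cmat: "madj (cmat M) = cmat (madj M)"
proof (intro ext)
  fix k i
  show "madj (cmat M) k i = cmat (madj M) k i"
    by (cases k; cases i) (auto simp: madj_def cmat_def ket_def)
qed

lemma isometric_tmat:
  assumes "isometric (ix Q1) (ix Q2) M" "isometric (ix Q3) (ix Q4) N"
  shows "isometric (ix (QTensor Q1 Q3)) (ix (QTensor Q2 Q4)) (tmat M N)"
proof (rule isometricI, goal_cases)
  case (1 i)
  then show ?case using isometricD[OF assms(1)] isometricD[OF assms(2)] by (auto simp: tmat_def finite_tvec)
next
  case (2 i k)
  then show ?case using isometricD[OF assms(1)] isometricD[OF assms(2)] by (auto simp: tmat_def tvec_nonzero)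
next
  case (3 i j)
  then show ?case using isometricD[OF assms(1)] isometricD[OF assms(2)] by (auto simp: tmat_def ip_tvec split: if_splits)
qed

lemma isometric_pmat:
  assumes "isometric (ix Q1) (ix Q2) M" "isometric (ix Q3) (ix Q4) N"
  shows "isometric (ix (QPlus Q1 Q3)) (ix (QPlus Q2 Q4)) (pmat M N)"
proof (rule isometricI, goal_cases)
  case (1 i)
  then show ?case using isometricD[OF assms(1)] isometricD[OF assms(2)] by (auto simp: pmat_def finite_inj_l finite_inj_r)
next
  case (2 i k)
  then show ?case using isometricD[OF assms(1)] isometricD[OF assms(2)] by (auto simp: pmat_def inj_l_nonzero inj_r_nonzero)
next
  case (3 i j)
  then show ?case using isometricD[OF assms(1)] isometricD[OF assms(2)] by (auto simp: pmat_def ip_inj_l ip_inj_r split: if_splits)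
qed

lemma isometric_cmat:
  assumes "isometric (ix Q) (ix Q) M"
  shows "isometric (ix (QTensor qbit Q)) (ix (QTensor qbit Q)) (cmat M)"
proof (rule isometricI, goal_cases)
  case (1 i)
  then show ?case using isometricD[OF assms] by (auto simp: cmat_def qbit_def finite_tvec)
next
  case (2 i k)
  then show ?case using isometricD[OF assms] by (auto simp: cmat_def qbit_def tvec_nonzero)
next
  case (3 i j)
  then show ?case using isometricD[OF assms] by (auto simp: cmat_def qbit_def ip_tvec ip_ket_left ip_ket_right ket_apply split: if_splits)
qed

lemma unitary_tmat:
  assumes "unitary_mat (ix Q1) (ix Q2) M" "unitary_mat (ix Q3) (ix Q4) N"
  shows "unitary_mat (ix (QTensor Q1 Q3)) (ix (QTensor Q2 Q4)) (tmat M N)"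
  using assms isometric_tmat unfolding unitary_mat_def madj_tmat by blast

lemma unitary_pmat:
  assumes "unitary_mat (ix Q1) (ix Q2) M" "unitary_mat (ix Q3) (ix Q4) N"
  shows "unitary_mat (ix (QPlus Q1 Q3)) (ix (QPlus Q2 Q4)) (pmat M N)"
  using assms isometric_pmat unfolding unitary_mat_def madj_pmat by blast

lemma unitary_cmat:
  assumes "unitary_mat (ix Q) (ix Q) M"
  shows "unitary_mat (ix (QTensor qbit Q)) (ix (QTensor qbit Q)) (cmat M)"
  using assms isometric_cmat unfolding unitary_mat_def madj_cmat by blast

section \<open>Linear spans and a criterion for unitarity\<close>

text \<open>The algebraic span, without closure: every basis vector will be a finite combination of
  the vectors of a syntactic basis. Adding one scaled generator at a time makes linear images a
  plain induction.\<close>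

inductive_set cspan :: "('k \<Rightarrow> complex) set \<Rightarrow> ('k \<Rightarrow> complex) set" for W where
  cspan_zero: "(\<lambda>_. 0) \<in> cspan W"
| cspan_step: "v \<in> cspan W \<Longrightarrow> w \<in> W \<Longrightarrow> (\<lambda>k. v k + c * w k) \<in> cspan W"

lemma cspan_base: "w \<in> W \<Longrightarrow> w \<in> cspan W"
  using cspan_step[OF cspan_zero, of w W 1] by simp

lemma cspan_add_scaled:
  assumes "v \<in> cspan W" "w \<in> cspan W"
  shows "(\<lambda>k. v k + c * w k) \<in> cspan W"
  using assms(2)
proof induction
  case cspan_zero
  then show ?case using assms(1) by simp
next
  case (cspan_step w x d)
  have "(\<lambda>k. (v k + c * w k) + (c * d) * x k) \<in> cspan W"
    by (rule cspan.cspan_step[OF cspan_step.IH cspan_step.hyps(2)])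
  then show ?case by (simp add: algebra_simps)
qed

lemma cspan_sum:
  assumes "finite X" "\<And>x. x \<in> X \<Longrightarrow> w x \<in> cspan W"
  shows "(\<lambda>k. \<Sum>x\<in>X. c x * w x k) \<in> cspan W"
  using assms
proof (induction X rule: finite_induct)
  case empty
  then show ?case using cspan_zero by simp
next
  case (insert x X)
  then have "(\<lambda>k. (\<Sum>x\<in>X. c x * w x k) + c x * w x k) \<in> cspan W"
    by (intro cspan_add_scaled) auto
  then show ?case using insert by (simp add: add.commute)
qed

lemma cspan_linear_image:
  assumes "v \<in> cspan W"
    and "T (\<lambda>_. 0) = (\<lambda>_. 0)"
    and "\<And>v w c. T (\<lambda>k. v k + c * w k) = (\<lambda>k. T v k + c * T w k)"
    and "\<And>w. w \<in> W \<Longrightarrow> T w \<in> cspan W'"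
  shows "T v \<in> cspan W'"
  using assms(1)
proof induction
  case cspan_zero
  then show ?case using assms(2) cspan.cspan_zero by metis
next
  case (cspan_step v w c)
  then show ?case using assms(3,4) cspan_add_scaled by metis
qed

lemma cspan_repr:
  assumes "v \<in> cspan (M ` A)"
  shows "\<exists>c. finite {i. c i \<noteq> 0} \<and> {i. c i \<noteq> 0} \<subseteq> A \<and> v = mapp M c"
  using assms
proof induction
  case cspan_zero
  have "mapp M (\<lambda>_. 0) = (\<lambda>_. 0)" by (rule ext) (simp add: mapp_def)
  then show ?case by (intro exI[of _ "\<lambda>_. 0"]) auto
next
  case (cspan_step v w d)
  then obtain c i where c: "finite {i. c i \<noteq> 0}" "{i. c i \<noteq> 0} \<subseteq> A" "v = mapp M c"
    and i: "i \<in> A" "w = M i" by auto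
  let ?c = "\<lambda>j. c j + d * ket i j"
  have "{j. ?c j \<noteq> 0} \<subseteq> insert i {i. c i \<noteq> 0}" by (auto simp: ket_def)
  moreover have "mapp M ?c = (\<lambda>k. v k + d * w k)"
    unfolding c(3) i(2) by (rule ext, subst mapp_add_scaled) (use c(1) in \<open>auto simp: mapp_ket\<close>)
  ultimately show ?case using c(1,2) i(1)
    by (intro exI[of _ ?c] conjI) (auto intro: finite_subset[of _ "insert i {i. c i \<noteq> 0}"])
qed

text \<open>If \<open>ket k = mapp M c\<close>, pairing with the row \<open>i\<close> gives
  \<open>c i = cnj (M i k)\<close>, so the column at \<open>k\<close> is the coefficient vector of
  \<open>ket k\<close>. Columns are therefore finite, and orthonormal because \<open>M\<close>
  preserves inner products and the kets are orthonormal. The last hypothesis concerns rows outside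
  \<open>A\<close>, about which \<open>isometric\<close> is silent.\<close>

lemma isometric_spanning_unitary:
  assumes M: "isometric A B M"
    and span: "\<And>k. k \<in> B \<Longrightarrow> ket k \<in> cspan (M ` A)"
    and supp: "\<And>i k. k \<in> B \<Longrightarrow> M i k \<noteq> 0 \<Longrightarrow> i \<in> A"
  shows "unitary_mat A B M"
proof -
  have *: "finite {i. madj M k i \<noteq> 0} \<and> {i. madj M k i \<noteq> 0} \<subseteq> A \<and> ket k = mapp M (madj M k)"
    if k: "k \<in> B" for k
  proof -
    obtain c where c: "finite {i. c i \<noteq> 0}" "{i. c i \<noteq> 0} \<subseteq> A" "ket k = mapp M c"
      using cspan_repr[OF span[OF k]] by blast
    have "madj M k i = c i" for i
    proof (cases "i \<in> A")
      case True
      have "ip (mapp M (ket i)) (mapp M c) = ip (ket i) c"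
        by (rule ip_mapp[OF M]) (use True c in auto)
      then show ?thesis
        unfolding c(3)[symmetric] by (simp add: mapp_ket ip_ket_left ip_ket_right madj_def)
    next
      case False
      then have "M i k = 0" "c i = 0" using supp[OF k] c(2) by blast+
      then show ?thesis by (simp add: madj_def)
    qed
    then have "madj M k = c" ..
    then show ?thesis using c by simp
  qed
  have "ip (madj M k) (madj M l) = (if k = l then 1 else 0)" if kl: "k \<in> B" "l \<in> B" for k l
  proof -
    have "ip (madj M k) (madj M l) = ip (mapp M (madj M k)) (mapp M (madj M l))"
      using *[OF kl(1)] *[OF kl(2)] by (intro ip_mapp[OF M, symmetric]) auto
    also have "\<dots> = ip (ket k) (ket l)" using *[OF kl(1)] *[OF kl(2)] by simp
    finally show ?thesis by (simp add: ip_ket_left ket_apply)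
  qed
  then show ?thesis using M * unfolding unitary_mat_def isometric_def[of B A] by blast
qed

section \<open>Square-summable vectors\<close>

lemma ip_self: 
  assumes "finite S" "\<And>k. k \<notin> S \<Longrightarrow> v k = 0"
  shows "ip v v = of_real (\<Sum>k\<in>S. (cmod (v k))\<^sup>2)"
proof -
  have "ip v v = (\<Sum>k\<in>S. cnj (v k) * v k)" using assms by (intro ip_eq_sum) auto
  then show ?thesis by (simp add: complex_norm_square mult.commute del: of_real_power)
qed

lemma ell2_zero: "f \<in> ell2 A \<Longrightarrow> i \<notin> A \<Longrightarrow> f i = 0"
  by (simp add: ell2_def)

text \<open>Every finite partial sum of the squared output is bounded by the squared norm of
  \<open>f\<close>, which yields summability.\<close>

lemma mapp_ell2:
  assumes M: "unitary_mat A B M" and f: "f \<in> ell2 A"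
  shows "mapp M f \<in> ell2 B"
proof -
  have iso: "isometric A B M" using M by (simp add: unitary_mat_def)
  have f0: "\<And>i. i \<notin> A \<Longrightarrow> f i = 0" and sf: "(\<lambda>i. (cmod (f i))\<^sup>2) summable_on UNIV"
    using f by (auto simp: ell2_def)
  have zero: "mapp M f k = 0" if "k \<notin> B" for k
  proof (rule ccontr)
    assume "mapp M f k \<noteq> 0"
    then obtain i where "f i \<noteq> 0" "M i k \<noteq> 0" using mapp_nonzero by metis
    then show False using f0 that unitaryD(3)[OF M] by blast
  qed
  have bound: "(\<Sum>k\<in>F. (cmod (mapp M f k))\<^sup>2) \<le> (\<Sum>\<^sub>\<infinity>i. (cmod (f i))\<^sup>2)" if F: "finite F" for F
  proof -
    let ?K = "F \<inter> B"
    let ?I = "\<Union>k\<in>?K. {i. M i k \<noteq> 0}"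
    \<comment> \<open>Columns being finite, the output coordinates in \<open>F\<close> depend only
      on the coordinates of \<open>f\<close> in the finite set \<open>?I\<close>. The truncation
      \<open>g\<close> agrees there and is finitely supported, so that the isometry property
      \<open>ip_mapp\<close> applies to it.\<close>
    define g where "g = (\<lambda>i. if i \<in> ?I then f i else 0)"
    have I: "finite ?I" "?I \<subseteq> A" using F unitaryD(2,4)[OF M] by auto
    have g: "{i. g i \<noteq> 0} \<subseteq> ?I" by (auto simp: g_def)
    then have g': "{i. g i \<noteq> 0} \<subseteq> A" "finite {i. g i \<noteq> 0}" using I finite_subset by blast+
    have eq: "mapp M f k = mapp M g k" if "k \<in> ?K" for k
    proof -
      have "mapp M f k = (\<Sum>i\<in>?I. f i * M i k)" "mapp M g k = (\<Sum>i\<in>?I. g i * M i k)"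
        by (rule mapp_eq_sum[OF I(1)]; use that in blast)+
      then show ?thesis by (simp add: g_def)
    qed
    let ?S = "{k. mapp M g k \<noteq> 0} \<union> ?K"
    have S: "finite ?S" using F mapp_finite[OF iso g'] by simp
    have "(\<Sum>k\<in>F. (cmod (mapp M f k))\<^sup>2) = (\<Sum>k\<in>?K. (cmod (mapp M f k))\<^sup>2)"
      by (rule sum.mono_neutral_right) (use F zero in auto)
    also have "\<dots> = (\<Sum>k\<in>?K. (cmod (mapp M g k))\<^sup>2)" using eq by (intro sum.cong) auto
    also have "\<dots> \<le> (\<Sum>k\<in>?S. (cmod (mapp M g k))\<^sup>2)" using S by (intro sum_mono2) auto
    also have "\<dots> = (\<Sum>i\<in>?I. (cmod (g i))\<^sup>2)"
    proof -
      have "ip (mapp M g) (mapp M g) = of_real (\<Sum>k\<in>?S. (cmod (mapp M g k))\<^sup>2)"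
        by (rule ip_self[OF S]) auto
      moreover have "ip g g = of_real (\<Sum>i\<in>?I. (cmod (g i))\<^sup>2)"
        by (rule ip_self[OF I(1)]) (simp add: g_def)
      ultimately show ?thesis using ip_mapp[OF iso g' g'] by (metis of_real_eq_iff)
    qed
    also have "\<dots> = (\<Sum>i\<in>?I. (cmod (f i))\<^sup>2)" by (simp add: g_def)
    also have "\<dots> \<le> (\<Sum>\<^sub>\<infinity>i. (cmod (f i))\<^sup>2)"
      by (rule finite_sum_le_infsum[OF sf I(1)]) auto
    finally show ?thesis .
  qed
  have "(\<lambda>k. (cmod (mapp M f k))\<^sup>2) summable_on UNIV"
    by (rule nonneg_bdd_above_summable_on) (use bound in \<open>auto intro!: bdd_aboveI2\<close>)
  then show ?thesis using zero by (simp add: ell2_def)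
qed

text \<open>Supplies the slices of a vector on a direct sum, on a tensor product and on the index
  set of a family of clauses, so that restricted operators are applied inside their domains.\<close>

lemma ell2_reindex:
  assumes "f \<in> ell2 A" "inj_on h A'" "\<And>x. x \<notin> A' \<Longrightarrow> g x = 0" "\<And>x. x \<in> A' \<Longrightarrow> g x = f (h x)"
  shows "g \<in> ell2 A'"
proof -
  have "(\<lambda>i. (cmod (f i))\<^sup>2) summable_on h ` A'"
    by (rule summable_on_subset_banach[of _ UNIV]) (use assms(1) in \<open>auto simp: ell2_def\<close>)
  then have "((\<lambda>i. (cmod (f i))\<^sup>2) \<circ> h) summable_on A'"
    using summable_on_reindex[OF assms(2)] by blast
  then have "(\<lambda>x. (cmod (g x))\<^sup>2) summable_on UNIV"
    by (rule iffD1[OF summable_on_cong_neutral, rotated -1]) (use assms in auto)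
  then show ?thesis using assms(3) by (simp add: ell2_def)
qed

lemma ell2_add_scaled:
  assumes "f \<in> ell2 A" "g \<in> ell2 A"
  shows "(\<lambda>i. f i + c * g i) \<in> ell2 A"
proof -
  have "(\<lambda>i. 2 * (cmod (f i))\<^sup>2 + 2 * (cmod c)\<^sup>2 * (cmod (g i))\<^sup>2) summable_on UNIV"
    using assms by (intro summable_on_add summable_on_cmult_right) (auto simp: ell2_def)
  moreover have "(cmod (f i + c * g i))\<^sup>2 \<le> 2 * (cmod (f i))\<^sup>2 + 2 * (cmod c)\<^sup>2 * (cmod (g i))\<^sup>2" for i
  proof -
    have "(cmod (f i + c * g i))\<^sup>2 \<le> (cmod (f i) + cmod c * cmod (g i))\<^sup>2"
      using norm_triangle_ineq[of "f i" "c * g i"] by (intro power_mono) (auto simp: norm_mult)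
    also have "\<dots> \<le> 2 * (cmod (f i))\<^sup>2 + 2 * (cmod c)\<^sup>2 * (cmod (g i))\<^sup>2"
      using sum_squares_bound[of "cmod (f i)" "cmod c * cmod (g i)"]
      by (simp add: power2_sum power_mult_distrib)
    finally show ?thesis .
  qed
  ultimately have "(\<lambda>i. (cmod (f i + c * g i))\<^sup>2) summable_on UNIV"
    by (rule summable_on_comparison_test) auto
  then show ?thesis using assms by (simp add: ell2_def)
qed

lemma ell2_sum:
  assumes "finite X" "\<And>x. x \<in> X \<Longrightarrow> f x \<in> ell2 A"
  shows "(\<lambda>i. \<Sum>x\<in>X. f x i * c x) \<in> ell2 A"
  using assms
proof (induction X rule: finite_induct)
  case empty
  then show ?case by (simp add: ell2_def)
next
  case (insert x X)
  then have "(\<lambda>i. (\<Sum>x\<in>X. f x i * c x) + c x * f x i) \<in> ell2 A"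
    by (intro ell2_add_scaled) auto
  then show ?case using insert by (simp add: add.commute mult.commute)
qed

lemma finite_support_ell2:
  assumes "finite {i. f i \<noteq> 0}" "{i. f i \<noteq> 0} \<subseteq> A"
  shows "f \<in> ell2 A"
  unfolding ell2_def using assms
  by (auto intro!: finite_nonzero_values_imp_summable_on)

section \<open>Matrix semantics of terms and unitaries\<close>

fun fv :: "tm \<Rightarrow> var set" where
  "fv Star = {}"
| "fv (Var x) = {x}"
| "fv (Inl t) = fv t"
| "fv (Inr t) = fv t"
| "fv (Tensor s t) = fv s \<union> fv t"
| "fv Zero = {}"
| "fv (Succ t) = fv t"
| "fv (App u t) = fv t"
| "fv (Sum ts) = (\<Union>p\<in>set ts. fv (snd p))"

text \<open>
  \<open>amp t \<rho> k\<close> is the coordinate at \<open>k\<close> of the image of the basis vector \<open>\<rho>\<close> of the context under the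
  interpretation of \<open>t\<close>, and \<open>umat u i k\<close> the entry \<open>\<langle>k|u|i\<rangle>\<close>.  No types occur, so that distinct typing
  derivations need not be compared.
\<close>

function (sequential) amp :: "tm \<Rightarrow> (var \<rightharpoonup> idx) \<Rightarrow> idx \<Rightarrow> complex"
  and umat :: "un \<Rightarrow> idx \<Rightarrow> idx \<Rightarrow> complex" where
  "amp Star \<rho> = ket IStar"
| "amp (Var x) \<rho> = (\<lambda>k. if \<rho> x = Some k then 1 else 0)"
| "amp (Inl t) \<rho> = inj_l (amp t \<rho>)"
| "amp (Inr t) \<rho> = inj_r (amp t \<rho>)"
| "amp (Tensor s t) \<rho> = tvec (amp s \<rho>) (amp t \<rho>)"
| "amp Zero \<rho> = ket (INum 0)"
| "amp (Succ t) \<rho> = shift (amp t \<rho>)"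
| "amp (App u t) \<rho> = mapp (umat u) (amp t \<rho>)"
| "amp (Sum ts) \<rho> = (\<lambda>k. \<Sum>p\<leftarrow>ts. fst p * amp (snd p) \<rho> k)"
| "umat (Clauses cs) = (\<lambda>i k. Sum_any (\<lambda>p.
      if fst p < length cs \<and> dom (snd p) = fv (fst (cs ! fst p)) \<and> dom (snd p) = fv (snd (cs ! fst p))
      then cnj (amp (fst (cs ! fst p)) (snd p) i) * amp (snd (cs ! fst p)) (snd p) k else 0))"
| "umat (UTensor u v) = tmat (umat u) (umat v)"
| "umat (UPlus u v) = pmat (umat u) (umat v)"
| "umat (UComp v u) = (\<lambda>i. mapp (umat v) (umat u i))"
| "umat (UInv u) = madj (umat u)"
| "umat (UCtrl u) = cmat (umat u)"
  by pat_completeness auto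

lemma size_clause:
  assumes "c < length cs"
  shows "size (fst (cs ! c)) < size (Clauses cs)" "size (snd (cs ! c)) < size (Clauses cs)"
proof -
  have "size_prod size size (cs ! c) < Suc (size_list (size_prod size size) cs)"
    by (rule size_list_estimation'[of "cs ! c", THEN le_imp_less_Suc]) (use assms in auto)
  then show "size (fst (cs ! c)) < size (Clauses cs)" "size (snd (cs ! c)) < size (Clauses cs)"
    by (cases "cs ! c"; simp)+
qed

lemma size_summand:
  assumes "p \<in> set ts"
  shows "size (snd p) < size (Sum ts)"
proof -
  have "size_prod (\<lambda>_. 0) size p < Suc (size_list (size_prod (\<lambda>_. 0) size) ts)"
    by (rule size_list_estimation'[of p, THEN le_imp_less_Suc]) (use assms in auto)
  then show ?thesis by (cases p) simp
qed

termination
  by (relation "Wellfounded.measure (case_sum (\<lambda>p. size (fst p)) size)")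
    (use size_clause size_summand in \<open>auto simp del: tm.size un.size\<close>, simp_all)

lemma amp_cong: "(\<And>x. x \<in> fv t \<Longrightarrow> \<rho> x = \<rho>' x) \<Longrightarrow> amp t \<rho> = amp t \<rho>'"
proof (induction t rule: fv.induct)
  case (9 ts)
  have "amp (snd p) \<rho> = amp (snd p) \<rho>'" if "p \<in> set ts" for p
    by (rule "9.IH"[OF that]) (use that "9.prems" in auto)
  then show ?case by (simp cong: map_cong)
next
  case (2 x)
  then show ?case by simp
qed simp_all

lemma ix_nonempty: "ix Q \<noteq> {}"
  by (induction Q) auto

text \<open>
  The equational theory leads out of the typed terms: \<open>eq_sum_cong\<close> does not preserve the
  orthogonality required of the summands.  Its soundness is therefore stated for typing without
  the normalization and orthogonality conditions on sums.
\<close>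

inductive wt :: "ctx \<Rightarrow> tm \<Rightarrow> qty \<Rightarrow> bool" where
  wt_star: "wt Map.empty Star QI"
| wt_var: "wt [x \<mapsto> Q] (Var x) Q"
| wt_tensor: "\<lbrakk>wt \<Gamma>1 t1 Q1; wt \<Gamma>2 t2 Q2; dom \<Gamma>1 \<inter> dom \<Gamma>2 = {}\<rbrakk>
    \<Longrightarrow> wt (\<Gamma>1 ++ \<Gamma>2) (Tensor t1 t2) (QTensor Q1 Q2)"
| wt_inl: "wt \<Gamma> t Q1 \<Longrightarrow> wt \<Gamma> (Inl t) (QPlus Q1 Q2)"
| wt_inr: "wt \<Gamma> t Q2 \<Longrightarrow> wt \<Gamma> (Inr t) (QPlus Q1 Q2)"
| wt_zero: "wt Map.empty Zero QNat"
| wt_succ: "wt \<Gamma> t QNat \<Longrightarrow> wt \<Gamma> (Succ t) QNat"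
| wt_sum: "\<lbrakk>ts \<noteq> []; \<And>p. p \<in> set ts \<Longrightarrow> wt \<Gamma> (snd p) Q\<rbrakk> \<Longrightarrow> wt \<Gamma> (Sum ts) Q"
| wt_app: "\<lbrakk>\<tturnstile> u \<Colon> U(Q1, Q2); wt \<Gamma> t Q1\<rbrakk> \<Longrightarrow> wt \<Gamma> (App u t) Q2"

inductive_cases wt_starE: "wt \<Gamma> Star Q"
inductive_cases wt_varE: "wt \<Gamma> (Var x) Q"
inductive_cases wt_tensorE: "wt \<Gamma> (Tensor s t) Q"
inductive_cases wt_inlE: "wt \<Gamma> (Inl t) Q"
inductive_cases wt_inrE: "wt \<Gamma> (Inr t) Q"
inductive_cases wt_zeroE: "wt \<Gamma> Zero Q"
inductive_cases wt_succE: "wt \<Gamma> (Succ t) Q"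
inductive_cases wt_sumE: "wt \<Gamma> (Sum ts) Q"
inductive_cases wt_appE: "wt \<Gamma> (App u t) Q"

lemma wt_Inl_iff: "wt \<Gamma> (Inl t) (QPlus Q1 Q2) \<longleftrightarrow> wt \<Gamma> t Q1"
  by (metis wt_inl wt_inlE qty.inject(1))

lemma wt_Inr_iff: "wt \<Gamma> (Inr t) (QPlus Q1 Q2) \<longleftrightarrow> wt \<Gamma> t Q2"
  by (metis wt_inr wt_inrE qty.inject(1))

lemma wt_Succ_iff: "wt \<Gamma> (Succ t) QNat \<longleftrightarrow> wt \<Gamma> t QNat"
  by (metis wt_succ wt_succE)

lemma typed_wt: "\<Gamma> \<turnstile> t \<Colon> Q \<Longrightarrow> wt \<Gamma> t Q" and "\<tturnstile> u \<Colon> U(Q1, Q2) \<Longrightarrow> True"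
proof (induction rule: typed_utyped.inducts)
  case (ty_sum ts \<Gamma> Q)
  then show ?case by (intro wt_sum) (auto simp: in_set_conv_nth)
qed (rule wt.intros TrueI; assumption)+

lemma wt_dom: "wt \<Gamma> t Q \<Longrightarrow> dom \<Gamma> = fv t"
proof (induction rule: wt.induct)
  case (wt_sum ts \<Gamma> Q)
  have "fv (snd p) = dom \<Gamma>" if "p \<in> set ts" for p using wt_sum.IH that by blast
  then show ?case using wt_sum.hyps(1) by simp
qed (auto split: if_splits)

text \<open>Reading an expression along its type fixes the type of each variable at its leaf; a sum
  contributes through any of its summands, of which \<open>wt\<close> requires at least one.
  Applications are excluded because they hide the type of their argument.\<close>

lemma wt_unique: "wt \<Gamma> e Q \<Longrightarrow> expression e \<Longrightarrow> wt \<Gamma>' e Q \<Longrightarrow> \<Gamma>' = \<Gamma>"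
proof (induction arbitrary: \<Gamma>' rule: wt.induct)
  case (wt_tensor \<Gamma>1 t1 Q1 \<Gamma>2 t2 Q2)
  from wt_tensor.prems(2) show ?case
    by (rule wt_tensorE) (use wt_tensor in auto)
next
  case (wt_sum ts \<Gamma> Q)
  then obtain p where "p \<in> set ts" by (cases ts) auto
  then show ?case using wt_sum by (metis expression.simps(9) wt_sumE)
next
  case (wt_inl \<Gamma> t Q1 Q2)
  from wt_inl.prems(2) show ?case by (rule wt_inlE) (use wt_inl in auto)
next
  case (wt_inr \<Gamma> t Q2 Q1)
  from wt_inr.prems(2) show ?case by (rule wt_inrE) (use wt_inr in auto)
next
  case (wt_succ \<Gamma> t)
  from wt_succ.prems(2) show ?case by (rule wt_succE) (use wt_succ in auto)
next
  case wt_star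
  from wt_star.prems(2) show ?case by (rule wt_starE)
next
  case wt_zero
  from wt_zero.prems(2) show ?case by (rule wt_zeroE)
next
  case (wt_var x Q)
  from wt_var.prems(2) show ?case by (rule wt_varE)
qed simp

section \<open>Valuations of contexts and supports of expressions\<close>

text \<open>Unlike membership in \<open>cix\<close>, this leaves \<open>\<rho>\<close> free outside
  the context. As \<open>amp\<close> reads only the free variables, one valuation can serve all
  subterms of a tensor without being restricted.\<close>

definition covers :: "ctx \<Rightarrow> (var \<rightharpoonup> idx) \<Rightarrow> bool" where
  "covers \<Gamma> \<rho> \<longleftrightarrow> (\<forall>x Q. \<Gamma> x = Some Q \<longrightarrow> (\<exists>i\<in>ix Q. \<rho> x = Some i))"

lemma covers_empty [simp]: "covers Map.empty \<rho>"
  by (simp add: covers_def)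

lemma cix_iff: "\<rho> \<in> cix \<Gamma> \<longleftrightarrow> dom \<rho> = dom \<Gamma> \<and> covers \<Gamma> \<rho>"
  unfolding cix_def covers_def by (auto simp: dom_def set_eq_iff) fastforce+

lemma cix_empty [simp]: "cix Map.empty = {Map.empty}"
  by (auto simp: cix_def)

lemma covers_single: "covers [x \<mapsto> Q] \<rho> \<longleftrightarrow> (\<exists>i\<in>ix Q. \<rho> x = Some i)"
  by (simp add: covers_def)

lemma cix_single: "\<rho> \<in> cix [x \<mapsto> Q] \<longleftrightarrow> (\<exists>i\<in>ix Q. \<rho> = [x \<mapsto> i])"
proof
  assume "\<rho> \<in> cix [x \<mapsto> Q]"
  then obtain i where i: "i \<in> ix Q" "\<rho> x = Some i" "dom \<rho> = {x}"
    by (auto simp: cix_iff covers_single)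
  then have "\<rho> = [x \<mapsto> i]" by (metis dom_eq_singleton_conv fun_upd_same option.inject)
  then show "\<exists>i\<in>ix Q. \<rho> = [x \<mapsto> i]" using i(1) by blast
next
  assume "\<exists>i\<in>ix Q. \<rho> = [x \<mapsto> i]"
  then obtain i where "i \<in> ix Q" "\<rho> = [x \<mapsto> i]" by blast
  then show "\<rho> \<in> cix [x \<mapsto> Q]" unfolding cix_iff covers_single by simp
qed

lemma covers_add:
  assumes "dom \<Gamma>1 \<inter> dom \<Gamma>2 = {}"
  shows "covers (\<Gamma>1 ++ \<Gamma>2) \<rho> \<longleftrightarrow> covers \<Gamma>1 \<rho> \<and> covers \<Gamma>2 \<rho>"
proof -
  have "(\<Gamma>1 ++ \<Gamma>2) x = Some Q \<longleftrightarrow> \<Gamma>1 x = Some Q \<or> \<Gamma>2 x = Some Q" for x Q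
    using assms by (auto simp: map_add_Some_iff dom_def)
  then show ?thesis unfolding covers_def by blast
qed

lemma covers_cong: "(\<And>x. x \<in> dom \<Gamma> \<Longrightarrow> \<rho> x = \<rho>' x) \<Longrightarrow> covers \<Gamma> \<rho> \<longleftrightarrow> covers \<Gamma> \<rho>'"
  unfolding covers_def by (metis domI)

lemma cix_add:
  assumes "dom \<Gamma>1 \<inter> dom \<Gamma>2 = {}" "\<rho>1 \<in> cix \<Gamma>1" "\<rho>2 \<in> cix \<Gamma>2"
  shows "\<rho>1 ++ \<rho>2 \<in> cix (\<Gamma>1 ++ \<Gamma>2)"
proof -
  have "dom \<rho>1 = dom \<Gamma>1" "dom \<rho>2 = dom \<Gamma>2" using assms by (simp_all add: cix_iff)
  then have "x \<notin> dom \<rho>2" if "x \<in> dom \<Gamma>1" for x using assms(1) that by blast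
  then have "covers \<Gamma>1 (\<rho>1 ++ \<rho>2) \<longleftrightarrow> covers \<Gamma>1 \<rho>1"
    by (intro covers_cong map_add_dom_app_simps(3))
  moreover have "covers \<Gamma>2 (\<rho>1 ++ \<rho>2) \<longleftrightarrow> covers \<Gamma>2 \<rho>2"
    using \<open>dom \<rho>2 = dom \<Gamma>2\<close> by (intro covers_cong map_add_dom_app_simps(1)) simp
  ultimately show ?thesis using assms by (auto simp: cix_iff covers_add)
qed

lemma cix_restrict:
  assumes "dom \<Gamma>1 \<inter> dom \<Gamma>2 = {}" "\<rho> \<in> cix (\<Gamma>1 ++ \<Gamma>2)"
  shows "\<rho> |` dom \<Gamma>1 \<in> cix \<Gamma>1" "\<rho> |` dom \<Gamma>2 \<in> cix \<Gamma>2" "\<rho> |` dom \<Gamma>1 ++ \<rho> |` dom \<Gamma>2 = \<rho>"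
proof -
  have "covers \<Gamma>1 (\<rho> |` dom \<Gamma>1) \<longleftrightarrow> covers \<Gamma>1 \<rho>" "covers \<Gamma>2 (\<rho> |` dom \<Gamma>2) \<longleftrightarrow> covers \<Gamma>2 \<rho>"
    by (rule covers_cong; simp)+
  then show "\<rho> |` dom \<Gamma>1 \<in> cix \<Gamma>1" "\<rho> |` dom \<Gamma>2 \<in> cix \<Gamma>2"
    using assms by (auto simp: cix_iff covers_add)
  show "\<rho> |` dom \<Gamma>1 ++ \<rho> |` dom \<Gamma>2 = \<rho>"
  proof
    fix x
    have "\<rho> x = None" if "x \<notin> dom \<Gamma>1" "x \<notin> dom \<Gamma>2"
      using assms(2) that unfolding cix_iff by (metis Un_iff domIff dom_map_add)
    then show "(\<rho> |` dom \<Gamma>1 ++ \<rho> |` dom \<Gamma>2) x = \<rho> x"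
      by (auto simp: map_add_def restrict_map_def split: option.splits)
  qed
qed

lemma map_add_restrict_left: "dom \<rho>1 \<inter> dom \<rho>2 = {} \<Longrightarrow> (\<rho>1 ++ \<rho>2) |` dom \<rho>1 = \<rho>1"
  by (intro ext) (auto simp: map_add_def restrict_map_def split: option.splits)

lemma map_add_restrict_right: "(\<rho>1 ++ \<rho>2) |` dom \<rho>2 = \<rho>2"
  by (intro ext) (auto simp: map_add_def restrict_map_def split: option.splits)

lemma sum_list_nonzero: "(\<Sum>p\<leftarrow>ts. g p) \<noteq> (0::complex) \<Longrightarrow> \<exists>p\<in>set ts. g p \<noteq> 0"
  by (induction ts) auto

lemma amp_Sum_nonzero: "amp (Sum ts) \<rho> k \<noteq> 0 \<Longrightarrow> \<exists>p\<in>set ts. amp (snd p) \<rho> k \<noteq> 0"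
  using sum_list_nonzero[of "\<lambda>p. fst p * amp (snd p) \<rho> k" ts] by force

text \<open>For expressions the lemma is needed before unitarity is known.\<close>

lemma amp_supp_aux:
  assumes "wt \<Gamma> t Q" "covers \<Gamma> \<rho>"
    and "expression t \<or> (\<forall>u Q1 Q2. \<tturnstile> u \<Colon> U(Q1, Q2) \<longrightarrow> unitary_mat (ix Q1) (ix Q2) (umat u))"
  shows "finite {k. amp t \<rho> k \<noteq> 0} \<and> {k. amp t \<rho> k \<noteq> 0} \<subseteq> ix Q"
  using assms
proof (induction rule: wt.induct)
  case (wt_tensor \<Gamma>1 t1 Q1 \<Gamma>2 t2 Q2)
  then have "finite {k. amp t1 \<rho> k \<noteq> 0} \<and> {k. amp t1 \<rho> k \<noteq> 0} \<subseteq> ix Q1"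
    "finite {k. amp t2 \<rho> k \<noteq> 0} \<and> {k. amp t2 \<rho> k \<noteq> 0} \<subseteq> ix Q2"
    using covers_add by auto
  then show ?case using finite_tvec by (auto simp: tvec_nonzero simp del: mult_eq_0_iff)
next
  case (wt_inl \<Gamma> t Q1 Q2)
  then have "finite {k. amp t \<rho> k \<noteq> 0} \<and> {k. amp t \<rho> k \<noteq> 0} \<subseteq> ix Q1" by simp
  then show ?case using finite_inj_l[of "amp t \<rho>"] by (auto simp: inj_l_nonzero)
next
  case (wt_inr \<Gamma> t Q2 Q1)
  then have "finite {k. amp t \<rho> k \<noteq> 0} \<and> {k. amp t \<rho> k \<noteq> 0} \<subseteq> ix Q2" by simp
  then show ?case using finite_inj_r[of "amp t \<rho>"] by (auto simp: inj_r_nonzero)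
next
  case (wt_succ \<Gamma> t)
  then have "finite {k. amp t \<rho> k \<noteq> 0}" by simp
  then show ?case using finite_shift[of "amp t \<rho>"] by (auto simp: shift_nonzero)
next
  case (wt_sum ts \<Gamma> Q)
  have IH: "finite {k. amp (snd p) \<rho> k \<noteq> 0} \<and> {k. amp (snd p) \<rho> k \<noteq> 0} \<subseteq> ix Q" if "p \<in> set ts" for p
    by (rule wt_sum.IH[OF that wt_sum.prems(1)]) (use wt_sum.prems(2) that in auto)
  have sub: "{k. amp (Sum ts) \<rho> k \<noteq> 0} \<subseteq> (\<Union>p\<in>set ts. {k. amp (snd p) \<rho> k \<noteq> 0})"
    using amp_Sum_nonzero by blast
  have "finite (\<Union>p\<in>set ts. {k. amp (snd p) \<rho> k \<noteq> 0})" using IH by blast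
  then show ?case using sub IH finite_subset by blast
next
  case (wt_app u Q1 Q2 \<Gamma> t)
  then have M: "isometric (ix Q1) (ix Q2) (umat u)" by (simp add: unitary_mat_def)
  have "finite {k. amp t \<rho> k \<noteq> 0}" "{k. amp t \<rho> k \<noteq> 0} \<subseteq> ix Q1" using wt_app by simp_all
  then show ?case using mapp_finite[OF M] mapp_supp[OF M] by simp
next
  case (wt_var x Q)
  then obtain i where "\<rho> x = Some i" "i \<in> ix Q" unfolding covers_single by blast
  then show ?case by auto
qed auto

lemma expression_supp:
  assumes "wt \<Gamma> t Q" "covers \<Gamma> \<rho>" "expression t"
  shows "finite {k. amp t \<rho> k \<noteq> 0}" "amp t \<rho> k \<noteq> 0 \<Longrightarrow> k \<in> ix Q"
  using amp_supp_aux[OF assms(1,2)] assms(3) by auto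

text \<open>In an expression the index assigned to each variable reappears inside the output index,
  so an output index of the right type forces the inputs to have theirs. Hence the type-free sum in
  \<open>umat (Clauses cs)\<close> gets no contribution from ill-typed valuations.\<close>

lemma expression_covers:
  assumes "wt \<Gamma> t Q" "expression t" "amp t \<rho> k \<noteq> 0" "k \<in> ix Q"
  shows "covers \<Gamma> \<rho>"
  using assms
proof (induction arbitrary: k rule: wt.induct)
  case (wt_tensor \<Gamma>1 t1 Q1 \<Gamma>2 t2 Q2)
  then show ?case by (auto simp: covers_add)
next
  case (wt_inl \<Gamma> t Q1 Q2)
  then show ?case by (auto simp: inj_l_nonzero)
next
  case (wt_inr \<Gamma> t Q2 Q1)
  then show ?case by (auto simp: inj_r_nonzero)
next
  case (wt_succ \<Gamma> t)
  then show ?case by (auto simp: shift_nonzero)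
next
  case (wt_sum ts \<Gamma> Q)
  then show ?case using amp_Sum_nonzero by (metis expression.simps(9))
next
  case (wt_var x Q)
  then show ?case by (auto simp: covers_def split: if_splits)
qed auto

text \<open>For a variable the output index determines the valuation; in a tensor the valuation
  splits along the two disjoint contexts, and a sum has only finitely many summands. Thus a fixed
  output index is reached from finitely many valuations, although \<open>cix \<Gamma>\<close> may be
  infinite.\<close>

lemma expression_column_finite:
  assumes "wt \<Gamma> t Q" "expression t"
  shows "finite {\<rho>\<in>cix \<Gamma>. amp t \<rho> k \<noteq> 0}"
  using assms
proof (induction arbitrary: k rule: wt.induct)
  case (wt_var x Q)
  have "{\<rho> \<in> cix [x \<mapsto> Q]. amp (Var x) \<rho> k \<noteq> 0} \<subseteq> {[x \<mapsto> k]}"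
    by (auto simp: cix_single)
  then show ?case using finite_subset by blast
next
  case (wt_tensor \<Gamma>1 t1 Q1 \<Gamma>2 t2 Q2)
  show ?case
  proof (cases k)
    case (IPair i j)
    have "{\<rho> \<in> cix (\<Gamma>1 ++ \<Gamma>2). amp (Tensor t1 t2) \<rho> k \<noteq> 0} \<subseteq>
        (\<lambda>(\<rho>1, \<rho>2). \<rho>1 ++ \<rho>2) ` ({\<rho>\<in>cix \<Gamma>1. amp t1 \<rho> i \<noteq> 0} \<times> {\<rho>\<in>cix \<Gamma>2. amp t2 \<rho> j \<noteq> 0})"
    proof
      fix \<rho> assume r: "\<rho> \<in> {\<rho> \<in> cix (\<Gamma>1 ++ \<Gamma>2). amp (Tensor t1 t2) \<rho> k \<noteq> 0}"
      have "amp t1 (\<rho> |` dom \<Gamma>1) = amp t1 \<rho>" "amp t2 (\<rho> |` dom \<Gamma>2) = amp t2 \<rho>"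
        using wt_tensor.hyps wt_dom by (auto intro!: amp_cong)
      then have "(\<rho> |` dom \<Gamma>1, \<rho> |` dom \<Gamma>2) \<in> {\<rho>\<in>cix \<Gamma>1. amp t1 \<rho> i \<noteq> 0} \<times> {\<rho>\<in>cix \<Gamma>2. amp t2 \<rho> j \<noteq> 0}"
        using r IPair cix_restrict[OF wt_tensor.hyps(3)] by auto
      then show "\<rho> \<in> (\<lambda>(\<rho>1, \<rho>2). \<rho>1 ++ \<rho>2) ` ({\<rho>\<in>cix \<Gamma>1. amp t1 \<rho> i \<noteq> 0} \<times> {\<rho>\<in>cix \<Gamma>2. amp t2 \<rho> j \<noteq> 0})"
        using r cix_restrict(3)[OF wt_tensor.hyps(3)] by (intro image_eqI) auto
    qed
    then show ?thesis
      by (rule finite_subset) (use wt_tensor in \<open>intro finite_imageI finite_cartesian_product, simp_all\<close>)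
  qed auto
next
  case (wt_inl \<Gamma> t Q1 Q2)
  then show ?case by (cases k) auto
next
  case (wt_inr \<Gamma> t Q2 Q1)
  then show ?case by (cases k) auto
next
  case (wt_succ \<Gamma> t)
  show ?case
  proof (cases "\<exists>n. k = INum (Suc n)")
    case True
    then show ?thesis using wt_succ by auto
  next
    case False
    then have "shift (amp t \<rho>) k = 0" for \<rho> using shift_nonzero by metis
    then show ?thesis by simp
  qed
next
  case (wt_sum ts \<Gamma> Q)
  have "{\<rho>\<in>cix \<Gamma>. amp (Sum ts) \<rho> k \<noteq> 0} \<subseteq> (\<Union>p\<in>set ts. {\<rho>\<in>cix \<Gamma>. amp (snd p) \<rho> k \<noteq> 0})"
    using amp_Sum_nonzero by blast
  moreover have "finite (\<Union>p\<in>set ts. {\<rho>\<in>cix \<Gamma>. amp (snd p) \<rho> k \<noteq> 0})"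
    using wt_sum.IH wt_sum.prems by (intro finite_UN_I) auto
  ultimately show ?case by (rule finite_subset)
qed auto


section \<open>Syntactic orthonormal bases denote orthonormal bases\<close>

lemma wt_tensor_fam:
  assumes "wt \<Gamma> (Tensor a b) (QTensor Q1 Q2)" "\<rho> \<in> cix \<Gamma>"
  obtains \<Gamma>1 \<Gamma>2 where "wt \<Gamma>1 a Q1" "wt \<Gamma>2 b Q2" "\<rho> |` fv a \<in> cix \<Gamma>1" "\<rho> |` fv b \<in> cix \<Gamma>2"
    "\<rho> |` fv a ++ \<rho> |` fv b = \<rho>"
    "amp (Tensor a b) \<rho> = tvec (amp a (\<rho> |` fv a)) (amp b (\<rho> |` fv b))"
proof -
  obtain \<Gamma>1 \<Gamma>2 where G: "\<Gamma> = \<Gamma>1 ++ \<Gamma>2" "wt \<Gamma>1 a Q1" "wt \<Gamma>2 b Q2" "dom \<Gamma>1 \<inter> dom \<Gamma>2 = {}"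
    using assms(1) by (auto elim: wt_tensorE)
  have "amp a (\<rho> |` fv a) = amp a \<rho>" "amp b (\<rho> |` fv b) = amp b \<rho>" by (rule amp_cong; simp)+
  then show ?thesis
    using that[OF G(2,3)] cix_restrict[OF G(4)] assms(2) G(1) wt_dom[OF G(2)] wt_dom[OF G(3)] by simp
qed

lemma amp_Tensor_add:
  assumes "wt \<Gamma>1 a Q1" "wt \<Gamma>2 b Q2" "\<rho>1 \<in> cix \<Gamma>1" "\<rho>2 \<in> cix \<Gamma>2" "dom \<Gamma>1 \<inter> dom \<Gamma>2 = {}"
  shows "amp (Tensor a b) (\<rho>1 ++ \<rho>2) = tvec (amp a \<rho>1) (amp b \<rho>2)"
proof -
  have d: "dom \<rho>1 = fv a" "dom \<rho>2 = fv b" "fv a \<inter> fv b = {}"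
    using assms wt_dom by (auto simp: cix_iff)
  have "amp a (\<rho>1 ++ \<rho>2) = amp a \<rho>1"
    by (rule amp_cong, rule map_add_dom_app_simps(3)) (use d in auto)
  moreover have "amp b (\<rho>1 ++ \<rho>2) = amp b \<rho>2"
    by (rule amp_cong, rule map_add_dom_app_simps(1)) (use d in auto)
  ultimately show ?thesis by simp
qed

text \<open>The vectors \<open>amp e \<rho>\<close> with \<open>(e, \<rho>) \<in> fam Q S\<close> form the orthonormal basis denoted by \<open>S\<close>.\<close>

definition fam :: "qty \<Rightarrow> tm set \<Rightarrow> (tm \<times> (var \<rightharpoonup> idx)) set" where
  "fam Q S = {(e, \<rho>). e \<in> S \<and> (\<exists>\<Gamma>. wt \<Gamma> e Q \<and> \<rho> \<in> cix \<Gamma>)}"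

definition typeable :: "qty \<Rightarrow> tm set \<Rightarrow> bool" where
  "typeable Q S \<longleftrightarrow> (\<forall>e\<in>S. expression e \<and> (\<exists>\<Gamma>. wt \<Gamma> e Q))"

definition orthonormal_on :: "qty \<Rightarrow> tm set \<Rightarrow> bool" where
  "orthonormal_on Q S \<longleftrightarrow> (\<forall>(e, \<rho>)\<in>fam Q S. \<forall>(e', \<rho>')\<in>fam Q S.
     ip (amp e \<rho>) (amp e' \<rho>') = (if e = e' \<and> \<rho> = \<rho>' then 1 else 0))"

definition spanning_on :: "qty \<Rightarrow> tm set \<Rightarrow> bool" where
  "spanning_on Q S \<longleftrightarrow> (\<forall>k\<in>ix Q. ket k \<in> cspan (case_prod amp ` fam Q S))"

lemma orthonormal_onD:
  assumes "orthonormal_on Q S" "e \<in> S" "e' \<in> S" "wt \<Gamma> e Q" "wt \<Gamma>' e' Q" "\<rho> \<in> cix \<Gamma>" "\<rho>' \<in> cix \<Gamma>'"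
  shows "ip (amp e \<rho>) (amp e' \<rho>') = (if e = e' \<and> \<rho> = \<rho>' then 1 else 0)"
  using assms unfolding orthonormal_on_def fam_def by blast

lemma orthonormal_onI:
  assumes "\<And>e e' \<Gamma> \<Gamma>' \<rho> \<rho>'. e \<in> S \<Longrightarrow> e' \<in> S \<Longrightarrow> wt \<Gamma> e Q \<Longrightarrow> wt \<Gamma>' e' Q \<Longrightarrow> \<rho> \<in> cix \<Gamma> \<Longrightarrow> \<rho>' \<in> cix \<Gamma>' \<Longrightarrow>
    ip (amp e \<rho>) (amp e' \<rho>') = (if e = e' \<and> \<rho> = \<rho>' then 1 else 0)"
  shows "orthonormal_on Q S"
  using assms unfolding orthonormal_on_def fam_def by blast

lemma fam_isometric:
  assumes "typeable Q S" "orthonormal_on Q S"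
  shows "isometric (fam Q S) (ix Q) (case_prod amp)"
proof (rule isometricI)
  fix p assume "p \<in> fam Q S"
  then obtain e \<rho> \<Gamma> where p: "p = (e, \<rho>)" "e \<in> S" "wt \<Gamma> e Q" "covers \<Gamma> \<rho>"
    by (auto simp: fam_def cix_iff)
  then show "finite {k. case_prod amp p k \<noteq> 0}" "\<And>k. case_prod amp p k \<noteq> 0 \<Longrightarrow> k \<in> ix Q"
    using expression_supp[OF p(3,4)] assms(1) by (auto simp: typeable_def)
next
  fix p q assume "p \<in> fam Q S" "q \<in> fam Q S"
  then show "ip (case_prod amp p) (case_prod amp q) = (if p = q then 1 else 0)"
    using assms(2) unfolding orthonormal_on_def by (cases p; cases q) fastforce
qed

lemma tvec_linear_left:
  "tvec (\<lambda>_. 0) w = (\<lambda>_. 0)" "tvec (\<lambda>k. v k + c * v' k) w = (\<lambda>k. tvec v w k + c * tvec v' w k)"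
  by (rule ext, simp add: tvec_def algebra_simps split: idx.split)+

lemma tvec_linear_right:
  "tvec v (\<lambda>_. 0) = (\<lambda>_. 0)" "tvec v (\<lambda>k. w k + c * w' k) = (\<lambda>k. tvec v w k + c * tvec v w' k)"
  by (rule ext, simp add: tvec_def algebra_simps split: idx.split)+

lemma inj_l_linear:
  "inj_l (\<lambda>_. 0) = (\<lambda>_. 0)" "inj_l (\<lambda>k. v k + c * v' k) = (\<lambda>k. inj_l v k + c * inj_l v' k)"
  by (rule ext, simp add: inj_l_def split: idx.split)+

lemma inj_r_linear:
  "inj_r (\<lambda>_. 0) = (\<lambda>_. 0)" "inj_r (\<lambda>k. v k + c * v' k) = (\<lambda>k. inj_r v k + c * inj_r v' k)"
  by (rule ext, simp add: inj_r_def split: idx.split)+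

lemma shift_linear:
  "shift (\<lambda>_. 0) = (\<lambda>_. 0)" "shift (\<lambda>k. v k + c * v' k) = (\<lambda>k. shift v k + c * shift v' k)"
  by (rule ext, simp add: shift_def split: idx.split nat.split)+

lemma ket_image:
  "inj_l (ket i) = ket (IInl i)" "inj_r (ket i) = ket (IInr i)" "shift (ket (INum n)) = ket (INum (Suc n))"
  "tvec (ket i) (ket j) = ket (IPair i j)"
  by (rule ext, auto simp: inj_l_def inj_r_def shift_def tvec_def ket_apply split: idx.split nat.split)+

lemma typeable_succ:
  assumes "typeable QNat ({Zero} \<union> Succ ` S)"
  shows "typeable QNat S"
  unfolding typeable_def
proof
  fix e assume "e \<in> S"
  then obtain \<Gamma> where "expression (Succ e)" "wt \<Gamma> (Succ e) QNat"
    using assms[unfolded typeable_def, THEN bspec, of "Succ e"] by fast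
  then show "expression e \<and> (\<exists>\<Gamma>. wt \<Gamma> e QNat)" by (auto simp: wt_Succ_iff)
qed

lemma typeable_plus:
  assumes "typeable (QPlus Q1 Q2) (Inl ` S \<union> Inr ` T)"
  shows "typeable Q1 S" "typeable Q2 T"
proof -
  have "expression e \<and> (\<exists>\<Gamma>. wt \<Gamma> e Q1)" if e: "e \<in> S" for e
  proof -
    obtain \<Gamma> where "expression (Inl e)" "wt \<Gamma> (Inl e) (QPlus Q1 Q2)"
      using assms[unfolded typeable_def, THEN bspec, of "Inl e"] e by fast
    then show ?thesis by (metis expression.simps(3) qty.inject(1) wt_inlE)
  qed
  moreover have "expression e \<and> (\<exists>\<Gamma>. wt \<Gamma> e Q2)" if e: "e \<in> T" for e
  proof -
    obtain \<Gamma> where "expression (Inr e)" "wt \<Gamma> (Inr e) (QPlus Q1 Q2)"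
      using assms[unfolded typeable_def, THEN bspec, of "Inr e"] e by fast
    then show ?thesis by (metis expression.simps(4) qty.inject(1) wt_inrE)
  qed
  ultimately show "typeable Q1 S" "typeable Q2 T" unfolding typeable_def by blast+
qed

lemma typeable_tensor:
  assumes "typeable (QTensor Q1 Q2) S"
  shows "typeable Q1 (proj1 S)" "typeable Q2 (proj2 S)" "typeable Q1 (slice2 S b)" "typeable Q2 (slice1 S a)"
proof -
  have "expression a \<and> expression b \<and> (\<exists>\<Gamma>. wt \<Gamma> a Q1) \<and> (\<exists>\<Gamma>. wt \<Gamma> b Q2)" if "Tensor a b \<in> S" for a b
  proof -
    have *: "expression (Tensor a b) \<and> (\<exists>\<Gamma>. wt \<Gamma> (Tensor a b) (QTensor Q1 Q2))"
      using assms[unfolded typeable_def] that by (rule bspec)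
    from conjunct2[OF *] obtain \<Gamma> where "wt \<Gamma> (Tensor a b) (QTensor Q1 Q2)" ..
    then show ?thesis
    proof (rule wt_tensorE)
    qed (use conjunct1[OF *] in auto)
  qed
  then show "typeable Q1 (proj1 S)" "typeable Q2 (proj2 S)" "typeable Q1 (slice2 S b)" "typeable Q2 (slice1 S a)"
    unfolding typeable_def proj1_def proj2_def slice1_def slice2_def by blast+
qed

text \<open>The common part of the two tensor rules. The hypothesis is stated for the product of the
  inner products, since one factor may be arbitrary as soon as the other one vanishes.\<close>

lemma orthonormal_tensor:
  assumes "tensor_set S"
    and cases: "\<And>a b a' b' \<Gamma>1 \<Gamma>2 \<Gamma>1' \<Gamma>2' \<rho>1 \<rho>2 \<rho>1' \<rho>2'. Tensor a b \<in> S \<Longrightarrow> Tensor a' b' \<in> S \<Longrightarrow>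
      wt \<Gamma>1 a Q1 \<Longrightarrow> wt \<Gamma>2 b Q2 \<Longrightarrow> wt \<Gamma>1' a' Q1 \<Longrightarrow> wt \<Gamma>2' b' Q2 \<Longrightarrow>
      \<rho>1 \<in> cix \<Gamma>1 \<Longrightarrow> \<rho>2 \<in> cix \<Gamma>2 \<Longrightarrow> \<rho>1' \<in> cix \<Gamma>1' \<Longrightarrow> \<rho>2' \<in> cix \<Gamma>2' \<Longrightarrow>
      ip (amp a \<rho>1) (amp a' \<rho>1') * ip (amp b \<rho>2) (amp b' \<rho>2') =
        (if a = a' \<and> \<rho>1 = \<rho>1' \<and> b = b' \<and> \<rho>2 = \<rho>2' then 1 else 0)"
    and "typeable (QTensor Q1 Q2) S"
  shows "orthonormal_on (QTensor Q1 Q2) S"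
proof (rule orthonormal_onI)
  fix e e' \<Gamma> \<Gamma>' \<rho> \<rho>'
  assume e: "e \<in> S" "wt \<Gamma> e (QTensor Q1 Q2)" "\<rho> \<in> cix \<Gamma>"
    and e': "e' \<in> S" "wt \<Gamma>' e' (QTensor Q1 Q2)" "\<rho>' \<in> cix \<Gamma>'"
  obtain a b a' b' where ab: "e = Tensor a b" "e' = Tensor a' b'"
    using e(1) e'(1) assms(1) unfolding tensor_set_def by blast
  obtain \<Gamma>1 \<Gamma>2 where G: "wt \<Gamma>1 a Q1" "wt \<Gamma>2 b Q2" "\<rho> |` fv a \<in> cix \<Gamma>1" "\<rho> |` fv b \<in> cix \<Gamma>2"
    "\<rho> |` fv a ++ \<rho> |` fv b = \<rho>" "amp e \<rho> = tvec (amp a (\<rho> |` fv a)) (amp b (\<rho> |` fv b))"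
    using wt_tensor_fam[of \<Gamma> a b Q1 Q2 \<rho>] e unfolding ab by metis
  obtain \<Gamma>1' \<Gamma>2' where G': "wt \<Gamma>1' a' Q1" "wt \<Gamma>2' b' Q2" "\<rho>' |` fv a' \<in> cix \<Gamma>1'" "\<rho>' |` fv b' \<in> cix \<Gamma>2'"
    "\<rho>' |` fv a' ++ \<rho>' |` fv b' = \<rho>'" "amp e' \<rho>' = tvec (amp a' (\<rho>' |` fv a')) (amp b' (\<rho>' |` fv b'))"
    using wt_tensor_fam[of \<Gamma>' a' b' Q1 Q2 \<rho>'] e' unfolding ab by metis
  have ex: "expression a" "expression b" using assms(3) e(1) unfolding ab typeable_def by force+
  have "finite {k. amp a (\<rho> |` fv a) k \<noteq> 0}" "finite {k. amp b (\<rho> |` fv b) k \<noteq> 0}"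
    using expression_supp(1)[OF G(1) _ ex(1)] expression_supp(1)[OF G(2) _ ex(2)] G(3,4)
    by (auto simp: cix_iff)
  then have "ip (amp e \<rho>) (amp e' \<rho>') = ip (amp a (\<rho> |` fv a)) (amp a' (\<rho>' |` fv a')) * ip (amp b (\<rho> |` fv b)) (amp b' (\<rho>' |` fv b'))"
    unfolding G(6) G'(6) by (rule ip_tvec)
  also have "\<dots> = (if a = a' \<and> \<rho> |` fv a = \<rho>' |` fv a' \<and> b = b' \<and> \<rho> |` fv b = \<rho>' |` fv b' then 1 else 0)"
    by (rule cases) (use e(1) e'(1) ab G G' in simp_all)
  also have "\<dots> = (if e = e' \<and> \<rho> = \<rho>' then 1 else 0)"
  proof -
    have "\<rho> = \<rho>'" if "\<rho> |` fv a = \<rho>' |` fv a'" "\<rho> |` fv b = \<rho>' |` fv b'"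
      using G(5) G'(5) that by simp
    then show ?thesis unfolding ab by auto
  qed
  finally show "ip (amp e \<rho>) (amp e' \<rho>') = (if e = e' \<and> \<rho> = \<rho>' then 1 else 0)" .
qed

text \<open>The contexts \<open>\<Gamma>1\<close> and \<open>\<Gamma>2\<close> are not assumed
  disjoint. By uniqueness they coincide with the contexts in the typing of
  \<open>Tensor a b\<close>, which are, so \<open>\<rho>1 ++ \<rho>2\<close> is a valuation of the
  whole.\<close>

lemma tensor_in_fam:
  assumes "typeable (QTensor Q1 Q2) S" "Tensor a b \<in> S" "wt \<Gamma>1 a Q1" "wt \<Gamma>2 b Q2" "\<rho>1 \<in> cix \<Gamma>1" "\<rho>2 \<in> cix \<Gamma>2"
  shows "tvec (amp a \<rho>1) (amp b \<rho>2) \<in> case_prod amp ` fam (QTensor Q1 Q2) S"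
proof -
  have "expression (Tensor a b) \<and> (\<exists>\<Gamma>. wt \<Gamma> (Tensor a b) (QTensor Q1 Q2))"
    using assms(1)[unfolded typeable_def] assms(2) by (rule bspec)
  then obtain \<Gamma> where G: "wt \<Gamma> (Tensor a b) (QTensor Q1 Q2)" "expression a" "expression b"
    by auto
  from G(1) obtain \<Gamma>1' \<Gamma>2' where "\<Gamma> = \<Gamma>1' ++ \<Gamma>2'" "wt \<Gamma>1' a Q1" "wt \<Gamma>2' b Q2" and d: "dom \<Gamma>1' \<inter> dom \<Gamma>2' = {}"
    by (auto elim: wt_tensorE)
  then have eq: "\<Gamma> = \<Gamma>1 ++ \<Gamma>2" "\<Gamma>1' = \<Gamma>1" "\<Gamma>2' = \<Gamma>2"
    using wt_unique[OF assms(3) G(2)] wt_unique[OF assms(4) G(3)] by auto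
  have "amp (Tensor a b) (\<rho>1 ++ \<rho>2) = tvec (amp a \<rho>1) (amp b \<rho>2)"
    using amp_Tensor_add[OF assms(3-6)] d eq by blast
  moreover have "(Tensor a b, \<rho>1 ++ \<rho>2) \<in> fam (QTensor Q1 Q2) S"
    using cix_add[OF _ assms(5,6)] d eq G(1) assms(2) unfolding fam_def by blast
  ultimately show ?thesis by (metis (no_types, lifting) case_prod_conv image_eqI)
qed


lemma amp_Var_single: "amp (Var x) [x \<mapsto> i] = ket i"
  by (rule ext) (auto simp: ket_apply)

text \<open>For the tensor rules, components in the projected basis that differ give a zero factor;
  if they agree, the other components lie in the same slice. For the unitary rule, inner products of
  the new vectors reduce to those of rows of the matrix.\<close>

lemma ONBe_orthonormal: "ONBe Q S \<Longrightarrow> typeable Q S \<Longrightarrow> orthonormal_on Q S"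
proof (induction rule: ONBe.induct)
  case (ONBe_var Q x)
  show ?case
  proof (rule orthonormal_onI)
    fix e e' \<Gamma> \<Gamma>' \<rho> \<rho>'
    assume "e \<in> {Var x}" "e' \<in> {Var x}" "wt \<Gamma> e Q" "wt \<Gamma>' e' Q" "\<rho> \<in> cix \<Gamma>" "\<rho>' \<in> cix \<Gamma>'"
    then have "e = Var x" "e' = Var x" "\<rho> \<in> cix [x \<mapsto> Q]" "\<rho>' \<in> cix [x \<mapsto> Q]"
      using wt_varE by blast+
    then obtain i j where "e = Var x" "e' = Var x" "\<rho> = [x \<mapsto> i]" "\<rho>' = [x \<mapsto> j]"
      unfolding cix_single by blast
    moreover have "[x \<mapsto> i] = [x \<mapsto> j] \<longleftrightarrow> i = j" by (metis fun_upd_same option.inject)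
    ultimately show "ip (amp e \<rho>) (amp e' \<rho>') = (if e = e' \<and> \<rho> = \<rho>' then 1 else 0)"
      by (simp only: amp_Var_single ip_ket_left ket_apply simp_thms)
  qed
next
  case ONBe_star
  show ?case
    by (rule orthonormal_onI) (auto simp: ip_ket_left ket_apply elim!: wt_starE)
next
  case (ONBe_plus Q1 S Q2 T)
  have "typeable Q1 S" "typeable Q2 T" using typeable_plus[OF ONBe_plus.prems] by auto
  then have o: "orthonormal_on Q1 S" "orthonormal_on Q2 T" using ONBe_plus.IH by auto
  show ?case
  proof (rule orthonormal_onI)
    fix e e' \<Gamma> \<Gamma>' \<rho> \<rho>'
    assume a: "e \<in> Inl ` S \<union> Inr ` T" "e' \<in> Inl ` S \<union> Inr ` T"
      "wt \<Gamma> e (QPlus Q1 Q2)" "wt \<Gamma>' e' (QPlus Q1 Q2)" "\<rho> \<in> cix \<Gamma>" "\<rho>' \<in> cix \<Gamma>'"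
    then consider f f' where "f \<in> S" "f' \<in> S" "e = Inl f" "e' = Inl f'"
      | f f' where "f \<in> T" "f' \<in> T" "e = Inr f" "e' = Inr f'"
      | f f' where "e = Inl f" "e' = Inr f'" | f f' where "e = Inr f" "e' = Inl f'" by fast
    then show "ip (amp e \<rho>) (amp e' \<rho>') = (if e = e' \<and> \<rho> = \<rho>' then 1 else 0)"
    proof cases
      case (1 f f')
      then show ?thesis
        using orthonormal_onD[OF o(1) 1(1,2), of \<Gamma> \<Gamma>' \<rho> \<rho>'] a by (simp add: wt_Inl_iff ip_inj_l)
    next
      case (2 f f')
      then show ?thesis
        using orthonormal_onD[OF o(2) 2(1,2), of \<Gamma> \<Gamma>' \<rho> \<rho>'] a by (simp add: wt_Inr_iff ip_inj_r)
    qed simp_all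
  qed
next
  case (ONBe_nat S)
  have ty: "typeable QNat S" by (rule typeable_succ[OF ONBe_nat.prems])
  then have o: "orthonormal_on QNat S" using ONBe_nat.IH by auto
  have sh: "ip (shift (amp e \<rho>)) (shift (amp e' \<rho>')) = ip (amp e \<rho>) (amp e' \<rho>')"
    if "e \<in> S" "wt \<Gamma> e QNat" "\<rho> \<in> cix \<Gamma>" for e e' \<Gamma> \<rho> \<rho>'
    by (rule ip_shift)
      (use that ty expression_supp(2)[OF that(2)] in \<open>auto simp: typeable_def cix_iff\<close>)
  show ?case
  proof (rule orthonormal_onI)
    fix e e' \<Gamma> \<Gamma>' \<rho> \<rho>'
    assume a: "e \<in> {Zero} \<union> Succ ` S" "e' \<in> {Zero} \<union> Succ ` S"
      "wt \<Gamma> e QNat" "wt \<Gamma>' e' QNat" "\<rho> \<in> cix \<Gamma>" "\<rho>' \<in> cix \<Gamma>'"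
    then consider f f' where "f \<in> S" "f' \<in> S" "e = Succ f" "e' = Succ f'"
      | f where "e = Succ f" "e' = Zero" | f where "e = Zero" "e' = Succ f"
      | "e = Zero" "e' = Zero" by fast
    then show "ip (amp e \<rho>) (amp e' \<rho>') = (if e = e' \<and> \<rho> = \<rho>' then 1 else 0)"
    proof cases
      case (1 f f')
      have "wt \<Gamma> f QNat" "wt \<Gamma>' f' QNat" using a(3,4) 1 by (simp_all add: wt_Succ_iff)
      then show ?thesis
        using orthonormal_onD[OF o 1(1,2), of \<Gamma> \<Gamma>' \<rho> \<rho>'] sh[OF 1(1), of \<Gamma> \<rho>] a(5,6) 1(3,4) by simp
    next
      case 4
      have "\<Gamma> = Map.empty" "\<Gamma>' = Map.empty" using a(3,4) 4 wt_zeroE by blast+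
      then show ?thesis using a(5,6) 4 by (simp add: ip_ket_left ket_apply)
    qed (simp_all add: ip_ket_left ip_ket_right)
  qed
next
  case (ONBe_tensor2 S Q2 Q1)
  have o2: "orthonormal_on Q2 (proj2 S)" using ONBe_tensor2 typeable_tensor by blast
  have o1: "orthonormal_on Q1 (slice2 S b)" if "b \<in> proj2 S" for b
    using ONBe_tensor2 that typeable_tensor by blast
  show ?case
  proof (rule orthonormal_tensor[OF ONBe_tensor2.hyps(1) _ ONBe_tensor2.prems], goal_cases)
    case (1 a b a' b' \<Gamma>1 \<Gamma>2 \<Gamma>1' \<Gamma>2' \<rho>1 \<rho>2 \<rho>1' \<rho>2')
    have b: "b \<in> proj2 S" "b' \<in> proj2 S" using 1 by (auto simp: proj2_def)
    have *: "ip (amp b \<rho>2) (amp b' \<rho>2') = (if b = b' \<and> \<rho>2 = \<rho>2' then 1 else 0)"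
      by (rule orthonormal_onD[OF o2 b]) (use 1 in auto)
    have "ip (amp a \<rho>1) (amp a' \<rho>1') = (if a = a' \<and> \<rho>1 = \<rho>1' then 1 else 0)" if "b = b'"
      by (rule orthonormal_onD[OF o1[OF b(1)]]) (use 1 that in \<open>auto simp: slice2_def\<close>)
    then show ?case using * by (cases "b = b'") simp_all
  qed
next
  case (ONBe_tensor1 S Q1 Q2)
  have o1: "orthonormal_on Q1 (proj1 S)" using ONBe_tensor1 typeable_tensor by blast
  have o2: "orthonormal_on Q2 (slice1 S a)" if "a \<in> proj1 S" for a
    using ONBe_tensor1 that typeable_tensor by blast
  show ?case
  proof (rule orthonormal_tensor[OF ONBe_tensor1.hyps(1) _ ONBe_tensor1.prems], goal_cases)
    case (1 a b a' b' \<Gamma>1 \<Gamma>2 \<Gamma>1' \<Gamma>2' \<rho>1 \<rho>2 \<rho>1' \<rho>2')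
    have a: "a \<in> proj1 S" "a' \<in> proj1 S" using 1 by (auto simp: proj1_def)
    have *: "ip (amp a \<rho>1) (amp a' \<rho>1') = (if a = a' \<and> \<rho>1 = \<rho>1' then 1 else 0)"
      by (rule orthonormal_onD[OF o1 a]) (use 1 in auto)
    have "ip (amp b \<rho>2) (amp b' \<rho>2') = (if b = b' \<and> \<rho>2 = \<rho>2' then 1 else 0)" if "a = a'"
      by (rule orthonormal_onD[OF o2[OF a(1)]]) (use 1 that in \<open>auto simp: slice1_def\<close>)
    then show ?case using * by (cases "a = a'") simp_all
  qed
next
  case (ONBe_unitary Q S \<alpha> en)
  let ?s = "\<lambda>e. Sum (map (\<lambda>e'. (\<alpha> e e', e')) (en e))"
  have en: "distinct (en e)" "set (en e) = S" if "e \<in> S" for e using ONBe_unitary.hyps that by auto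
  have ty: "typeable Q S"
    unfolding typeable_def
  proof
    fix e assume e: "e \<in> S"
    then obtain \<Gamma> where "expression (?s e)" "wt \<Gamma> (?s e) Q"
      using ONBe_unitary.prems unfolding typeable_def by blast
    then show "expression e \<and> (\<exists>\<Gamma>. wt \<Gamma> e Q)" using en[OF e] e by (fastforce elim!: wt_sumE)
  qed
  then have iso: "isometric (fam Q S) (ix Q) (case_prod amp)"
    using ONBe_unitary.IH fam_isometric by blast
  \<comment> \<open>The coefficients of \<open>amp (?s e) \<rho>\<close> in the family indexed by
    pairs of a term and a valuation: only pairs with the same valuation occur.\<close>
  define c where "c e \<rho> = (\<lambda>(e', \<rho>'). if e' \<in> S \<and> \<rho>' = \<rho> then \<alpha> e e' else 0)"
    for e and \<rho> :: "var \<Rightarrow> idx option"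
  have c_sub: "{p. c e \<rho> p \<noteq> 0} \<subseteq> (\<lambda>e'. (e', \<rho>)) ` S" for e \<rho>
    by (auto simp: c_def split: if_splits)
  have fin: "finite S" if "e \<in> S" for e using en[OF that] by (metis finite_set)
  have s: "amp (?s e) \<rho> = mapp (case_prod amp) (c e \<rho>)" if e: "e \<in> S" for e \<rho>
  proof
    fix k
    have "mapp (case_prod amp) (c e \<rho>) k = (\<Sum>p\<in>(\<lambda>e'. (e', \<rho>)) ` S. c e \<rho> p * case_prod amp p k)"
      by (rule mapp_eq_sum) (use fin[OF e] c_sub in auto)
    also have "\<dots> = (\<Sum>e'\<in>S. \<alpha> e e' * amp e' \<rho> k)"
      by (subst sum.reindex) (auto simp: inj_on_def c_def)
    also have "\<dots> = amp (?s e) \<rho> k"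
      using en[OF e] by (simp add: comp_def sum_list_distinct_conv_sum_set)
    finally show "amp (?s e) \<rho> k = mapp (case_prod amp) (c e \<rho>) k" by simp
  qed
  have wtS: "wt \<Gamma> e' Q" if "wt \<Gamma> (?s e) Q" "e \<in> S" "e' \<in> S" for \<Gamma> e e'
    using that(1) en[OF that(2)] that(3) by (fastforce elim!: wt_sumE)
  have ip_s: "ip (amp (?s e) \<rho>) (amp (?s f) \<rho>') = (if e = f \<and> \<rho> = \<rho>' then 1 else 0)"
    if e: "e \<in> S" "wt \<Gamma> (?s e) Q" "\<rho> \<in> cix \<Gamma>" and f: "f \<in> S" "wt \<Gamma>' (?s f) Q" "\<rho>' \<in> cix \<Gamma>'"
    for e f \<rho> \<rho>' \<Gamma> \<Gamma>'
  proof -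
    have sub: "{p. c e \<rho> p \<noteq> 0} \<subseteq> fam Q S" "{p. c f \<rho>' p \<noteq> 0} \<subseteq> fam Q S"
      using c_sub e f wtS[OF e(2,1)] wtS[OF f(2,1)] unfolding fam_def by fastforce+
    have "ip (amp (?s e) \<rho>) (amp (?s f) \<rho>') = ip (c e \<rho>) (c f \<rho>')"
      unfolding s[OF e(1)] s[OF f(1)]
      by (rule ip_mapp[OF iso]) (use sub finite_subset[OF c_sub] fin[OF e(1)] in auto)
    also have "\<dots> = (\<Sum>p\<in>(\<lambda>e'. (e', \<rho>)) ` S. cnj (c e \<rho> p) * c f \<rho>' p)"
      by (rule ip_eq_sum) (use fin[OF e(1)] c_sub in auto)
    also have "\<dots> = (\<Sum>e'\<in>S. cnj (\<alpha> e e') * (if \<rho> = \<rho>' then \<alpha> f e' else 0))"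
      by (subst sum.reindex) (auto simp: inj_on_def c_def intro!: sum.cong)
    also have "\<dots> = (if e = f \<and> \<rho> = \<rho>' then 1 else 0)"
    proof -
      have "(\<Sum>c\<in>S. \<alpha> f c * cnj (\<alpha> e c)) = (if f = e then 1 else 0)"
        using ONBe_unitary.hyps(2) e(1) f(1) unfolding unitary_on_def by blast
      then show ?thesis by (cases "\<rho> = \<rho>'") (simp_all add: mult.commute eq_commute[of f e])
    qed
    finally show ?thesis .
  qed
  show ?case
  proof (rule orthonormal_onI)
    fix x y \<Gamma> \<Gamma>' \<rho> \<rho>'
    assume x: "x \<in> ?s ` S" "wt \<Gamma> x Q" "\<rho> \<in> cix \<Gamma>" and y: "y \<in> ?s ` S" "wt \<Gamma>' y Q" "\<rho>' \<in> cix \<Gamma>'"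
    obtain e f where ef: "e \<in> S" "x = ?s e" "f \<in> S" "y = ?s f" using x(1) y(1) by blast
    \<comment> \<open>Orthonormality compares terms, so distinct \<open>e\<close> and
      \<open>f\<close> must not yield the same sum: its vector would have norm one and be orthogonal
      to itself.\<close>
    have "e = f" if "x = y"
    proof (rule ccontr)
      assume ne: "e \<noteq> f"
      have "ip (amp x \<rho>) (amp x \<rho>) = 1"
        using ip_s[of e \<Gamma> \<rho> e \<Gamma> \<rho>, folded ef(2)] ef(1) x(2,3) by simp
      moreover have "ip (amp x \<rho>) (amp x \<rho>) = 0"
        using ip_s[of e \<Gamma> \<rho> f \<Gamma> \<rho>, folded ef(2,4), folded that] ef(1,3) x(2,3) ne by simp
      ultimately show False by simp
    qed
    then have "x = y \<longleftrightarrow> e = f" using ef by auto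
    then show "ip (amp x \<rho>) (amp y \<rho>') = (if x = y \<and> \<rho> = \<rho>' then 1 else 0)"
      using ip_s[of e \<Gamma> \<rho> f \<Gamma>' \<rho>', folded ef(2,4)] ef(1,3) x(2,3) y(2,3) by simp
  qed
qed


lemma span_constructor:
  assumes "spanning_on Q' S" "k \<in> ix Q'" "C ` S \<subseteq> S'"
    and "\<And>\<Gamma> e. wt \<Gamma> e Q' \<Longrightarrow> wt \<Gamma> (C e) Q" "\<And>e \<rho>. amp (C e) \<rho> = T (amp e \<rho>)"
    and "T (\<lambda>_. 0) = (\<lambda>_. 0)" "\<And>v w c. T (\<lambda>k. v k + c * w k) = (\<lambda>k. T v k + c * T w k)"
  shows "T (ket k) \<in> cspan (case_prod amp ` fam Q S')"
proof (rule cspan_linear_image[where T = T, OF _ assms(6,7)])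
  show "ket k \<in> cspan (case_prod amp ` fam Q' S)" using assms(1,2) by (auto simp: spanning_on_def)
  fix w assume "w \<in> case_prod amp ` fam Q' S"
  then obtain e \<rho> \<Gamma> where w: "w = amp e \<rho>" "e \<in> S" "wt \<Gamma> e Q'" "\<rho> \<in> cix \<Gamma>" by (auto simp: fam_def)
  then have "(C e, \<rho>) \<in> fam Q S'" using assms(3,4) unfolding fam_def by blast
  then show "T w \<in> cspan (case_prod amp ` fam Q S')"
    unfolding w(1) assms(5)[symmetric] by (metis (no_types, lifting) case_prod_conv cspan_base image_eqI)
qed

text \<open>A bilinear \<open>f\<close> covers both orders of the tensor product. The set
  \<open>S'\<close> of second components may depend on the first component \<open>b\<close>, as the
  slices in the basis rules do; \<open>f (ket j) (ket i)\<close> is expanded in the first argument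
  and then, for each \<open>b\<close>, in the second.\<close>

lemma span_tensor:
  assumes S: "spanning_on Q S" and S': "\<And>b. b \<in> S \<Longrightarrow> spanning_on Q' (S' b)"
    and "j \<in> ix Q" "i \<in> ix Q'"
    and left: "\<And>v. f (\<lambda>_. 0) v = (\<lambda>_. 0)" "\<And>w w' v c. f (\<lambda>k. w k + c * w' k) v = (\<lambda>k. f w v k + c * f w' v k)"
    and right: "\<And>w. f w (\<lambda>_. 0) = (\<lambda>_. 0)" "\<And>w v v' c. f w (\<lambda>k. v k + c * v' k) = (\<lambda>k. f w v k + c * f w v' k)"
    and W: "\<And>b a \<Gamma> \<Gamma>' \<rho> \<rho>'. b \<in> S \<Longrightarrow> a \<in> S' b \<Longrightarrow> wt \<Gamma> b Q \<Longrightarrow> wt \<Gamma>' a Q' \<Longrightarrow> \<rho> \<in> cix \<Gamma> \<Longrightarrow> \<rho>' \<in> cix \<Gamma>' \<Longrightarrow>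
      f (amp b \<rho>) (amp a \<rho>') \<in> W"
  shows "f (ket j) (ket i) \<in> cspan W"
proof (rule cspan_linear_image[where T = "\<lambda>w. f w (ket i)", OF _ left])
  show "ket j \<in> cspan (case_prod amp ` fam Q S)" using S assms(3) by (auto simp: spanning_on_def)
  fix w assume "w \<in> case_prod amp ` fam Q S"
  then obtain b \<rho> \<Gamma> where w: "w = amp b \<rho>" "b \<in> S" "wt \<Gamma> b Q" "\<rho> \<in> cix \<Gamma>" by (auto simp: fam_def)
  show "f w (ket i) \<in> cspan W"
  proof (rule cspan_linear_image[where T = "f w", OF _ right])
    show "ket i \<in> cspan (case_prod amp ` fam Q' (S' b))" using S'[OF w(2)] assms(4) by (auto simp: spanning_on_def)
    fix v assume "v \<in> case_prod amp ` fam Q' (S' b)"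
    then show "f w v \<in> cspan W" using W w by (auto simp: fam_def intro!: cspan_base)
  qed
qed

text \<open>Each rule builds its vectors linearly from spanning families. In the unitary case the
  conjugate transpose of the matrix recovers the old vectors from the new ones.\<close>

lemma ONBe_spanning: "ONBe Q S \<Longrightarrow> typeable Q S \<Longrightarrow> spanning_on Q S"
proof (induction rule: ONBe.induct)
  case (ONBe_var Q x)
  show ?case
    unfolding spanning_on_def
  proof (intro ballI cspan_base)
    fix k assume "k \<in> ix Q"
    then have "(Var x, [x \<mapsto> k]) \<in> fam Q {Var x}"
      unfolding fam_def using wt_var cix_single by blast
    then show "ket k \<in> case_prod amp ` fam Q {Var x}"
      by (rule rev_image_eqI) (simp add: amp_Var_single del: amp.simps)
  qed
next
  case ONBe_star
  have "(Star, Map.empty) \<in> fam QI {Star}" by (auto simp: fam_def intro: wt_star)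
  then have "ket IStar \<in> case_prod amp ` fam QI {Star}" by (rule rev_image_eqI) simp
  then show ?case unfolding spanning_on_def using cspan_base by simp
next
  case (ONBe_plus Q1 S Q2 T)
  note ty = typeable_plus[OF ONBe_plus.prems]
  let ?W = "case_prod amp ` fam (QPlus Q1 Q2) (Inl ` S \<union> Inr ` T)"
  have 1: "inj_l (ket k) \<in> cspan ?W" if "k \<in> ix Q1" for k
    by (rule span_constructor[OF ONBe_plus.IH(1)[OF ty(1)] that, of Inl]) (auto simp: inj_l_linear wt_Inl_iff)
  have 2: "inj_r (ket k) \<in> cspan ?W" if "k \<in> ix Q2" for k
    by (rule span_constructor[OF ONBe_plus.IH(2)[OF ty(2)] that, of Inr]) (auto simp: inj_r_linear wt_Inr_iff)
  show ?case unfolding spanning_on_def using 1 2 by (auto simp: ket_image)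
next
  case (ONBe_nat S)
  have ty: "typeable QNat S" by (rule typeable_succ[OF ONBe_nat.prems])
  let ?W = "case_prod amp ` fam QNat ({Zero} \<union> Succ ` S)"
  have 1: "shift (ket k) \<in> cspan ?W" if "k \<in> ix QNat" for k
    by (rule span_constructor[OF ONBe_nat.IH[OF ty] that, of Succ]) (auto simp: shift_linear wt_Succ_iff)
  have 2: "ket (INum 0) \<in> cspan ?W"
  proof (rule cspan_base)
    have "(Zero, Map.empty) \<in> fam QNat ({Zero} \<union> Succ ` S)" by (auto simp: fam_def intro: wt_zero)
    then show "ket (INum 0) \<in> ?W" by (rule rev_image_eqI) simp
  qed
  have "ket (INum n) \<in> cspan ?W" for n
    using 1[of "INum (n - 1)"] 2 by (cases n) (auto simp: ket_image)
  then show ?case unfolding spanning_on_def by auto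
next
  case (ONBe_tensor2 S Q2 Q1)
  let ?W = "case_prod amp ` fam (QTensor Q1 Q2) S"
  have s2: "spanning_on Q2 (proj2 S)" using ONBe_tensor2 typeable_tensor by blast
  have s1: "spanning_on Q1 (slice2 S b)" if "b \<in> proj2 S" for b
    using ONBe_tensor2 that typeable_tensor by blast
  have "tvec (ket i) (ket j) \<in> cspan ?W" if "i \<in> ix Q1" and "j \<in> ix Q2" for i j
    by (rule span_tensor[where f = "\<lambda>w v. tvec v w" and S' = "slice2 S", OF s2 s1 that(2,1)])
      (auto simp: tvec_linear_left tvec_linear_right slice2_def intro: tensor_in_fam[OF ONBe_tensor2.prems])
  then show ?case unfolding spanning_on_def by (auto simp: ket_image)
next
  case (ONBe_tensor1 S Q1 Q2)
  let ?W = "case_prod amp ` fam (QTensor Q1 Q2) S"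
  have s1: "spanning_on Q1 (proj1 S)" using ONBe_tensor1 typeable_tensor by blast
  have s2: "spanning_on Q2 (slice1 S a)" if "a \<in> proj1 S" for a
    using ONBe_tensor1 that typeable_tensor by blast
  have "tvec (ket i) (ket j) \<in> cspan ?W" if "i \<in> ix Q1" and "j \<in> ix Q2" for i j
    by (rule span_tensor[where f = tvec and S' = "slice1 S", OF s1 s2 that])
      (auto simp: tvec_linear_left tvec_linear_right slice1_def intro: tensor_in_fam[OF ONBe_tensor1.prems])
  then show ?case unfolding spanning_on_def by (auto simp: ket_image)
next
  case (ONBe_unitary Q S \<alpha> en)
  let ?s = "\<lambda>e. Sum (map (\<lambda>e'. (\<alpha> e e', e')) (en e))"
  let ?W = "case_prod amp ` fam Q (?s ` S)"
  have en: "distinct (en e)" "set (en e) = S" if "e \<in> S" for e using ONBe_unitary.hyps that by auto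
  have wtS: "wt \<Gamma> e' Q" if "wt \<Gamma> (?s e) Q" "e \<in> S" "e' \<in> S" for \<Gamma> e e'
    using that(1) en[OF that(2)] that(3) by (fastforce elim!: wt_sumE)
  have ex: "expression e \<and> (\<exists>\<Gamma>. wt \<Gamma> (?s e) Q)" if "e \<in> S" for e
    using ONBe_unitary.prems that en[OF that] unfolding typeable_def by fastforce
  have ty: "typeable Q S" unfolding typeable_def using ex wtS by blast
  have base: "amp e' \<rho> \<in> cspan ?W" if e': "e' \<in> S" and G: "wt \<Gamma> e' Q" "\<rho> \<in> cix \<Gamma>" for e' \<rho> \<Gamma>
  proof -
    have fin: "finite S" using en[OF e'] by (metis finite_set)
    \<comment> \<open>All the sums contain \<open>e'\<close>, hence by uniqueness of contexts they
      live in the context of \<open>e'\<close>, and one valuation \<open>\<rho>\<close> suits them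
      all.\<close>
    have wt_s: "wt \<Gamma> (?s e) Q" if e: "e \<in> S" for e
    proof -
      obtain \<Gamma>' where G': "wt \<Gamma>' (?s e) Q" using ex[OF e] by blast
      then have "wt \<Gamma>' e' Q" using wtS e e' by blast
      then have "\<Gamma>' = \<Gamma>" using wt_unique[OF G(1)] ex[OF e'] by blast
      then show ?thesis using G' by simp
    qed
    have s: "amp (?s e) \<rho> k = (\<Sum>f\<in>S. \<alpha> e f * amp f \<rho> k)" if "e \<in> S" for e k
      using en[OF that] by (simp add: comp_def sum_list_distinct_conv_sum_set)
    have "(\<lambda>k. \<Sum>e\<in>S. cnj (\<alpha> e e') * amp (?s e) \<rho> k) \<in> cspan ?W"
    proof (rule cspan_sum[OF fin])
      fix e assume e: "e \<in> S"
      have "(?s e, \<rho>) \<in> fam Q (?s ` S)" using wt_s[OF e] G(2) e unfolding fam_def by blast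
      then show "amp (?s e) \<rho> \<in> cspan ?W" by (intro cspan_base rev_image_eqI[of "(?s e, \<rho>)"]) auto
    qed
    \<comment> \<open>Here the columns of the matrix are used, whereas orthonormality used its
      rows.\<close>
    moreover have "(\<Sum>e\<in>S. cnj (\<alpha> e e') * amp (?s e) \<rho> k) = amp e' \<rho> k" for k
    proof -
      have "(\<Sum>e\<in>S. cnj (\<alpha> e e') * amp (?s e) \<rho> k) = (\<Sum>e\<in>S. \<Sum>f\<in>S. cnj (\<alpha> e e') * \<alpha> e f * amp f \<rho> k)"
        by (intro sum.cong refl, subst s) (auto simp: sum_distrib_left mult.assoc)
      also have "\<dots> = (\<Sum>f\<in>S. (\<Sum>e\<in>S. cnj (\<alpha> e e') * \<alpha> e f) * amp f \<rho> k)"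
        by (subst sum.swap) (simp add: sum_distrib_right)
      also have "\<dots> = (\<Sum>f\<in>S. if e' = f then amp f \<rho> k else 0)"
        using ONBe_unitary.hyps(2) e' unfolding unitary_on_def by (intro sum.cong refl) auto
      also have "\<dots> = amp e' \<rho> k" using fin e' by (simp add: sum.delta')
      finally show ?thesis .
    qed
    ultimately show ?thesis by simp
  qed
  show ?case
    unfolding spanning_on_def
  proof
    fix k assume "k \<in> ix Q"
    then have "ket k \<in> cspan (case_prod amp ` fam Q S)"
      using ONBe_unitary.IH[OF ty] by (auto simp: spanning_on_def)
    then show "ket k \<in> cspan ?W"
      by (rule cspan_linear_image[where T = "\<lambda>v. v"]) (use base in \<open>auto simp: fam_def\<close>)
  qed
qed

lemma ONB_ONBe: "ONB Q S \<Longrightarrow> ONBe Q S"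
  by (induction rule: ONB.induct) (blast intro: ONBe.intros)+

section \<open>Unitarity of the matrices of unitaries\<close>

text \<open>Indexing by positions rather than terms lets the two sides of a list of clauses share
  one index set. Contexts are not mentioned, as \<open>umat\<close> knows no types; the condition on
  the domain makes each basis vector of a context occur exactly once.\<close>

definition family_mat :: "tm list \<Rightarrow> nat \<times> (var \<rightharpoonup> idx) \<Rightarrow> idx \<Rightarrow> complex" where
  "family_mat es = (\<lambda>(c, \<rho>) k. if c < length es \<and> dom \<rho> = fv (es ! c) then amp (es ! c) \<rho> k else 0)"

text \<open>Since the terms are distinct and their contexts unique, pairs of a position and a
  valuation correspond bijectively to \<open>fam Q (set es)\<close>, so orthonormality and spanning
  carry over.\<close>

lemma family_mat_unitary:
  assumes "ONBe Q (set es)" "distinct es" and ty: "\<And>c. c < length es \<Longrightarrow> wt (\<Delta> c) (es ! c) Q"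
  shows "unitary_mat {(c, \<rho>). c < length es \<and> \<rho> \<in> cix (\<Delta> c)} (ix Q) (family_mat es)"
    (is "unitary_mat ?I _ _")
proof (rule isometric_spanning_unitary)
  have ex: "expression (es ! c)" if "c < length es" for c
    using ONBe_expression[OF assms(1)] that by simp
  then have tyS: "typeable Q (set es)" unfolding typeable_def using ty by (metis in_set_conv_nth)
  let ?h = "\<lambda>(c, \<rho>). (es ! c, \<rho>)"
  have fm: "family_mat es p = case_prod amp (?h p)" if "p \<in> ?I" for p
    using that wt_dom[OF ty] by (auto simp: family_mat_def cix_iff fun_eq_iff)
  have h: "?h ` ?I = fam Q (set es)"
  proof
    show "?h ` ?I \<subseteq> fam Q (set es)" using ty by (auto simp: fam_def)
    show "fam Q (set es) \<subseteq> ?h ` ?I"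
    proof
      fix p assume "p \<in> fam Q (set es)"
      then obtain c \<rho> \<Gamma> where p: "p = (es ! c, \<rho>)" "c < length es" "wt \<Gamma> (es ! c) Q" "\<rho> \<in> cix \<Gamma>"
        by (auto simp: fam_def in_set_conv_nth)
      then have "\<Gamma> = \<Delta> c" using wt_unique[OF ty ex] by blast
      then show "p \<in> ?h ` ?I" using p by force
    qed
  qed
  have inj: "p = q \<longleftrightarrow> ?h p = ?h q" if "p \<in> ?I" "q \<in> ?I" for p q
    using that assms(2) nth_eq_iff_index_eq by fastforce
  have iso: "isometric (fam Q (set es)) (ix Q) (case_prod amp)"
    using fam_isometric[OF tyS ONBe_orthonormal[OF assms(1) tyS]] .
  show "isometric ?I (ix Q) (family_mat es)"
  proof (rule isometricI)
    fix p assume p: "p \<in> ?I"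
    then have "?h p \<in> fam Q (set es)" using h by blast
    note * = isometricD(1,2)[OF iso this, folded fm[OF p]]
    show "finite {k. family_mat es p k \<noteq> 0}" by (rule *)
    show "k \<in> ix Q" if "family_mat es p k \<noteq> 0" for k using * that by blast
    fix q assume q: "q \<in> ?I"
    then have "?h q \<in> fam Q (set es)" using h by blast
    then show "ip (family_mat es p) (family_mat es q) = (if p = q then 1 else 0)"
      using isometricD(3)[OF iso \<open>?h p \<in> fam Q (set es)\<close>] inj[OF p q] fm[OF p] fm[OF q] by simp
  qed
  have "family_mat es ` ?I = case_prod amp ` fam Q (set es)"
    unfolding h[symmetric] image_image using fm by (intro image_cong) auto
  then show "ket k \<in> cspan (family_mat es ` ?I)" if "k \<in> ix Q" for k
    using ONBe_spanning[OF assms(1) tyS] that by (simp add: spanning_on_def)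
  show "p \<in> ?I" if "k \<in> ix Q" "family_mat es p k \<noteq> 0" for p k
    using that expression_covers[OF ty ex] wt_dom[OF ty]
    by (cases p) (auto simp: family_mat_def cix_iff split: if_splits)
qed

text \<open>Regroups the sum over clauses and valuations as a change of basis: the adjoint of the
  left-hand basis followed by the right-hand basis.\<close>

lemma umat_Clauses: "umat (Clauses cs) i = mapp (family_mat (map snd cs)) (madj (family_mat (map fst cs)) i)"
  unfolding umat.simps mapp_def
  by (rule ext, rule Sum_any.cong) (auto simp: family_mat_def madj_def case_prod_beta)

text \<open>The two sides of clause \<open>c\<close> are typed in the same context
  \<open>\<Delta> c\<close>, so both bases have the same index set and the two unitary matrices
  compose.\<close>

lemma clauses_unitary:
  assumes "\<And>c. c < length cs \<Longrightarrow> wt (\<Delta> c) (fst (cs ! c)) Q1 \<and> wt (\<Delta> c) (snd (cs ! c)) Q2"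
    and "distinct (map fst cs)" "distinct (map snd cs)"
    and "ONB Q1 (set (map fst cs))" "ONBe Q2 (set (map snd cs))"
  shows "unitary_mat (ix Q1) (ix Q2) (umat (Clauses cs))"
proof -
  let ?I = "{(c, \<rho>). c < length cs \<and> \<rho> \<in> cix (\<Delta> c)}"
  have "unitary_mat ?I (ix Q1) (family_mat (map fst cs))"
    using family_mat_unitary[of Q1 "map fst cs" \<Delta>] assms(1,2) ONB_ONBe[OF assms(4)] by simp
  moreover have "unitary_mat ?I (ix Q2) (family_mat (map snd cs))"
    using family_mat_unitary[of Q2 "map snd cs" \<Delta>] assms(1,3,5) by simp
  ultimately have "unitary_mat (ix Q1) (ix Q2)
      (\<lambda>i. mapp (family_mat (map snd cs)) (madj (family_mat (map fst cs)) i))"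
    using unitary_comp unitary_adj by blast
  then show ?thesis using umat_Clauses[of cs] by presburger
qed

lemma "\<Gamma> \<turnstile> t \<Colon> Q \<Longrightarrow> True"
  and umat_unitary: "\<tturnstile> u \<Colon> U(Q1, Q2) \<Longrightarrow> unitary_mat (ix Q1) (ix Q2) (umat u)"
proof (induction rule: typed_utyped.inducts)
  case (ty_clauses cs \<Delta> Q1 Q2)
  then show ?case using typed_wt by (intro clauses_unitary[of cs \<Delta>]) auto
next
  case (ty_inv u Q1 Q2)
  then show ?case using unitary_adj by simp
next
  case (ty_comp u1 Q1 Q2 u2 Q3)
  then show ?case using unitary_comp[of _ _ "umat u1" _ "umat u2"] by simp
next
  case (ty_utensor u1 Q1 Q2 u2 Q3 Q4)
  show ?case using unitary_tmat[OF ty_utensor.IH] unfolding umat.simps .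
next
  case (ty_uplus u1 Q1 Q2 u2 Q3 Q4)
  show ?case using unitary_pmat[OF ty_uplus.IH] unfolding umat.simps .
next
  case (ty_ctrl u Q)
  show ?case using unitary_cmat[OF ty_ctrl.IH] unfolding umat.simps .
qed simp_all

lemma amp_supp:
  assumes "wt \<Gamma> t Q" "covers \<Gamma> \<rho>"
  shows "finite {k. amp t \<rho> k \<noteq> 0}" "{k. amp t \<rho> k \<noteq> 0} \<subseteq> ix Q"
  using amp_supp_aux[OF assms] umat_unitary by auto

section \<open>Soundness\<close>

primrec bt :: "idx \<Rightarrow> tm" where
  "bt IStar = Star"
| "bt (IInl i) = Inl (bt i)"
| "bt (IInr i) = Inr (bt i)"
| "bt (IPair i j) = Tensor (bt i) (bt j)"
| "bt (INum n) = (Succ ^^ n) Zero"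

lemma basis_value_bt: "basis_value (bt i)"
proof (induction i)
  case (INum n)
  then show ?case by (induction n) auto
qed auto

lemma bt_typed: "i \<in> ix Q \<Longrightarrow> Map.empty \<turnstile> bt i \<Colon> Q"
proof (induction Q arbitrary: i)
  case QI
  then show ?case by (auto intro: ty_star)
next
  case (QPlus Q1 Q2)
  then show ?case by (auto intro!: ty_inl ty_inr)
next
  case (QTensor Q1 Q2)
  then show ?case using ty_tensor[of Map.empty _ Q1 Map.empty _ Q2] by auto
next
  case QNat
  then obtain n where "i = INum n" by auto
  then show ?case by (induction n arbitrary: i) (auto intro: ty_zero ty_succ)
qed

lemma amp_bt [simp]: "amp (bt i) \<rho> = ket i"
proof (induction i)
  case (INum n)
  then show ?case by (induction n) (auto simp: ket_image)
qed (auto simp: ket_image)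

lemma bt_inject: "bt i = bt j \<longleftrightarrow> i = j"
  by (metis amp_bt ket_nonzero_iff)

lemma bt_orth: "i \<in> ix Q \<Longrightarrow> j \<in> ix Q \<Longrightarrow> i \<noteq> j \<Longrightarrow> bt i \<bottom>\<^sub>t bt j"
proof (induction Q arbitrary: i j)
  case (QPlus Q1 Q2)
  then show ?case by (auto intro!: orth_inl orth_inr orth_inl_inr intro: orth_sym[OF orth_inl_inr])
next
  case (QTensor Q1 Q2)
  then obtain a b a' b' where ab: "i = IPair a b" "j = IPair a' b'" "a \<in> ix Q1" "b \<in> ix Q2" "a' \<in> ix Q1" "b' \<in> ix Q2"
    by auto
  then consider "a \<noteq> a'" | "b \<noteq> b'" using QTensor.prems(3) by blast
  then show ?case
  proof cases
    case 1
    then show ?thesis using ab QTensor.IH(1) by (simp add: orth_tensor_left)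
  next
    case 2
    then show ?thesis using ab QTensor.IH(2) by (simp add: orth_tensor_right)
  qed
next
  case QNat
  have "(Succ ^^ m) Zero \<bottom>\<^sub>t (Succ ^^ n) Zero" if "m \<noteq> n" for m n
    using that
  proof (induction m arbitrary: n)
    case 0
    then show ?case by (cases n) (auto intro: orth_zero_succ)
  next
    case (Suc m)
    then show ?case by (cases n) (auto intro: orth_succ orth_sym[OF orth_zero_succ])
  qed
  moreover obtain m n where "i = INum m" "j = INum n" using QNat.prems by auto
  ultimately show ?case using QNat.prems(3) by simp
qed simp

lemma closed_basis_value:
  "wt \<Gamma> b Q \<Longrightarrow> \<Gamma> = Map.empty \<Longrightarrow> basis_value b \<Longrightarrow> \<exists>i\<in>ix Q. b = bt i"
proof (induction rule: wt.induct)
  case (wt_tensor \<Gamma>1 t1 Q1 \<Gamma>2 t2 Q2)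
  then obtain i j where "i \<in> ix Q1" "t1 = bt i" "j \<in> ix Q2" "t2 = bt j" by auto
  then show ?case by (intro bexI[of _ "IPair i j"]) auto
next
  case (wt_inl \<Gamma> t Q1 Q2)
  then obtain i where "i \<in> ix Q1" "t = bt i" by auto
  then show ?case by (intro bexI[of _ "IInl i"]) auto
next
  case (wt_inr \<Gamma> t Q2 Q1)
  then obtain i where "i \<in> ix Q2" "t = bt i" by auto
  then show ?case by (intro bexI[of _ "IInr i"]) auto
next
  case wt_zero
  show ?case by (intro bexI[of _ "INum 0"]) auto
next
  case (wt_succ \<Gamma> t)
  then obtain n where "t = bt (INum n)" by auto
  then show ?case by (intro bexI[of _ "INum (Suc n)"]) auto
next
  case (wt_var x Q)
  then show ?case by (metis fun_upd_same option.distinct(1))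
qed auto

definition env_subst :: "(var \<rightharpoonup> idx) \<Rightarrow> var \<rightharpoonup> tm" where
  "env_subst \<rho> = (\<lambda>x. map_option bt (\<rho> x))"

lemma amp_subst: "fv t \<subseteq> dom \<rho> \<Longrightarrow> amp (subst (env_subst \<rho>) t) \<rho>' = amp t \<rho>"
proof (induction t rule: fv.induct)
  case (2 x)
  then obtain i where "\<rho> x = Some i" by auto
  then show ?case by (auto simp: env_subst_def ket_apply fun_eq_iff)
next
  case (9 ts)
  have *: "amp (subst (env_subst \<rho>) (snd p)) \<rho>' = amp (snd p) \<rho>" if "p \<in> set ts" for p
    by (rule "9.IH"[OF that]) (use that "9.prems" in auto)
  show ?case
    by (rule ext) (auto simp: comp_def case_prod_beta * cong: map_cong)
qed auto

text \<open>Keeps a sum well-formed when its variables are replaced. It holds rule by rule, since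
  orthogonality is never derived from a variable alone and coefficients are untouched.\<close>

lemma orth_subst: "s \<bottom>\<^sub>t t \<Longrightarrow> subst \<sigma> s \<bottom>\<^sub>t subst \<sigma> t"
proof (induction rule: orth.induct)
  case (orth_sum ts t)
  then have "subst \<sigma> t \<bottom>\<^sub>t Sum (map (\<lambda>p. (fst p, subst \<sigma> (snd p))) ts)"
    by (intro orth.orth_sum) simp
  then show ?case by (simp add: case_prod_unfold)
next
  case (orth_sum_zero ts ts' t)
  let ?s = "map (\<lambda>p. (fst p, subst \<sigma> (snd p)))"
  have "subst \<sigma> t \<bottom>\<^sub>t Sum (?s ts @ (0, subst \<sigma> t) # ?s ts')"
    using orth_sum_zero.IH by (intro orth.orth_sum_zero) (simp add: ball_Un)
  then show ?case by (simp add: case_prod_unfold)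
next
  case (orth_sums I t js ks \<alpha> \<beta>)
  have "Sum (map (\<lambda>j. (\<alpha> j, subst \<sigma> (t j))) js) \<bottom>\<^sub>t Sum (map (\<lambda>k. (\<beta> k, subst \<sigma> (t k))) ks)"
    using orth_sums by (intro orth.orth_sums[of I]) auto
  then show ?case by (simp add: comp_def)
qed (auto intro: orth.intros)

inductive_cases typed_tensorE: "\<Gamma> \<turnstile> Tensor s t \<Colon> Q"
inductive_cases typed_inlE: "\<Gamma> \<turnstile> Inl t \<Colon> Q"
inductive_cases typed_inrE: "\<Gamma> \<turnstile> Inr t \<Colon> Q"
inductive_cases typed_succE: "\<Gamma> \<turnstile> Succ t \<Colon> Q"
inductive_cases typed_sumE: "\<Gamma> \<turnstile> Sum ts \<Colon> Q"
inductive_cases typed_appE: "\<Gamma> \<turnstile> App u t \<Colon> Q"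
inductive_cases typed_varE: "\<Gamma> \<turnstile> Var x \<Colon> Q"
inductive_cases utyped_clausesE: "\<tturnstile> Clauses cs \<Colon> U(Q1, Q2)"

lemma subst_closed: "\<Gamma> \<turnstile> t \<Colon> Q \<Longrightarrow> covers \<Gamma> \<rho> \<Longrightarrow> Map.empty \<turnstile> subst (env_subst \<rho>) t \<Colon> Q"
  and "\<tturnstile> u \<Colon> U(Q1, Q2) \<Longrightarrow> True"
proof (induction rule: typed_utyped.inducts)
  case (ty_var x Q)
  then obtain i where "i \<in> ix Q" "\<rho> x = Some i" unfolding covers_single by blast
  then show ?case using bt_typed by (simp add: env_subst_def)
next
  case (ty_tensor \<Gamma>1 t1 Q1 \<Gamma>2 t2 Q2)
  then show ?case
    using typed_utyped.ty_tensor[of Map.empty _ Q1 Map.empty _ Q2] by (simp add: covers_add)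
next
  case (ty_sum ts \<Gamma> Q)
  then show ?case by (auto intro!: typed_utyped.ty_sum orth_subst simp: case_prod_beta)
qed (auto intro: typed_utyped.intros)

lemma closed_tensor:
  assumes "Map.empty \<turnstile> Tensor s t \<Colon> Q"
  obtains Q1 Q2 where "Q = QTensor Q1 Q2" "Map.empty \<turnstile> s \<Colon> Q1" "Map.empty \<turnstile> t \<Colon> Q2"
  using assms
proof (rule typed_tensorE)
  fix \<Gamma>1 Q1 \<Gamma>2 Q2
  assume a: "Map.empty = \<Gamma>1 ++ \<Gamma>2" "Q = QTensor Q1 Q2" "\<Gamma>1 \<turnstile> s \<Colon> Q1" "\<Gamma>2 \<turnstile> t \<Colon> Q2"
  then have "\<Gamma>1 = Map.empty" "\<Gamma>2 = Map.empty" by (metis map_add_None ext)+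
  then show thesis using that a by blast
qed

lemma typed_sum_summand: "\<Gamma> \<turnstile> Sum ts \<Colon> Q \<Longrightarrow> p \<in> set ts \<Longrightarrow> \<Gamma> \<turnstile> snd p \<Colon> Q"
  by (auto elim!: typed_sumE simp: in_set_conv_nth)

lemma closed_supp:
  assumes "Map.empty \<turnstile> t \<Colon> Q"
  shows "finite {k. amp t \<rho> k \<noteq> 0}" "{k. amp t \<rho> k \<noteq> 0} \<subseteq> ix Q"
  using amp_supp[OF typed_wt[OF assms]] by simp_all

section \<open>Inner products and norms of closed terms\<close>

text \<open>The head constructor of a type shows in its indices; the factors of a product can be
  read off because neither factor is empty. Together with \<open>unitary_source_unique\<close> this
  shows that a unitary with given target type has one source type.\<close>

lemma ix_inj: "ix Q = ix Q' \<Longrightarrow> Q = Q'"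
proof (induction Q arbitrary: Q')
  case QI
  then have "IStar \<in> ix Q'" by auto
  then show ?case by (cases Q') auto
next
  case QNat
  then have "INum 0 \<in> ix Q'" by auto
  then show ?case by (cases Q') auto
next
  case (QPlus Q1 Q2)
  obtain i where "i \<in> ix Q1" using ix_nonempty by blast
  then have "IInl i \<in> ix Q'" using QPlus.prems by auto
  then obtain Q1' Q2' where Q': "Q' = QPlus Q1' Q2'" by (cases Q') auto
  have "j \<in> ix Q1 \<longleftrightarrow> IInl j \<in> ix (QPlus Q1 Q2)" "j \<in> ix Q2 \<longleftrightarrow> IInr j \<in> ix (QPlus Q1 Q2)"
    "j \<in> ix Q1' \<longleftrightarrow> IInl j \<in> ix (QPlus Q1' Q2')" "j \<in> ix Q2' \<longleftrightarrow> IInr j \<in> ix (QPlus Q1' Q2')" for j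
    by auto
  then have "ix Q1 = ix Q1'" "ix Q2 = ix Q2'" using QPlus.prems unfolding Q' by blast+
  then show ?case using QPlus.IH Q' by blast
next
  case (QTensor Q1 Q2)
  obtain i j where ij: "i \<in> ix Q1" "j \<in> ix Q2" using ix_nonempty by blast
  then have "IPair i j \<in> ix Q'" using QTensor.prems by auto
  then obtain Q1' Q2' where Q': "Q' = QTensor Q1' Q2'" by (cases Q') auto
  have *: "IPair a b \<in> ix (QTensor Q1 Q2) \<longleftrightarrow> IPair a b \<in> ix (QTensor Q1' Q2')" for a b
    using QTensor.prems Q' by blast
  have "ix Q1 = ix Q1'" "ix Q2 = ix Q2'"
    using ij * unfolding ix.simps IPair_image_iff by blast+
  then show ?case using QTensor.IH Q' by blast
qed

lemma ip_sums:
  assumes "finite I" "finite J" "\<And>i. i \<in> I \<Longrightarrow> finite {k. v i k \<noteq> 0}" "\<And>j. j \<in> J \<Longrightarrow> finite {k. w j k \<noteq> 0}"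
  shows "ip (\<lambda>k. \<Sum>i\<in>I. a i * v i k) (\<lambda>k. \<Sum>j\<in>J. b j * w j k) = (\<Sum>i\<in>I. \<Sum>j\<in>J. cnj (a i) * b j * ip (v i) (w j))"
proof -
  let ?S = "(\<Union>i\<in>I. {k. v i k \<noteq> 0}) \<union> (\<Union>j\<in>J. {k. w j k \<noteq> 0})"
  have S: "finite ?S" using assms by blast
  have "ip (\<lambda>k. \<Sum>i\<in>I. a i * v i k) (\<lambda>k. \<Sum>j\<in>J. b j * w j k) =
      (\<Sum>k\<in>?S. cnj (\<Sum>i\<in>I. a i * v i k) * (\<Sum>j\<in>J. b j * w j k))"
    by (rule ip_eq_sum[OF S]) auto
  also have "\<dots> = (\<Sum>k\<in>?S. \<Sum>i\<in>I. \<Sum>j\<in>J. cnj (a i) * b j * (cnj (v i k) * w j k))"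
    unfolding cnj_sum sum_product by (intro sum.cong refl) simp
  also have "\<dots> = (\<Sum>i\<in>I. \<Sum>j\<in>J. \<Sum>k\<in>?S. cnj (a i) * b j * (cnj (v i k) * w j k))"
    by (subst sum.swap, rule sum.cong, rule refl, rule sum.swap)
  also have "\<dots> = (\<Sum>i\<in>I. \<Sum>j\<in>J. cnj (a i) * b j * ip (v i) (w j))"
  proof (intro sum.cong refl)
    fix i j assume "i \<in> I" "j \<in> J"
    then have "ip (v i) (w j) = (\<Sum>k\<in>?S. cnj (v i k) * w j k)" by (intro ip_eq_sum[OF S]) auto
    then show "(\<Sum>k\<in>?S. cnj (a i) * b j * (cnj (v i k) * w j k)) = cnj (a i) * b j * ip (v i) (w j)"
      by (simp add: sum_distrib_left)
  qed
  finally show ?thesis .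
qed

lemma amp_Sum_nth: "amp (Sum ts) \<rho> = (\<lambda>k. \<Sum>i<length ts. fst (ts ! i) * amp (snd (ts ! i)) \<rho> k)"
  by (rule ext) (simp add: sum_list_sum_nth atLeast0LessThan)

lemma amp_Sum_map: "distinct js \<Longrightarrow> amp (Sum (map (\<lambda>j. (\<alpha> j, t j)) js)) \<rho> = (\<lambda>k. \<Sum>j\<in>set js. \<alpha> j * amp (t j) \<rho> k)"
  by (rule ext) (simp add: comp_def sum_list_distinct_conv_sum_set)

text \<open>The alternative \<open>fst p = 0\<close> serves the rule by which a term is orthogonal
  to a sum containing that very term with coefficient zero.\<close>

lemma ip_Sum_zero:
  assumes "finite {k. v k \<noteq> 0}" "\<And>p. p \<in> set ts \<Longrightarrow> finite {k. amp (snd p) \<rho> k \<noteq> 0}"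
    and "\<And>p. p \<in> set ts \<Longrightarrow> fst p = 0 \<or> ip v (amp (snd p) \<rho>) = 0"
  shows "ip v (amp (Sum ts) \<rho>) = 0"
proof -
  have "ip v (amp (Sum ts) \<rho>) = ip (\<lambda>k. \<Sum>i\<in>{()}. 1 * v k) (amp (Sum ts) \<rho>)" by simp
  also have "\<dots> = (\<Sum>i\<in>{()}. \<Sum>j<length ts. cnj 1 * fst (ts ! j) * ip v (amp (snd (ts ! j)) \<rho>))"
    unfolding amp_Sum_nth by (rule ip_sums) (use assms in auto)
  also have "\<dots> = 0" using assms(3) by (auto intro!: sum.neutral)
  finally show ?thesis .
qed

text \<open>Induction on orthogonality, with the norms of terms smaller than \<open>n\<close> as a
  hypothesis. Norms are needed only for summands shared by two sums; these are strictly smaller than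
  the sums, so the hypothesis can later be supplied by an induction on size.\<close>

lemma orth_ip_zero:
  assumes "s \<bottom>\<^sub>t t" "Map.empty \<turnstile> s \<Colon> Q" "Map.empty \<turnstile> t \<Colon> Q" "size s \<le> n" "size t \<le> n"
    and norm: "\<And>t Q. size t < n \<Longrightarrow> Map.empty \<turnstile> t \<Colon> Q \<Longrightarrow> ip (amp t Map.empty) (amp t Map.empty) = 1"
  shows "ip (amp s Map.empty) (amp t Map.empty) = 0"
  using assms(1-5)
proof (induction arbitrary: Q rule: orth.induct)
  case (orth_sym t1 t2)
  then show ?case using ip_commute_zero by blast
next
  case (orth_zero_succ t)
  then show ?case by (simp add: ip_ket_left)
next
  case (orth_succ t1 t2)
  then have t: "Map.empty \<turnstile> t1 \<Colon> QNat" "Map.empty \<turnstile> t2 \<Colon> QNat" by (blast elim: typed_succE)+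
  then have "ip (amp t1 Map.empty) (amp t2 Map.empty) = 0" using orth_succ by simp
  then show ?case using ip_shift closed_supp(2)[OF t(1)] by simp
next
  case (orth_inl t1 t2)
  then show ?case by (auto elim!: typed_inlE simp: ip_inj_l)
next
  case (orth_inr t1 t2)
  then show ?case by (auto elim!: typed_inrE simp: ip_inj_r)
next
  case (orth_app t1 t2 u)
  obtain Q1 where 1: "\<tturnstile> u \<Colon> U(Q1, Q)" "Map.empty \<turnstile> t1 \<Colon> Q1" using orth_app.prems(1) by (blast elim: typed_appE)
  obtain Q1' where 2: "\<tturnstile> u \<Colon> U(Q1', Q)" "Map.empty \<turnstile> t2 \<Colon> Q1'" using orth_app.prems(2) by (blast elim: typed_appE)
  \<comment> \<open>The two applications are typed separately and might use different source types,
    but the induction hypothesis needs both arguments at one type.\<close>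
  have "Q1 = Q1'" using unitary_source_unique[OF umat_unitary[OF 1(1)] umat_unitary[OF 2(1)]] ix_inj by blast
  then have "ip (amp t1 Map.empty) (amp t2 Map.empty) = 0" using orth_app.IH 1 2 orth_app.prems by simp
  moreover have "ip (amp (App u t1) Map.empty) (amp (App u t2) Map.empty) = ip (amp t1 Map.empty) (amp t2 Map.empty)"
    unfolding amp.simps
    by (rule ip_mapp[of "ix Q1" "ix Q"])
      (use umat_unitary[OF 1(1)] closed_supp[OF 1(2)] closed_supp[OF 2(2)] \<open>Q1 = Q1'\<close> in \<open>simp_all add: unitary_mat_def\<close>)
  ultimately show ?case by simp
next
  case (orth_tensor_right t1 t2 t t')
  from orth_tensor_right.prems(1) obtain Q1 Q2 where 1: "Q = QTensor Q1 Q2" "Map.empty \<turnstile> t \<Colon> Q1" "Map.empty \<turnstile> t1 \<Colon> Q2"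
    by (rule closed_tensor)
  from orth_tensor_right.prems(2) have 2: "Map.empty \<turnstile> t2 \<Colon> Q2"
    by (rule closed_tensor) (use 1 in simp)
  have "ip (amp t1 Map.empty) (amp t2 Map.empty) = 0" using orth_tensor_right.IH[OF 1(3) 2] orth_tensor_right.prems by simp
  then show ?case using ip_tvec closed_supp(1)[OF 1(2)] closed_supp(1)[OF 1(3)] by simp
next
  case (orth_tensor_left t1 t2 t t')
  from orth_tensor_left.prems(1) obtain Q1 Q2 where 1: "Q = QTensor Q1 Q2" "Map.empty \<turnstile> t1 \<Colon> Q1" "Map.empty \<turnstile> t \<Colon> Q2"
    by (rule closed_tensor)
  from orth_tensor_left.prems(2) have 2: "Map.empty \<turnstile> t2 \<Colon> Q1"
    by (rule closed_tensor) (use 1 in simp)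
  have "ip (amp t1 Map.empty) (amp t2 Map.empty) = 0" using orth_tensor_left.IH[OF 1(2) 2] orth_tensor_left.prems by simp
  then show ?case using ip_tvec closed_supp(1)[OF 1(2)] closed_supp(1)[OF 1(3)] by simp
next
  case (orth_sum ts t)
  have ty: "Map.empty \<turnstile> snd p \<Colon> Q" if "p \<in> set ts" for p using orth_sum.prems(2) that by (rule typed_sum_summand)
  show ?case
  proof (rule ip_Sum_zero)
    fix p assume p: "p \<in> set ts"
    show "finite {k. amp (snd p) Map.empty k \<noteq> 0}" using closed_supp(1)[OF ty[OF p]] .
    have "size (snd p) \<le> n" using size_summand[OF p] orth_sum.prems(4) by linarith
    then show "fst p = 0 \<or> ip (amp t Map.empty) (amp (snd p) Map.empty) = 0"
      using orth_sum.IH orth_sum.prems ty[OF p] p by blast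
  qed (rule closed_supp(1)[OF orth_sum.prems(1)])
next
  case (orth_sum_zero ts ts' t)
  let ?ts = "ts @ (0, t) # ts'"
  have ty: "Map.empty \<turnstile> snd p \<Colon> Q" if "p \<in> set ?ts" for p using orth_sum_zero.prems(2) that by (rule typed_sum_summand)
  show ?case
  proof (rule ip_Sum_zero)
    fix p assume p: "p \<in> set ?ts"
    show "finite {k. amp (snd p) Map.empty k \<noteq> 0}" using closed_supp(1)[OF ty[OF p]] .
    have "size (snd p) \<le> n" using size_summand[OF p] orth_sum_zero.prems(4) by linarith
    then show "fst p = 0 \<or> ip (amp t Map.empty) (amp (snd p) Map.empty) = 0"
      using orth_sum_zero.IH orth_sum_zero.prems(1,3) ty[OF p] p by auto
  qed (rule closed_supp(1)[OF orth_sum_zero.prems(1)])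
next
  case (orth_sums I t js ks \<alpha> \<beta>)
  have tj: "Map.empty \<turnstile> t j \<Colon> Q" "size (t j) < n" if j: "j \<in> set js" for j
    using typed_sum_summand[OF orth_sums.prems(1), of "(\<alpha> j, t j)"]
      size_summand[of "(\<alpha> j, t j)" "map (\<lambda>j. (\<alpha> j, t j)) js"] j orth_sums.prems(3) by auto
  have tk: "Map.empty \<turnstile> t k \<Colon> Q" "size (t k) < n" if k: "k \<in> set ks" for k
    using typed_sum_summand[OF orth_sums.prems(2), of "(\<beta> k, t k)"]
      size_summand[of "(\<beta> k, t k)" "map (\<lambda>k. (\<beta> k, t k)) ks"] k orth_sums.prems(4) by auto
  have d: "ip (amp (t j) Map.empty) (amp (t k) Map.empty) = (if j = k then 1 else 0)"
    if "j \<in> set js" "k \<in> set ks" for j k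
  proof (cases "j = k")
    case True
    then show ?thesis using norm[OF tj(2,1)] that by simp
  next
    case False
    then show ?thesis using orth_sums.IH orth_sums.hyps tj[OF that(1)] tk[OF that(2)] that by (simp add: subset_iff)
  qed
  have "ip (amp (Sum (map (\<lambda>j. (\<alpha> j, t j)) js)) Map.empty) (amp (Sum (map (\<lambda>k. (\<beta> k, t k)) ks)) Map.empty) =
      (\<Sum>j\<in>set js. \<Sum>k\<in>set ks. cnj (\<alpha> j) * \<beta> k * ip (amp (t j) Map.empty) (amp (t k) Map.empty))"
    unfolding amp_Sum_map[OF orth_sums.hyps(2)] amp_Sum_map[OF orth_sums.hyps(3)]
    by (rule ip_sums) (use closed_supp(1)[OF tj(1)] closed_supp(1)[OF tk(1)] in auto)
  also have "\<dots> = (\<Sum>j\<in>set js. \<Sum>k\<in>set ks. if j = k then cnj (\<alpha> j) * \<beta> k else 0)"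
    using d by (intro sum.cong refl) simp
  also have "\<dots> = (\<Sum>j\<in>set js. if j \<in> set ks then cnj (\<alpha> j) * \<beta> j else 0)"
    by (intro sum.cong refl) (simp add: sum.delta')
  also have "\<dots> = (\<Sum>j\<in>set js \<inter> set ks. cnj (\<alpha> j) * \<beta> j)"
    by (simp add: sum.inter_restrict)
  finally show ?case using orth_sums.hyps(6) by simp
qed simp

text \<open>The other half of the circle, by induction on size: the induction hypothesis is the norm
  hypothesis of \<open>orth_ip_zero\<close> for the summands of a sum, whose orthogonality then
  leaves the sum of the squared moduli of the coefficients.\<close>

lemma closed_norm: "Map.empty \<turnstile> t \<Colon> Q \<Longrightarrow> ip (amp t Map.empty) (amp t Map.empty) = 1"
proof (induction "size t" arbitrary: t Q rule: less_induct)
  case less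
  note IH = less.hyps
  show ?case
  proof (cases t)
    case (Tensor a b)
    from less.prems[unfolded Tensor] obtain Q1 Q2 where "Map.empty \<turnstile> a \<Colon> Q1" "Map.empty \<turnstile> b \<Colon> Q2"
      by (rule closed_tensor)
    then show ?thesis using IH[of a] IH[of b] closed_supp(1) Tensor by (simp add: ip_tvec)
  next
    case (Inl a)
    then show ?thesis using less.prems IH[of a] by (auto elim!: typed_inlE simp: ip_inj_l)
  next
    case (Inr a)
    then show ?thesis using less.prems IH[of a] by (auto elim!: typed_inrE simp: ip_inj_r)
  next
    case (Succ a)
    then have a: "Map.empty \<turnstile> a \<Colon> QNat" using less.prems by (auto elim: typed_succE)
    then show ?thesis using IH[of a] ip_shift closed_supp(2)[OF a] Succ by simp
  next
    case (Var x)
    then have "Map.empty = [x \<mapsto> Q]" using less.prems by (auto elim: typed_varE)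
    then show ?thesis by (metis fun_upd_same option.distinct(1))
  next
    case (App u a)
    then obtain Q1 where 1: "\<tturnstile> u \<Colon> U(Q1, Q)" "Map.empty \<turnstile> a \<Colon> Q1" using less.prems by (blast elim: typed_appE)
    have "ip (mapp (umat u) (amp a Map.empty)) (mapp (umat u) (amp a Map.empty)) = ip (amp a Map.empty) (amp a Map.empty)"
      by (rule ip_mapp[of "ix Q1" "ix Q"])
        (use umat_unitary[OF 1(1)] closed_supp[OF 1(2)] in \<open>simp_all add: unitary_mat_def\<close>)
    then show ?thesis using IH[of a] 1 App by simp
  next
    case (Sum ts)
    from less.prems[unfolded Sum] have ty: "\<forall>i<length ts. Map.empty \<turnstile> snd (ts ! i) \<Colon> Q"
      and nrm: "(\<Sum>i<length ts. (cmod (fst (ts ! i)))\<^sup>2) = 1"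
      and orth: "\<forall>i<length ts. \<forall>j<length ts. i \<noteq> j \<longrightarrow> snd (ts ! i) \<bottom>\<^sub>t snd (ts ! j)"
      by (auto elim: typed_sumE)
    have sz: "size (snd (ts ! i)) < size t" if "i < length ts" for i
      using size_summand[of "ts ! i" ts] that Sum by simp
    have d: "ip (amp (snd (ts ! i)) Map.empty) (amp (snd (ts ! j)) Map.empty) = (if i = j then 1 else 0)"
      if "i < length ts" "j < length ts" for i j
    proof (cases "i = j")
      case True
      then show ?thesis using IH[OF sz] ty that by auto
    next
      case False
      have "ip (amp (snd (ts ! i)) Map.empty) (amp (snd (ts ! j)) Map.empty) = 0"
        by (rule orth_ip_zero[where Q = Q and n = "size t"])
          (use that False orth ty sz IH in \<open>auto simp: less_imp_le\<close>)
      then show ?thesis using False by simp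
    qed
    have "ip (amp t Map.empty) (amp t Map.empty) =
        (\<Sum>i<length ts. \<Sum>j<length ts. cnj (fst (ts ! i)) * fst (ts ! j) * ip (amp (snd (ts ! i)) Map.empty) (amp (snd (ts ! j)) Map.empty))"
      unfolding Sum amp_Sum_nth by (rule ip_sums) (use closed_supp(1) ty in auto)
    also have "\<dots> = (\<Sum>i<length ts. \<Sum>j<length ts. if i = j then cnj (fst (ts ! i)) * fst (ts ! j) else 0)"
      using d by (intro sum.cong refl) simp
    also have "\<dots> = (\<Sum>i<length ts. cnj (fst (ts ! i)) * fst (ts ! i))"
      by (intro sum.cong refl) (simp add: sum.delta')
    also have "\<dots> = of_real (\<Sum>i<length ts. (cmod (fst (ts ! i)))\<^sup>2)"
      by (simp add: complex_norm_square mult.commute del: of_real_power)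
    finally show ?thesis using nrm by simp
  qed (simp_all add: ip_ket_left ket_apply)
qed


section \<open>Soundness of the equations\<close>

lemma mapp_sum_list:
  assumes "\<And>p. p \<in> set ts \<Longrightarrow> finite {i. amp (snd p) \<rho> i \<noteq> 0}"
  shows "mapp M (amp (Sum ts) \<rho>) k = (\<Sum>p\<leftarrow>ts. fst p * mapp M (amp (snd p) \<rho>) k)"
proof -
  have "finite {i. amp (Sum ts) \<rho> i \<noteq> 0} \<and> mapp M (amp (Sum ts) \<rho>) k = (\<Sum>p\<leftarrow>ts. fst p * mapp M (amp (snd p) \<rho>) k)"
    using assms
  proof (induction ts)
    case Nil
    then show ?case by (simp add: mapp_def)
  next
    case (Cons p ts)
    then have IH: "finite {i. amp (Sum ts) \<rho> i \<noteq> 0}" "finite {i. amp (snd p) \<rho> i \<noteq> 0}"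
      "mapp M (amp (Sum ts) \<rho>) k = (\<Sum>p\<leftarrow>ts. fst p * mapp M (amp (snd p) \<rho>) k)" by auto
    have eq: "amp (Sum (p # ts)) \<rho> = (\<lambda>i. amp (Sum ts) \<rho> i + fst p * amp (snd p) \<rho> i)" by (simp add: add.commute)
    have "{i. amp (Sum (p # ts)) \<rho> i \<noteq> 0} \<subseteq> {i. amp (Sum ts) \<rho> i \<noteq> 0} \<union> {i. amp (snd p) \<rho> i \<noteq> 0}"
      unfolding eq by auto
    then have "finite {i. amp (Sum (p # ts)) \<rho> i \<noteq> 0}" using IH finite_subset by blast
    then show ?case unfolding eq mapp_add_scaled[OF IH(1,2)] IH(3) by (simp add: add.commute)
  qed
  then show ?thesis ..
qed

lemma env_subst_add: "env_subst (\<rho>1 ++ \<rho>2) = env_subst \<rho>1 ++ env_subst \<rho>2"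
  by (rule ext) (auto simp: env_subst_def map_add_def split: option.split)

lemma closed_wt_tensor:
  assumes "wt Map.empty (Tensor s t) Q"
  obtains Q1 Q2 where "Q = QTensor Q1 Q2" "wt Map.empty s Q1" "wt Map.empty t Q2"
  using assms
proof (rule wt_tensorE)
  fix \<Gamma>1 Q1 \<Gamma>2 Q2
  assume a: "Map.empty = \<Gamma>1 ++ \<Gamma>2" "Q = QTensor Q1 Q2" "wt \<Gamma>1 s Q1" "wt \<Gamma>2 t Q2"
  then have "\<Gamma>1 = Map.empty" "\<Gamma>2 = Map.empty" by (metis map_add_None ext)+
  then show thesis using that a by blast
qed

text \<open>Links matching to coordinates: the substitution comes from a basis valuation
  \<open>\<rho>\<close> of the pattern's context, and the pattern sends \<open>\<rho>\<close>
  exactly to the basis vector of the matched value.\<close>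

lemma match_env:
  "match \<sigma> b b' \<Longrightarrow> wt \<Gamma> b Q \<Longrightarrow> wt Map.empty b' Q \<Longrightarrow>
    \<exists>\<rho> i. \<rho> \<in> cix \<Gamma> \<and> \<sigma> = env_subst \<rho> \<and> b' = bt i \<and> i \<in> ix Q \<and> amp b \<rho> = ket i"
proof (induction arbitrary: \<Gamma> Q rule: match.induct)
  case match_star
  then have "Q = QI" "\<Gamma> = Map.empty" by (auto elim: wt_starE)
  then show ?case by (intro exI[of _ Map.empty] exI[of _ IStar]) (auto simp: env_subst_def)
next
  case (match_var b' x)
  then obtain i where i: "i \<in> ix Q" "b' = bt i" using closed_basis_value by blast
  have "\<Gamma> = [x \<mapsto> Q]" using match_var.prems(1) by (auto elim: wt_varE)
  moreover have "env_subst [x \<mapsto> i] = [x \<mapsto> bt i]" by (rule ext) (simp add: env_subst_def)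
  ultimately show ?case
    using i amp_Var_single cix_single by (intro exI[of _ "[x \<mapsto> i]"] exI[of _ i]) (metis (no_types))
next
  case match_zero
  then have "Q = QNat" "\<Gamma> = Map.empty" by (auto elim: wt_zeroE)
  then show ?case by (intro exI[of _ Map.empty] exI[of _ "INum 0"]) (auto simp: env_subst_def)
next
  case (match_inl \<sigma> b b')
  from match_inl.prems(1) obtain Q1 Q2 where Q: "Q = QPlus Q1 Q2" by (auto elim: wt_inlE)
  then obtain \<rho> i where "\<rho> \<in> cix \<Gamma>" "\<sigma> = env_subst \<rho>" "b' = bt i" "i \<in> ix Q1" "amp b \<rho> = ket i"
    using match_inl unfolding Q wt_Inl_iff by blast
  then show ?case using Q by (intro exI[of _ \<rho>] exI[of _ "IInl i"]) (auto simp: ket_image)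
next
  case (match_inr \<sigma> b b')
  from match_inr.prems(1) obtain Q1 Q2 where Q: "Q = QPlus Q1 Q2" by (auto elim: wt_inrE)
  then obtain \<rho> i where "\<rho> \<in> cix \<Gamma>" "\<sigma> = env_subst \<rho>" "b' = bt i" "i \<in> ix Q2" "amp b \<rho> = ket i"
    using match_inr unfolding Q wt_Inr_iff by blast
  then show ?case using Q by (intro exI[of _ \<rho>] exI[of _ "IInr i"]) (auto simp: ket_image)
next
  case (match_succ \<sigma> b b')
  from match_succ.prems(1) have Q: "Q = QNat" by (auto elim: wt_succE)
  then obtain \<rho> i where i: "\<rho> \<in> cix \<Gamma>" "\<sigma> = env_subst \<rho>" "b' = bt i" "i \<in> ix QNat" "amp b \<rho> = ket i"
    using match_succ unfolding Q wt_Succ_iff by blast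
  then obtain n where "i = INum n" by auto
  then show ?case using i Q by (intro exI[of _ \<rho>] exI[of _ "INum (Suc n)"]) (auto simp: ket_image)
next
  case (match_tensor \<sigma>1 b1 b1' \<sigma>2 b2 b2')
  from match_tensor.prems(1) obtain \<Gamma>1 \<Gamma>2 Q1 Q2 where G: "\<Gamma> = \<Gamma>1 ++ \<Gamma>2" "Q = QTensor Q1 Q2"
    "wt \<Gamma>1 b1 Q1" "wt \<Gamma>2 b2 Q2" "dom \<Gamma>1 \<inter> dom \<Gamma>2 = {}" by (rule wt_tensorE) blast
  from match_tensor.prems(2) have b': "wt Map.empty b1' Q1" "wt Map.empty b2' Q2"
    by (rule closed_wt_tensor; use G(2) in simp)+
  obtain \<rho>1 i where 1: "\<rho>1 \<in> cix \<Gamma>1" "\<sigma>1 = env_subst \<rho>1" "b1' = bt i" "i \<in> ix Q1" "amp b1 \<rho>1 = ket i"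
    using match_tensor.IH(1)[OF G(3) b'(1)] by blast
  obtain \<rho>2 j where 2: "\<rho>2 \<in> cix \<Gamma>2" "\<sigma>2 = env_subst \<rho>2" "b2' = bt j" "j \<in> ix Q2" "amp b2 \<rho>2 = ket j"
    using match_tensor.IH(2)[OF G(4) b'(2)] by blast
  have "amp (Tensor b1 b2) (\<rho>1 ++ \<rho>2) = ket (IPair i j)"
    using amp_Tensor_add[OF G(3,4) 1(1) 2(1) G(5)] 1(5) 2(5) ket_image(4) by simp
  then show ?case
    using cix_add[OF G(5) 1(1) 2(1)] 1 2 G(1,2)
    by (intro exI[of _ "\<rho>1 ++ \<rho>2"] exI[of _ "IPair i j"]) (simp add: env_subst_add)
qed

lemma utyped_clauses:
  assumes "\<tturnstile> Clauses cs \<Colon> U(Q1, Q2)"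
  shows "\<exists>\<Delta>. (\<forall>c<length cs. \<Delta> c \<turnstile> fst (cs ! c) \<Colon> Q1 \<and> \<Delta> c \<turnstile> snd (cs ! c) \<Colon> Q2) \<and>
    distinct (map fst cs) \<and> distinct (map snd cs) \<and> ONB Q1 (set (map fst cs)) \<and> ONBe Q2 (set (map snd cs))"
  using assms by (rule utyped_clausesE) (simp only: set_map, blast)

text \<open>The row \<open>(c, \<rho>)\<close> of the left-hand basis is \<open>ket i\<close>; by
  unitarity the adjoint sends \<open>ket i\<close> back to \<open>ket (c, \<rho>)\<close>. So no
  other clause and no other valuation contributes.\<close>

lemma umat_Clauses_row:
  assumes "\<tturnstile> Clauses cs \<Colon> U(Q1, Q2)" "(b, e) \<in> set cs" "wt \<Gamma> b Q1" "\<rho> \<in> cix \<Gamma>" "amp b \<rho> = ket i"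
  shows "umat (Clauses cs) i = amp e \<rho>" "wt \<Gamma> e Q2" "\<Gamma> \<turnstile> e \<Colon> Q2"
proof -
  obtain \<Delta> where ty: "\<And>c. c < length cs \<Longrightarrow> \<Delta> c \<turnstile> fst (cs ! c) \<Colon> Q1 \<and> \<Delta> c \<turnstile> snd (cs ! c) \<Colon> Q2"
    and d: "distinct (map fst cs)" and onb: "ONB Q1 (set (map fst cs))"
    using utyped_clauses[OF assms(1)] by auto
  obtain c where c: "c < length cs" "cs ! c = (b, e)" using assms(2) by (metis in_set_conv_nth)
  have "expression b" using ONBe_expression[OF ONB_ONBe[OF onb]] assms(2) by force
  moreover have be: "\<Delta> c \<turnstile> b \<Colon> Q1" "\<Delta> c \<turnstile> e \<Colon> Q2" using ty[OF c(1)] c(2) by auto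
  ultimately have G: "\<Delta> c = \<Gamma>" using wt_unique[OF assms(3)] typed_wt by blast
  then show e: "wt \<Gamma> e Q2" "\<Gamma> \<turnstile> e \<Colon> Q2" using be typed_wt by auto
  have dom: "dom \<rho> = fv b" "dom \<rho> = fv e"
    using assms(4) wt_dom[OF assms(3)] wt_dom[OF e(1)] by (simp_all add: cix_iff)
  let ?I = "{(c, \<rho>). c < length (map fst cs) \<and> \<rho> \<in> cix (\<Delta> c)}"
  have M: "unitary_mat ?I (ix Q1) (family_mat (map fst cs))"
    by (rule family_mat_unitary) (use ONB_ONBe[OF onb] d ty typed_wt in auto)
  have row: "family_mat (map fst cs) (c, \<rho>) = ket i" "family_mat (map snd cs) (c, \<rho>) = amp e \<rho>"
    using c dom assms(5) by (auto simp: family_mat_def fun_eq_iff)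
  have "mapp (madj (family_mat (map fst cs))) (family_mat (map fst cs) (c, \<rho>)) = ket (c, \<rho>)"
    by (rule unitary_mapp_adj[OF M]) (use c G assms(4) in auto)
  then have "madj (family_mat (map fst cs)) i = ket (c, \<rho>)" unfolding row mapp_ket .
  then show "umat (Clauses cs) i = amp e \<rho>" by (simp only: umat_Clauses mapp_ket row)
qed

lemma wt_Sum_iff: "wt \<Gamma> (Sum ts) Q \<longleftrightarrow> ts \<noteq> [] \<and> (\<forall>p\<in>set ts. wt \<Gamma> (snd p) Q)"
  by (metis wt_sum wt_sumE)

lemma wt_sum_map:
  assumes "wt \<Gamma> (Sum (map (\<lambda>i. (\<alpha> i, t i)) [0..<n])) Q"
  shows "n > 0" "i < n \<Longrightarrow> wt \<Gamma> (t i) Q"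
  using assms by (auto simp: wt_Sum_iff)

lemma sum_list_upt: "(\<Sum>i\<leftarrow>[0..<n]. f i) = (\<Sum>i<n. f i)"
  by (simp add: interv_sum_list_conv_sum_set_nat atLeast0LessThan)

lemma amp_Sum_upt: "amp (Sum (map (\<lambda>i. (\<alpha> i, t i)) [0..<n])) \<rho> k = (\<Sum>i<n. \<alpha> i * amp (t i) \<rho> k)"
  by (simp add: comp_def sum_list_upt)

text \<open>The common shape of the rules that move a sum out of a context; each then only has to
  show that \<open>C\<close> respects typing and is linear in coordinates.\<close>

lemma sum_context_sound:
  assumes w: "wt \<Gamma> (C (Sum ts)) Q"
    and wt_C: "wt \<Gamma> (C (Sum ts)) Q \<Longrightarrow> ts \<noteq> [] \<and> (\<forall>p\<in>set ts. wt \<Gamma> (C (snd p)) Q)"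
    and amp_C: "\<And>\<rho> k. covers \<Gamma> \<rho> \<Longrightarrow> amp (C (Sum ts)) \<rho> k = (\<Sum>p\<leftarrow>ts. fst p * amp (C (snd p)) \<rho> k)"
  shows "wt \<Gamma> (C (Sum ts)) Q \<and> wt \<Gamma> (Sum (map (\<lambda>(\<alpha>, t). (\<alpha>, C t)) ts)) Q \<and>
    (\<forall>\<rho>. covers \<Gamma> \<rho> \<longrightarrow> amp (C (Sum ts)) \<rho> = amp (Sum (map (\<lambda>(\<alpha>, t). (\<alpha>, C t)) ts)) \<rho>)"
  using w wt_C[OF w] amp_C by (auto simp: wt_Sum_iff fun_eq_iff comp_def case_prod_unfold)

text \<open>Valuations are restricted to those covering \<open>\<Gamma>\<close>: there the
  coordinates have finite support inside the type, which linearity of an application and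
  associativity of composition rely on.\<close>

lemma eqn_sound:
  "eqn r \<Gamma> s t Q \<Longrightarrow> wt \<Gamma> s Q \<and> wt \<Gamma> t Q \<and> (\<forall>\<rho>. covers \<Gamma> \<rho> \<longrightarrow> amp s \<rho> = amp t \<rho>)"
proof (induction rule: eqn.induct)
  case (eq_refl \<Gamma> t Q)
  then show ?case using typed_wt by blast
next
  case (eq_permute \<Gamma> ts Q l)
  have m: "mset (permute_list l ts) = mset ts" using eq_permute(2) by simp
  have w: "wt \<Gamma> (Sum ts) Q" using typed_wt eq_permute(1) by blast
  have "set (permute_list l ts) = set ts" using m by (metis set_mset_mset)
  moreover have "ts \<noteq> []" using w by (simp_all add: wt_Sum_iff)
  moreover have "permute_list l ts \<noteq> []" using \<open>ts \<noteq> []\<close> by (metis length_0_conv length_permute_list)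
  ultimately have "wt \<Gamma> (Sum (permute_list l ts)) Q" using w by (simp add: wt_Sum_iff)
  moreover have "amp (Sum ts) \<rho> = amp (Sum (permute_list l ts)) \<rho>" for \<rho>
  proof
    fix k
    have "mset (map (\<lambda>p. fst p * amp (snd p) \<rho> k) (permute_list l ts)) = mset (map (\<lambda>p. fst p * amp (snd p) \<rho> k) ts)"
      by (simp only: mset_map m)
    then show "amp (Sum ts) \<rho> k = amp (Sum (permute_list l ts)) \<rho> k"
      unfolding amp.simps by (simp only: sum_mset_sum_list[symmetric])
  qed
  ultimately show ?case using w by blast
next
  case (eq_zero \<Gamma> ts t Q)
  have w: "wt \<Gamma> (Sum (ts @ [(0, t)])) Q" using typed_wt eq_zero by blast
  \<comment> \<open>If \<open>ts\<close> were empty, the only coefficient would be zero and the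
    squared norm could not be one.\<close>
  have "ts \<noteq> []" using eq_zero by (rule typed_sumE) auto
  then have "wt \<Gamma> (Sum ts) Q" using w by (simp add: wt_Sum_iff)
  then show ?case using w by simp
next
  case (eq_single \<Gamma> t Q)
  have w: "wt \<Gamma> (Sum [(1, t)]) Q" using typed_wt eq_single by blast
  then have "wt \<Gamma> t Q" by (simp add: wt_Sum_iff)
  then show ?case using w by simp
next
  case (eq_distrib \<Gamma> \<alpha> \<beta> t n m Q)
  let ?s = "\<lambda>i. Sum (map (\<lambda>j. (\<beta> i j, t j)) [0..<n])"
  have w: "wt \<Gamma> (Sum (map (\<lambda>i. (\<alpha> i, ?s i)) [0..<m])) Q" using typed_wt eq_distrib by blast
  have m: "m > 0" "\<And>i. i < m \<Longrightarrow> wt \<Gamma> (?s i) Q" using wt_sum_map[OF w] by auto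
  have n: "n > 0" "\<And>j. j < n \<Longrightarrow> wt \<Gamma> (t j) Q" using wt_sum_map[OF m(2)[OF m(1)]] by auto
  have "wt \<Gamma> (Sum (map (\<lambda>j. (\<Sum>i<m. \<alpha> i * \<beta> i j, t j)) [0..<n])) Q"
    using n by (auto simp: wt_Sum_iff)
  moreover have "amp (Sum (map (\<lambda>i. (\<alpha> i, ?s i)) [0..<m])) \<rho> k =
      amp (Sum (map (\<lambda>j. (\<Sum>i<m. \<alpha> i * \<beta> i j, t j)) [0..<n])) \<rho> k" for \<rho> k
    unfolding amp_Sum_upt
    by (simp add: sum_distrib_left sum_distrib_right mult.assoc) (rule sum.swap)
  ultimately show ?case using w by blast
next
  case (eq_flatten \<Gamma> \<alpha> \<beta> t n m Q)
  have "amp (Sum (map (\<lambda>i. (\<alpha> i, Sum (map (\<lambda>j. (\<beta> i j, t i j)) [0..<n]))) [0..<m])) \<rho> k =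
      amp (Sum (map (\<lambda>(i, j). (\<alpha> i * \<beta> i j, t i j)) (List.product [0..<m] [0..<n]))) \<rho> k" for \<rho> k
  proof -
    have "amp (Sum (map (\<lambda>(i, j). (\<alpha> i * \<beta> i j, t i j)) (List.product [0..<m] [0..<n]))) \<rho> k =
        (\<Sum>p\<in>set (List.product [0..<m] [0..<n]). \<alpha> (fst p) * \<beta> (fst p) (snd p) * amp (t (fst p) (snd p)) \<rho> k)"
      by (simp add: comp_def case_prod_beta sum_list_distinct_conv_sum_set distinct_product del: set_product)
    also have "\<dots> = (\<Sum>i<m. \<Sum>j<n. \<alpha> i * \<beta> i j * amp (t i j) \<rho> k)"
      by (simp add: sum.cartesian_product atLeast0LessThan case_prod_beta)
    finally show ?thesis unfolding amp_Sum_upt by (simp add: sum_distrib_left mult.assoc)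
  qed
  then show ?case using typed_wt eq_flatten by blast
next
  case (eq_app_sum \<Gamma> u ts Q)
  from typed_wt[OF eq_app_sum] obtain Q1 where u: "\<tturnstile> u \<Colon> U(Q1, Q)" "wt \<Gamma> (Sum ts) Q1"
    by (auto elim: wt_appE)
  show ?case
  proof (rule sum_context_sound[where C = "App u", OF typed_wt[OF eq_app_sum]])
    show "ts \<noteq> [] \<and> (\<forall>p\<in>set ts. wt \<Gamma> (App u (snd p)) Q)"
      using u(2) wt_app[OF u(1)] by (simp add: wt_Sum_iff)
    show "amp (App u (Sum ts)) \<rho> k = (\<Sum>p\<leftarrow>ts. fst p * amp (App u (snd p)) \<rho> k)" if "covers \<Gamma> \<rho>" for \<rho> k
    proof -
      have "finite {i. amp (snd p) \<rho> i \<noteq> 0}" if "p \<in> set ts" for p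
        using u(2) that amp_supp(1)[OF _ \<open>covers \<Gamma> \<rho>\<close>] unfolding wt_Sum_iff by blast
      then show ?thesis unfolding amp.simps(8) by (rule mapp_sum_list)
    qed
  qed
next
  case (eq_inl_sum \<Gamma> ts Q)
  show ?case
  proof (rule sum_context_sound[where C = Inl, OF typed_wt[OF eq_inl_sum]])
    show "ts \<noteq> [] \<and> (\<forall>p\<in>set ts. wt \<Gamma> (Inl (snd p)) Q)" if "wt \<Gamma> (Inl (Sum ts)) Q"
      using that by (rule wt_inlE) (simp add: wt_Sum_iff wt_Inl_iff)
    show "amp (Inl (Sum ts)) \<rho> k = (\<Sum>p\<leftarrow>ts. fst p * amp (Inl (snd p)) \<rho> k)" for \<rho> k
      by (cases k) simp_all
  qed
next
  case (eq_inr_sum \<Gamma> ts Q)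
  show ?case
  proof (rule sum_context_sound[where C = Inr, OF typed_wt[OF eq_inr_sum]])
    show "ts \<noteq> [] \<and> (\<forall>p\<in>set ts. wt \<Gamma> (Inr (snd p)) Q)" if "wt \<Gamma> (Inr (Sum ts)) Q"
      using that by (rule wt_inrE) (simp add: wt_Sum_iff wt_Inr_iff)
    show "amp (Inr (Sum ts)) \<rho> k = (\<Sum>p\<leftarrow>ts. fst p * amp (Inr (snd p)) \<rho> k)" for \<rho> k
      by (cases k) simp_all
  qed
next
  case (eq_succ_sum \<Gamma> ts Q)
  show ?case
  proof (rule sum_context_sound[where C = Succ, OF typed_wt[OF eq_succ_sum]])
    show "ts \<noteq> [] \<and> (\<forall>p\<in>set ts. wt \<Gamma> (Succ (snd p)) Q)" if "wt \<Gamma> (Succ (Sum ts)) Q"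
      using that by (rule wt_succE) (simp add: wt_Sum_iff wt_Succ_iff)
    show "amp (Succ (Sum ts)) \<rho> k = (\<Sum>p\<leftarrow>ts. fst p * amp (Succ (snd p)) \<rho> k)" for \<rho> k
      by (cases k; cases "\<exists>n. k = INum (Suc n)") (auto simp: shift_def split: nat.split)
  qed
next
  case (eq_tensor_sum_right \<Gamma> s ts Q)
  show ?case
  proof (rule sum_context_sound[where C = "Tensor s", OF typed_wt[OF eq_tensor_sum_right]])
    show "ts \<noteq> [] \<and> (\<forall>p\<in>set ts. wt \<Gamma> (Tensor s (snd p)) Q)" if "wt \<Gamma> (Tensor s (Sum ts)) Q"
      using that by (rule wt_tensorE) (simp add: wt_Sum_iff wt_tensor)
    show "amp (Tensor s (Sum ts)) \<rho> k = (\<Sum>p\<leftarrow>ts. fst p * amp (Tensor s (snd p)) \<rho> k)" for \<rho> k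
      by (cases k) (simp_all add: mult.left_commute sum_list_const_mult[symmetric])
  qed
next
  case (eq_tensor_sum_left \<Gamma> ts s Q)
  show ?case
  proof (rule sum_context_sound[where C = "\<lambda>t. Tensor t s", OF typed_wt[OF eq_tensor_sum_left]])
    show "ts \<noteq> [] \<and> (\<forall>p\<in>set ts. wt \<Gamma> (Tensor (snd p) s) Q)" if "wt \<Gamma> (Tensor (Sum ts) s) Q"
      using that by (rule wt_tensorE) (simp add: wt_Sum_iff wt_tensor)
    show "amp (Tensor (Sum ts) s) \<rho> k = (\<Sum>p\<leftarrow>ts. fst p * amp (Tensor (snd p) s) \<rho> k)" for \<rho> k
      by (cases k) (simp_all add: mult.assoc[symmetric] sum_list_mult_const)
  qed
next
  case (eq_app_cong u Q1 Q2 \<Gamma> t1 t2)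
  then show ?case by (auto intro: wt_app)
next
  case (eq_inl_cong \<Gamma> t1 t2 Q1 Q2)
  then show ?case by (auto intro: wt_inl)
next
  case (eq_inr_cong \<Gamma> t1 t2 Q2 Q1)
  then show ?case by (auto intro: wt_inr)
next
  case (eq_succ_cong \<Gamma> t1 t2)
  then show ?case by (auto intro: wt_succ)
next
  case (eq_tensor_cong_right \<Gamma> t Q1 \<Gamma>' t1 t2 Q2)
  then show ?case using typed_wt by (auto intro: wt_tensor simp: covers_add)
next
  case (eq_tensor_cong_left \<Gamma> t1 t2 Q1 \<Gamma>' t Q2)
  then show ?case using typed_wt by (auto intro: wt_tensor simp: covers_add)
next
  case (eq_sum_cong \<Gamma> \<alpha> t n Q t')
  have w: "wt \<Gamma> (Sum (map (\<lambda>i. (\<alpha> i, t i)) [0..<n])) Q" using typed_wt eq_sum_cong by blast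
  have "wt \<Gamma> (Sum (map (\<lambda>i. (\<alpha> i, t' i)) [0..<n])) Q"
    using eq_sum_cong.IH wt_sum_map(1)[OF w] by (auto simp: wt_Sum_iff)
  moreover have "amp (Sum (map (\<lambda>i. (\<alpha> i, t i)) [0..<n])) \<rho> k = amp (Sum (map (\<lambda>i. (\<alpha> i, t' i)) [0..<n])) \<rho> k"
    if "covers \<Gamma> \<rho>" for \<rho> k
    unfolding amp_Sum_upt using eq_sum_cong.IH that by (intro sum.cong refl) auto
  ultimately show ?case using w by blast
next
  case (eq_clauses cs Q1 Q2 b' b e \<sigma>)
  obtain c where "c < length cs" "cs ! c = (b, e)" using eq_clauses(4) by (metis in_set_conv_nth)
  then obtain \<Gamma> where b: "wt \<Gamma> b Q1" using utyped_clauses[OF eq_clauses(1)] typed_wt by (metis fst_conv)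
  obtain \<rho> i where m: "\<rho> \<in> cix \<Gamma>" "\<sigma> = env_subst \<rho>" "b' = bt i" "i \<in> ix Q1" "amp b \<rho> = ket i"
    using match_env[OF eq_clauses(5) b typed_wt[OF eq_clauses(3)]] by blast
  note row = umat_Clauses_row[OF eq_clauses(1,4) b m(1,5)]
  have cov: "covers \<Gamma> \<rho>" "fv e \<subseteq> dom \<rho>" using m(1) wt_dom[OF row(2)] by (auto simp: cix_iff)
  have "wt Map.empty (subst \<sigma> e) Q2" using subst_closed[OF row(3) cov(1)] typed_wt m(2) by blast
  moreover have "wt Map.empty (App (Clauses cs) b') Q2" using eq_clauses(1,3) typed_wt by (blast intro: wt_app)
  moreover have "amp (App (Clauses cs) b') \<rho>' = amp (subst \<sigma> e) \<rho>'" for \<rho>'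
    using amp_subst[OF cov(2)] row(1) by (simp add: m(2,3) mapp_ket del: umat.simps)
  ultimately show ?case by blast
next
  case (eq_inv u Q1 Q2 b v)
  obtain i where i: "i \<in> ix Q1" "b = bt i" using closed_basis_value[OF typed_wt[OF eq_inv(3)]] eq_inv(2) by blast
  have "amp v \<rho> = umat u i" for \<rho> using eq_inv.IH by (simp add: i(2) mapp_ket)
  \<comment> \<open>The value \<open>v\<close> has the coordinates of row \<open>i\<close> of
    \<open>umat u\<close>, which the adjoint maps back to \<open>ket i\<close>.\<close>
  then have "amp (App (UInv u) v) \<rho> = amp b \<rho>" for \<rho>
    using unitary_mapp_adj[OF umat_unitary[OF eq_inv(1)] i(1)] i(2) by simp
  moreover have "wt Map.empty (App (UInv u) v) Q1" using eq_inv(1,5) typed_wt by (blast intro: wt_app ty_inv)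
  ultimately show ?case using typed_wt[OF eq_inv(3)] by blast
next
  case (eq_comp u1 Q1 Q2 u2 Q3 b \<Gamma>)
  have b: "wt \<Gamma> b Q1" using typed_wt eq_comp by blast
  have "amp (App (UComp u2 u1) b) \<rho> = amp (App u2 (App u1 b)) \<rho>" if "covers \<Gamma> \<rho>" for \<rho>
  proof -
    have "amp b \<rho> i = 0" if "i \<notin> ix Q1" for i using amp_supp(2)[OF b \<open>covers \<Gamma> \<rho>\<close>] that by blast
    then show ?thesis
      using mapp_assoc[OF umat_unitary[OF eq_comp(1)] umat_unitary[OF eq_comp(2)], of "amp b \<rho>"] by simp
  qed
  moreover have "wt \<Gamma> (App (UComp u2 u1) b) Q3" "wt \<Gamma> (App u2 (App u1 b)) Q3"
    using eq_comp(1,2) b by (blast intro: wt_app ty_comp)+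
  ultimately show ?case by blast
next
  case (eq_utensor u1 Q1 Q2 u2 Q3 Q4 b1 b2)
  obtain i where i: "b1 = bt i" using closed_basis_value[OF typed_wt[OF eq_utensor(4)]] eq_utensor(3) by blast
  obtain j where j: "b2 = bt j" using closed_basis_value[OF typed_wt[OF eq_utensor(6)]] eq_utensor(5) by blast
  have "amp (App (UTensor u1 u2) (Tensor b1 b2)) \<rho> = amp (Tensor (App u1 b1) (App u2 b2)) \<rho>" for \<rho>
    by (simp add: i j ket_image mapp_ket tmat_def)
  moreover have "wt Map.empty (Tensor b1 b2) (QTensor Q1 Q3)"
    "wt Map.empty (Tensor (App u1 b1) (App u2 b2)) (QTensor Q2 Q4)"
    using wt_tensor[of Map.empty _ _ Map.empty] eq_utensor typed_wt wt_app by simp_all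
  ultimately show ?case using eq_utensor(1,2) by (blast intro: wt_app ty_utensor)
next
  case (eq_uplus_inl u1 Q1 Q2 u2 Q3 Q4 b)
  obtain i where i: "b = bt i" using closed_basis_value[OF typed_wt[OF eq_uplus_inl(4)]] eq_uplus_inl(3) by blast
  have "amp (App (UPlus u1 u2) (Inl b)) \<rho> = amp (Inl (App u1 b)) \<rho>" for \<rho>
    by (simp add: i ket_image mapp_ket pmat_def)
  then show ?case using eq_uplus_inl typed_wt by (blast intro: wt_app ty_uplus wt_inl)
next
  case (eq_uplus_inr u1 Q1 Q2 u2 Q3 Q4 b)
  obtain i where i: "b = bt i" using closed_basis_value[OF typed_wt[OF eq_uplus_inr(4)]] eq_uplus_inr(3) by blast
  have "amp (App (UPlus u1 u2) (Inr b)) \<rho> = amp (Inr (App u2 b)) \<rho>" for \<rho>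
    by (simp add: i ket_image mapp_ket pmat_def)
  then show ?case using eq_uplus_inr typed_wt by (blast intro: wt_app ty_uplus wt_inr)
next
  case (eq_ctrl_inl u Q b)
  obtain i where i: "b = bt i" using closed_basis_value[OF typed_wt[OF eq_ctrl_inl(3)]] eq_ctrl_inl(2) by blast
  have "amp (App (UCtrl u) (Tensor (Inl Star) b)) \<rho> = amp (Tensor (Inl Star) b) \<rho>" for \<rho>
    by (simp add: i ket_image mapp_ket cmat_def)
  moreover have "wt Map.empty (Inl Star) qbit" unfolding qbit_def by (intro wt_inl wt_star)
  then have "wt Map.empty (Tensor (Inl Star) b) (QTensor qbit Q)"
    using wt_tensor[of Map.empty _ _ Map.empty] typed_wt[OF eq_ctrl_inl(3)] by simp
  ultimately show ?case using eq_ctrl_inl(1) by (blast intro: wt_app ty_ctrl)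
next
  case (eq_ctrl_inr u Q b)
  obtain i where i: "b = bt i" using closed_basis_value[OF typed_wt[OF eq_ctrl_inr(3)]] eq_ctrl_inr(2) by blast
  have "amp (App (UCtrl u) (Tensor (Inr Star) b)) \<rho> = amp (Tensor (Inr Star) (App u b)) \<rho>" for \<rho>
    by (simp add: i ket_image mapp_ket cmat_def)
  moreover have "wt Map.empty (Inr Star) qbit" unfolding qbit_def by (intro wt_inr wt_star)
  then have "wt Map.empty (Tensor (Inr Star) b) (QTensor qbit Q)"
    "wt Map.empty (Tensor (Inr Star) (App u b)) (QTensor qbit Q)"
    using wt_tensor[of Map.empty _ _ Map.empty] typed_wt[OF eq_ctrl_inr(3)] wt_app[OF eq_ctrl_inr(1)] by simp_all
  ultimately show ?case using eq_ctrl_inr(1) by (blast intro: wt_app ty_ctrl)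
qed auto

section \<open>The denotational semantics in coordinates\<close>

lemma inner2_ip: "finite {i. v i \<noteq> 0} \<Longrightarrow> inner2 v w = ip v w"
proof -
  assume fin: "finite {i. v i \<noteq> 0}"
  have "inner2 v w = (\<Sum>\<^sub>\<infinity>i\<in>{i. v i \<noteq> 0}. cnj (v i) * w i)"
    unfolding inner2_def by (rule infsum_cong_neutral) auto
  also have "\<dots> = ip v w"
    using fin by (subst ip_eq_sum[OF fin]) auto
  finally show ?thesis .
qed

lemma mapp_closed: "f \<in> ell2 {a} \<Longrightarrow> mapp M f k = f a * M a k"
  by (subst mapp_eq_sum[of "{a}"]) (auto dest: ell2_zero)

lemma mapp_scaled: "finite {i. f i \<noteq> 0} \<Longrightarrow> mapp M (\<lambda>i. c * f i) k = c * mapp M f k"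
  by (subst (1 2) mapp_eq_sum[of "{i. f i \<noteq> 0}"]) (auto simp: sum_distrib_left mult.assoc)

text \<open>Two different reasons: an expression reveals its valuation in the output, while the
  empty context has a single valuation.\<close>

lemma column_finite:
  assumes "wt \<Gamma> t Q" "expression t \<or> \<Gamma> = Map.empty"
  shows "finite {\<rho>\<in>cix \<Gamma>. amp t \<rho> k \<noteq> 0}"
proof (cases "expression t")
  case True
  then show ?thesis using expression_column_finite[OF assms(1)] by blast
next
  case False
  then have "cix \<Gamma> = {Map.empty}" using assms(2) by simp
  then have "{\<rho>\<in>cix \<Gamma>. amp t \<rho> k \<noteq> 0} \<subseteq> {Map.empty}" by blast
  then show ?thesis using finite_subset by blast
qed

text \<open>Expands the two-stage definition of \<open>op_tensor\<close> into one finite sum over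
  the entries in the columns at \<open>i\<close> and \<open>j\<close>, which is the form in which it
  can be compared with a matrix of pairs.\<close>

lemma op_tensor_mapp:
  assumes S: "S = restrict (mapp M) (ell2 A)" and T: "T = restrict (mapp N) (ell2 B)"
    and h: "\<And>a. (\<lambda>b. h (a, b)) \<in> ell2 B" "\<And>b. (\<lambda>a. h (a, b)) \<in> ell2 A"
    and fin: "finite {a\<in>A. M a i \<noteq> 0}" "finite {b\<in>B. N b j \<noteq> 0}"
  shows "op_tensor S T h (IPair i j) =
    (\<Sum>(a, b)\<in>{a\<in>A. M a i \<noteq> 0} \<times> {b\<in>B. N b j \<noteq> 0}. h (a, b) * (M a i * N b j))"
proof -
  let ?A = "{a\<in>A. M a i \<noteq> 0}" and ?B = "{b\<in>B. N b j \<noteq> 0}"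
  have 1: "T (\<lambda>b. h (a, b)) j = (\<Sum>b\<in>?B. h (a, b) * N b j)" for a
    using h(1)[of a] ell2_zero[OF h(1)[of a]] fin(2) unfolding T by (auto intro!: mapp_eq_sum)
  \<comment> \<open>\<open>S\<close> is undefined outside \<open>ell2 A\<close>. After the inner
    operator a finite combination of slices of \<open>h\<close> remains, which is square summable,
    so \<open>S\<close> is applied inside its domain.\<close>
  have "(\<lambda>a. \<Sum>b\<in>?B. h (a, b) * N b j) \<in> ell2 A"
    by (rule ell2_sum[OF fin(2) h(2)])
  then have "op_tensor S T h (IPair i j) = mapp M (\<lambda>a. \<Sum>b\<in>?B. h (a, b) * N b j) i"
    unfolding op_tensor_def by (simp add: 1 S)
  also have "\<dots> = (\<Sum>a\<in>?A. (\<Sum>b\<in>?B. h (a, b) * N b j) * M a i)"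
  proof (rule mapp_eq_sum[OF fin(1)])
    fix a assume "a \<notin> ?A"
    moreover have "h (a, b) = 0" if "a \<notin> A" for b using ell2_zero[OF h(2) that] .
    ultimately show "(\<Sum>b\<in>?B. h (a, b) * N b j) = 0 \<or> M a i = 0" by auto
  qed
  also have "\<dots> = (\<Sum>a\<in>?A. \<Sum>b\<in>?B. h (a, b) * (M a i * N b j))"
    by (simp add: sum_distrib_right sum_distrib_left mult_ac)
  finally show ?thesis by (simp add: sum.cartesian_product)
qed

lemma op_tensor_not_pair: "\<nexists>i j. k = IPair i j \<Longrightarrow> op_tensor S T h k = 0"
  unfolding op_tensor_def by (cases k) auto

lemma amp_fun:
  "amp (Inl t) = (\<lambda>\<rho>. inj_l (amp t \<rho>))" "amp (Inr t) = (\<lambda>\<rho>. inj_r (amp t \<rho>))" "amp (Succ t) = (\<lambda>\<rho>. shift (amp t \<rho>))"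
  by (rule ext, simp)+

lemma mapp_inj_l: "mapp (\<lambda>i. inj_l (M i)) f = inj_l (mapp M f)"
  by (rule ext, rename_tac k, case_tac k) (simp_all add: mapp_def)

lemma mapp_inj_r: "mapp (\<lambda>i. inj_r (M i)) f = inj_r (mapp M f)"
  by (rule ext, rename_tac k, case_tac k) (simp_all add: mapp_def)

lemma mapp_shift: "mapp (\<lambda>i. shift (M i)) f = shift (mapp M f)"
proof
  fix k
  show "mapp (\<lambda>i. shift (M i)) f k = shift (mapp M f) k"
  proof (cases k)
    case (INum n)
    then show ?thesis by (cases n) (simp_all add: mapp_def)
  qed (simp_all add: mapp_def)
qed

text \<open>The pairing \<open>pr\<close> is a parameter so that one argument covers the union of
  valuations of disjoint contexts as well as \<open>IPair\<close>.\<close>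

lemma op_tensor_pair:
  assumes inj: "inj_on (\<lambda>(a, b). pr a b) (A \<times> B)"
    and f: "f \<in> ell2 ((\<lambda>(a, b). pr a b) ` (A \<times> B))"
    and h: "h = (\<lambda>(a, b). if a \<in> A \<and> b \<in> B then f (pr a b) else 0)"
    and fin: "\<And>i. finite {a\<in>A. M a i \<noteq> 0}" "\<And>j. finite {b\<in>B. N b j \<noteq> 0}"
    and P: "\<And>a b. a \<in> A \<Longrightarrow> b \<in> B \<Longrightarrow> P (pr a b) = tvec (M a) (N b)"
  shows "op_tensor (restrict (mapp M) (ell2 A)) (restrict (mapp N) (ell2 B)) h = mapp P f"
proof
  fix k
  let ?g = "\<lambda>(a, b). pr a b"
  have h1: "(\<lambda>b. h (a, b)) \<in> ell2 B" for a
  proof (cases "a \<in> A")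
    case True
    show ?thesis
    proof (rule ell2_reindex[OF f, of "\<lambda>b. pr a b"])
      show "inj_on (\<lambda>b. pr a b) B" using inj True by (fastforce simp: inj_on_def)
    qed (use True in \<open>simp_all add: h\<close>)
  qed (simp add: h ell2_def)
  have h2: "(\<lambda>a. h (a, b)) \<in> ell2 A" for b
  proof (cases "b \<in> B")
    case True
    show ?thesis
    proof (rule ell2_reindex[OF f, of "\<lambda>a. pr a b"])
      show "inj_on (\<lambda>a. pr a b) A" using inj True by (fastforce simp: inj_on_def)
    qed (use True in \<open>simp_all add: h\<close>)
  qed (simp add: h ell2_def)
  show "op_tensor (restrict (mapp M) (ell2 A)) (restrict (mapp N) (ell2 B)) h k = mapp P f k"
  proof (cases "\<exists>i j. k = IPair i j")
    case False
    then have "tvec v w k = 0" for v w by (cases k) auto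
    then have "f p * P p k = 0" for p
      using ell2_zero[OF f, of p] P by (cases "p \<in> ?g ` (A \<times> B)") auto
    then have "mapp P f k = 0" unfolding mapp_def by (rule Sum_any_zero)
    then show ?thesis by (simp add: op_tensor_not_pair[OF False])
  next
    case True
    then obtain i j where k: "k = IPair i j" by blast
    let ?A = "{a\<in>A. M a i \<noteq> 0}" and ?B = "{b\<in>B. N b j \<noteq> 0}"
    have "mapp P f k = (\<Sum>p\<in>?g ` (?A \<times> ?B). f p * P p k)"
    proof (rule mapp_eq_sum)
      fix p assume p: "p \<notin> ?g ` (?A \<times> ?B)"
      show "f p = 0 \<or> P p k = 0"
      proof (cases "p \<in> ?g ` (A \<times> B)")
        case True
        then obtain a b where ab: "p = pr a b" "a \<in> A" "b \<in> B" by auto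
        then have "M a i = 0 \<or> N b j = 0" using p by blast
        then show ?thesis using ab P by (auto simp: k)
      qed (use ell2_zero[OF f] in blast)
    qed (use fin in simp)
    also have "\<dots> = (\<Sum>(a, b)\<in>?A \<times> ?B. f (pr a b) * P (pr a b) k)"
    proof (subst sum.reindex)
      show "inj_on ?g (?A \<times> ?B)" by (rule inj_on_subset[OF inj]) blast
    qed (simp add: case_prod_unfold)
    also have "\<dots> = (\<Sum>(a, b)\<in>?A \<times> ?B. h (a, b) * (M a i * N b j))"
      by (intro sum.cong refl) (auto simp: h P k)
    also have "\<dots> = op_tensor (restrict (mapp M) (ell2 A)) (restrict (mapp N) (ell2 B)) h k"
      unfolding k by (rule op_tensor_mapp[symmetric, OF refl refl h1 h2 fin])
    finally show ?thesis by simp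
  qed
qed

lemma den_tensor_mapp:
  assumes w: "wt \<Gamma>1 s Q1" "wt \<Gamma>2 t Q2" and d: "dom \<Gamma>1 \<inter> dom \<Gamma>2 = {}"
    and e: "expression s \<or> \<Gamma>1 = Map.empty" "expression t \<or> \<Gamma>2 = Map.empty"
    and f: "f \<in> chilb (\<Gamma>1 ++ \<Gamma>2)"
  shows "op_tensor (restrict (mapp (amp s)) (chilb \<Gamma>1)) (restrict (mapp (amp t)) (chilb \<Gamma>2)) (split_ctx \<Gamma>1 \<Gamma>2 f) =
    mapp (amp (Tensor s t)) f"
  unfolding chilb_def
proof (rule op_tensor_pair[where pr = "(++)"])
  show "inj_on (\<lambda>(a, b). a ++ b) (cix \<Gamma>1 \<times> cix \<Gamma>2)"
  proof (rule inj_on_inverseI[where g = "\<lambda>\<rho>. (\<rho> |` dom \<Gamma>1, \<rho> |` dom \<Gamma>2)"])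
    fix p assume "p \<in> cix \<Gamma>1 \<times> cix \<Gamma>2"
    then obtain a b where p: "p = (a, b)" "dom a = dom \<Gamma>1" "dom b = dom \<Gamma>2" by (auto simp: cix_iff)
    then show "((case p of (a, b) \<Rightarrow> a ++ b) |` dom \<Gamma>1, (case p of (a, b) \<Rightarrow> a ++ b) |` dom \<Gamma>2) = p"
      using map_add_restrict_left[of a b] map_add_restrict_right[of a b] d p by simp
  qed
  have "cix (\<Gamma>1 ++ \<Gamma>2) = (\<lambda>(a, b). a ++ b) ` (cix \<Gamma>1 \<times> cix \<Gamma>2)"
  proof
    show "cix (\<Gamma>1 ++ \<Gamma>2) \<subseteq> (\<lambda>(a, b). a ++ b) ` (cix \<Gamma>1 \<times> cix \<Gamma>2)"
    proof
      fix \<rho> assume "\<rho> \<in> cix (\<Gamma>1 ++ \<Gamma>2)"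
      note cr = cix_restrict[OF d this]
      show "\<rho> \<in> (\<lambda>(a, b). a ++ b) ` (cix \<Gamma>1 \<times> cix \<Gamma>2)"
        by (rule image_eqI[of _ _ "(\<rho> |` dom \<Gamma>1, \<rho> |` dom \<Gamma>2)"]) (use cr in simp_all)
    qed
    show "(\<lambda>(a, b). a ++ b) ` (cix \<Gamma>1 \<times> cix \<Gamma>2) \<subseteq> cix (\<Gamma>1 ++ \<Gamma>2)" using cix_add[OF d] by auto
  qed
  then show "f \<in> ell2 ((\<lambda>(a, b). a ++ b) ` (cix \<Gamma>1 \<times> cix \<Gamma>2))" using f unfolding chilb_def by simp
  show "finite {a\<in>cix \<Gamma>1. amp s a i \<noteq> 0}" "finite {b\<in>cix \<Gamma>2. amp t b i \<noteq> 0}" for i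
    using column_finite w e by blast+
  show "amp (Tensor s t) (a ++ b) = tvec (amp s a) (amp t b)" if "a \<in> cix \<Gamma>1" "b \<in> cix \<Gamma>2" for a b
    by (rule amp_Tensor_add[OF w that d])
qed (rule split_ctx_def)

lemma uden_tensor_mapp:
  assumes M: "unitary_mat (ix Q1) (ix Q2) M" and N: "unitary_mat (ix Q3) (ix Q4) N"
    and f: "f \<in> hilb (QTensor Q1 Q3)"
  shows "op_tensor (restrict (mapp M) (hilb Q1)) (restrict (mapp N) (hilb Q3)) (uncurry_idx f) = mapp (tmat M N) f"
  unfolding hilb_def
proof (rule op_tensor_pair[where pr = IPair])
  have f': "f \<in> ell2 (ix (QTensor Q1 Q3))" using f by (simp add: hilb_def)
  then show "f \<in> ell2 ((\<lambda>(a, b). IPair a b) ` (ix Q1 \<times> ix Q3))" by simp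
  show "uncurry_idx f = (\<lambda>(a, b). if a \<in> ix Q1 \<and> b \<in> ix Q3 then f (IPair a b) else 0)"
    by (auto simp: uncurry_idx_def fun_eq_iff ell2_zero[OF f'])
  have fin: "finite {a\<in>A. M a i \<noteq> 0}" if "unitary_mat A B M" for A B i and M :: "idx \<Rightarrow> idx \<Rightarrow> complex"
  proof (cases "i \<in> B")
    case True
    then show ?thesis using unitaryD(2)[OF that] by simp
  next
    case False
    then have "{a\<in>A. M a i \<noteq> 0} = {}" using unitaryD(3)[OF that] by blast
    then show ?thesis by (metis finite.emptyI)
  qed
  show "finite {a\<in>ix Q1. M a i \<noteq> 0}" "finite {b\<in>ix Q3. N b i \<noteq> 0}" for i by (rule fin[OF M] fin[OF N])+
qed (auto simp: inj_on_def tmat_def)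

lemma uden_plus_mapp:
  assumes f: "f \<in> hilb (QPlus Q1 Q3)"
  shows "op_plus (restrict (mapp M) (hilb Q1)) (restrict (mapp N) (hilb Q3)) f = mapp (pmat M N) f"
proof
  fix k
  have f': "f \<in> ell2 (ix (QPlus Q1 Q3))" using f by (simp add: hilb_def)
  have "(\<lambda>i. f (IInl i)) \<in> hilb Q1" "(\<lambda>i. f (IInr i)) \<in> hilb Q3"
    unfolding hilb_def
    by (rule ell2_reindex[OF f', of IInl]; auto simp: inj_on_def intro: ell2_zero[OF f'])
      (rule ell2_reindex[OF f', of IInr]; auto simp: inj_on_def intro: ell2_zero[OF f'])
  then have "op_plus (restrict (mapp M) (hilb Q1)) (restrict (mapp N) (hilb Q3)) f k =
      inj_l (mapp M (\<lambda>i. f (IInl i))) k + inj_r (mapp N (\<lambda>i. f (IInr i))) k"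
    by (simp add: op_plus_def)
  also have "\<dots> = mapp (pmat M N) f k"
  proof (cases k)
    case (IInl c)
    have "mapp (pmat M N) f k = Sum_any (\<lambda>i. f (IInl i) * pmat M N (IInl i) k)"
      unfolding mapp_def
    proof (rule Sum_any_reindex)
      fix p assume "p \<notin> range IInl"
      then show "f p * pmat M N p k = 0" by (cases p) (auto simp: IInl pmat_def)
    qed (auto simp: inj_on_def)
    then show ?thesis by (simp add: IInl pmat_def mapp_def)
  next
    case (IInr c)
    have "mapp (pmat M N) f k = Sum_any (\<lambda>i. f (IInr i) * pmat M N (IInr i) k)"
      unfolding mapp_def
    proof (rule Sum_any_reindex)
      fix p assume "p \<notin> range IInr"
      then show "f p * pmat M N p k = 0" by (cases p) (auto simp: IInr pmat_def)
    qed (auto simp: inj_on_def)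
    then show ?thesis by (simp add: IInr pmat_def mapp_def)
  next
    case IStar
    have "pmat M N p k = 0" for p by (cases p) (simp_all add: IStar pmat_def)
    then show ?thesis by (simp add: mapp_def IStar)
  next
    case (IPair i j)
    have "pmat M N p k = 0" for p by (cases p) (simp_all add: IPair pmat_def)
    then show ?thesis by (simp add: mapp_def IPair)
  next
    case (INum n)
    have "pmat M N p k = 0" for p by (cases p) (simp_all add: INum pmat_def)
    then show ?thesis by (simp add: mapp_def INum)
  qed
  finally show "op_plus (restrict (mapp M) (hilb Q1)) (restrict (mapp N) (hilb Q3)) f k = mapp (pmat M N) f k" .
qed

lemma uden_ctrl_mapp:
  assumes f: "f \<in> hilb (QTensor qbit Q)"
  shows "op_tensor (projector (IInl IStar)) (\<lambda>g. g) (uncurry_idx f) k +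
    op_tensor (projector (IInr IStar)) (restrict (mapp M) (hilb Q)) (uncurry_idx f) k = mapp (cmat M) f k"
proof -
  have f': "f \<in> ell2 (ix (QTensor qbit Q))" using f by (simp add: hilb_def)
  have f0: "f p = 0" if "p \<notin> ix (QTensor qbit Q)" for p using ell2_zero[OF f' that] .
  \<comment> \<open>The projector leaves only this slice when the control is one; it has to lie in
    the domain of the restricted operator.\<close>
  have h: "(\<lambda>b. f (IPair (IInr IStar) b)) \<in> hilb Q"
    unfolding hilb_def
    by (rule ell2_reindex[OF f', of "\<lambda>b. IPair (IInr IStar) b"]) (auto simp: inj_on_def qbit_def intro!: f0)
  show ?thesis
  proof (cases "\<exists>i j. k = IPair i j")
    case False
    then have "tvec v w k = 0" for v w by (cases k) auto
    then have "cmat M p k = 0" for p by (cases p) (simp_all add: cmat_def)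
    then show ?thesis by (simp add: mapp_def op_tensor_not_pair[OF False])
  next
    case True
    then obtain i j where k: "k = IPair i j" by blast
    consider "i = IInl IStar" | "i = IInr IStar" | "i \<noteq> IInl IStar" "i \<noteq> IInr IStar" by blast
    then show ?thesis
    proof cases
      case 1
      have "mapp (cmat M) f k = (\<Sum>p\<in>{k}. f p * cmat M p k)"
      proof (rule mapp_eq_sum)
        fix p assume "p \<notin> {k}"
        then show "f p = 0 \<or> cmat M p k = 0" by (cases p) (auto simp: k 1 cmat_def)
      qed simp
      then show ?thesis by (simp add: k 1 cmat_def op_tensor_def projector_def uncurry_idx_def ket_apply)
    next
      case 2
      have "mapp (cmat M) f k = Sum_any (\<lambda>b. f (IPair (IInr IStar) b) * cmat M (IPair (IInr IStar) b) k)"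
        unfolding mapp_def
      proof (rule Sum_any_reindex)
        fix p assume p: "p \<notin> range (IPair (IInr IStar))"
        show "f p * cmat M p k = 0"
        proof (cases p)
          case (IPair a b)
          then have "a \<noteq> IInr IStar" using p by blast
          then show ?thesis using IPair by (auto simp: k 2 cmat_def)
        qed (auto simp: cmat_def)
      qed (auto simp: inj_on_def)
      then show ?thesis using h
        by (simp add: k 2 cmat_def op_tensor_def projector_def uncurry_idx_def ket_apply mapp_def)
    next
      case 3
      have "cmat M p k = 0" for p using 3 by (cases p) (auto simp: k cmat_def)
      then show ?thesis using 3 by (simp add: k op_tensor_def projector_def mapp_def)
    qed
  qed
qed


text \<open>The adjoints of the separate left-hand sides are the slices of a single vector, the
  image of \<open>f\<close> under the adjoint of the whole left-hand basis. The sum over clauses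
  then becomes one matrix application, and \<open>mapp_assoc\<close> composes it with that
  adjoint.\<close>

lemma uden_clauses_mapp:
  assumes ty: "\<tturnstile> Clauses cs \<Colon> U(Q1, Q2)"
    and w: "\<And>c. c < length cs \<Longrightarrow> wt (\<Delta> c) (fst (cs ! c)) Q1 \<and> wt (\<Delta> c) (snd (cs ! c)) Q2"
    and B: "\<And>c. c < length cs \<Longrightarrow> B c = restrict (mapp (amp (fst (cs ! c)))) (chilb (\<Delta> c))"
    and E: "\<And>c. c < length cs \<Longrightarrow> E c = restrict (mapp (amp (snd (cs ! c)))) (chilb (\<Delta> c))"
    and f: "f \<in> hilb Q1"
  shows "(\<Sum>c<length cs. E c (adj (cix (\<Delta> c)) (ix Q1) (B c) f) k) = mapp (umat (Clauses cs)) f k"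
proof -
  have onb: "distinct (map fst cs)" "distinct (map snd cs)"
    "ONBe Q1 (set (map fst cs))" "ONBe Q2 (set (map snd cs))"
    using utyped_clauses[OF ty] ONB_ONBe by auto
  have ex: "expression (fst (cs ! c))" "expression (snd (cs ! c))" if "c < length cs" for c
    using ONBe_expression[OF onb(3)] ONBe_expression[OF onb(4)] that by auto
  let ?I = "{(c, \<rho>). c < length cs \<and> \<rho> \<in> cix (\<Delta> c)}"
  let ?MB = "family_mat (map fst cs)" and ?ME = "family_mat (map snd cs)"
  have MB: "unitary_mat ?I (ix Q1) ?MB"
    using family_mat_unitary[OF onb(3,1), of \<Delta>] w by simp
  have ME: "unitary_mat ?I (ix Q2) ?ME"
    using family_mat_unitary[OF onb(4,2), of \<Delta>] w by simp
  have dom: "dom \<rho> = fv (fst (cs ! c))" "dom \<rho> = fv (snd (cs ! c))" if "c < length cs" "\<rho> \<in> cix (\<Delta> c)" for c \<rho>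
    using w[OF that(1)] wt_dom that(2) by (metis cix_iff)+
  have row: "?MB (c, \<rho>) = amp (fst (cs ! c)) \<rho>" "?ME (c, \<rho>) = amp (snd (cs ! c)) \<rho>"
    if "c < length cs" "\<rho> \<in> cix (\<Delta> c)" for c \<rho>
    using dom[OF that] that(1) by (simp_all add: family_mat_def fun_eq_iff)
  have f': "f \<in> ell2 (ix Q1)" using f by (simp add: hilb_def)
  \<comment> \<open>The coordinates of \<open>f\<close> in the left-hand basis, indexed by clause
    and valuation; square summability of \<open>g\<close> passes to its slices, to which the
    operators \<open>E c\<close> are applied.\<close>
  define g where "g = mapp (madj ?MB) f"
  have g: "g \<in> ell2 ?I" unfolding g_def by (rule mapp_ell2[OF unitary_adj[OF MB] f'])
  have adj: "adj (cix (\<Delta> c)) (ix Q1) (B c) f = (\<lambda>\<rho>. g (c, \<rho>))" if c: "c < length cs" for c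
  proof
    fix \<rho>
    show "adj (cix (\<Delta> c)) (ix Q1) (B c) f \<rho> = g (c, \<rho>)"
    proof (cases "\<rho> \<in> cix (\<Delta> c)")
      case True
      then have "B c (ket \<rho>) = amp (fst (cs ! c)) \<rho>"
        using B[OF c] ket_ell2[OF True] by (simp add: chilb_def mapp_ket)
      moreover have "finite {i. amp (fst (cs ! c)) \<rho> i \<noteq> 0}"
        using amp_supp(1) w[OF c] True unfolding cix_iff by blast
      ultimately have "adj (cix (\<Delta> c)) (ix Q1) (B c) f \<rho> = ip (amp (fst (cs ! c)) \<rho>) f"
        using True f' inner2_ip by (simp add: adj_def)
      also have "\<dots> = g (c, \<rho>)"
        unfolding g_def mapp_def ip_def madj_def row(1)[OF c True] by (simp add: mult.commute)
      finally show ?thesis .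
    next
      case False
      then show ?thesis using f' ell2_zero[OF g, of "(c, \<rho>)"] by (simp add: adj_def)
    qed
  qed
  let ?C = "\<lambda>c. {\<rho>\<in>cix (\<Delta> c). amp (snd (cs ! c)) \<rho> k \<noteq> 0}"
  have fin: "finite (?C c)" if "c < length cs" for c
    by (rule column_finite) (use w ex that in auto)
  have "(\<Sum>c<length cs. E c (adj (cix (\<Delta> c)) (ix Q1) (B c) f) k) =
      (\<Sum>c<length cs. \<Sum>\<rho>\<in>?C c. g (c, \<rho>) * amp (snd (cs ! c)) \<rho> k)"
  proof (rule sum.cong[OF refl])
    fix c assume "c \<in> {..<length cs}"
    then have c: "c < length cs" by simp
    have gc: "(\<lambda>\<rho>. g (c, \<rho>)) \<in> ell2 (cix (\<Delta> c))"
      by (rule ell2_reindex[OF g, of "\<lambda>\<rho>. (c, \<rho>)"]) (auto simp: inj_on_def intro: ell2_zero[OF g])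
    then have "E c (adj (cix (\<Delta> c)) (ix Q1) (B c) f) k = mapp (amp (snd (cs ! c))) (\<lambda>\<rho>. g (c, \<rho>)) k"
      using E[OF c] by (simp add: adj[OF c] chilb_def)
    also have "\<dots> = (\<Sum>\<rho>\<in>?C c. g (c, \<rho>) * amp (snd (cs ! c)) \<rho> k)"
      by (rule mapp_eq_sum[OF fin[OF c]]) (use ell2_zero[OF gc] in blast)
    finally show "E c (adj (cix (\<Delta> c)) (ix Q1) (B c) f) k = (\<Sum>\<rho>\<in>?C c. g (c, \<rho>) * amp (snd (cs ! c)) \<rho> k)" .
  qed
  also have "\<dots> = (\<Sum>(c, \<rho>)\<in>(SIGMA c:{..<length cs}. ?C c). g (c, \<rho>) * amp (snd (cs ! c)) \<rho> k)"
    by (rule sum.Sigma) (use fin in auto)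
  also have "\<dots> = (\<Sum>p\<in>(SIGMA c:{..<length cs}. ?C c). g p * ?ME p k)"
    by (intro sum.cong refl) (auto simp: row(2))
  also have "\<dots> = mapp ?ME g k"
  proof (rule mapp_eq_sum[symmetric])
    fix p assume p: "p \<notin> (SIGMA c:{..<length cs}. ?C c)"
    show "g p = 0 \<or> ?ME p k = 0"
    proof (cases "p \<in> ?I")
      case True
      then show ?thesis using p row(2) by (cases p) auto
    qed (use ell2_zero[OF g] in blast)
  qed (use fin in auto)
  also have "\<dots> = mapp (\<lambda>i. mapp ?ME (madj ?MB i)) f k"
    unfolding g_def using mapp_assoc[OF unitary_adj[OF MB] ME] ell2_zero[OF f'] by metis
  also have "\<dots> = mapp (umat (Clauses cs)) f k" using umat_Clauses[of cs] by presburger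
  finally show ?thesis .
qed

text \<open>For open terms the operator is identified only when they are expressions: these are the
  open terms that occur in clauses, and the final claim concerns closed terms. The description does
  not refer to the derivation, so it also shows that all derivations of such a judgement have the
  same interpretation.\<close>

lemma den_mapp:
  "den \<Gamma> t Q F \<Longrightarrow> wt \<Gamma> t Q \<and> (expression t \<or> \<Gamma> = Map.empty \<longrightarrow> F = restrict (mapp (amp t)) (chilb \<Gamma>))"
  and uden_mapp:
  "uden u Q1 Q2 T \<Longrightarrow> \<tturnstile> u \<Colon> U(Q1, Q2) \<and> T = restrict (mapp (umat u)) (hilb Q1)"
proof (induction rule: den_uden.inducts)
  case den_star
  show ?case by (auto simp: chilb_def mapp_closed fun_eq_iff intro!: restrict_ext wt_star)
next
  case (den_var x Q)
  have "f [x \<mapsto> k] = mapp (amp (Var x)) f k" if f: "f \<in> chilb [x \<mapsto> Q]" for f k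
  proof -
    have "mapp (amp (Var x)) f k = (\<Sum>\<rho>\<in>{[x \<mapsto> k]}. f \<rho> * amp (Var x) \<rho> k)"
    proof (rule mapp_eq_sum)
      fix \<rho> assume r: "\<rho> \<notin> {[x \<mapsto> k]}"
      show "f \<rho> = 0 \<or> amp (Var x) \<rho> k = 0"
      proof (cases "\<rho> \<in> cix [x \<mapsto> Q]")
        case True
        then obtain i where "\<rho> = [x \<mapsto> i]" unfolding cix_single by blast
        then show ?thesis using r amp_Var_single[of x i] by (auto simp del: amp.simps)
      next
        case False
        then have "f \<rho> = 0" by (rule ell2_zero[OF f[unfolded chilb_def]])
        then show ?thesis ..
      qed
    qed simp
    also have "\<dots> = f [x \<mapsto> k]" using amp_Var_single[of x k] by (simp add: ket_apply del: amp.simps)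
    finally show ?thesis by simp
  qed
  then have "(\<lambda>f\<in>chilb [x \<mapsto> Q]. \<lambda>i. f [x \<mapsto> i]) = restrict (mapp (amp (Var x))) (chilb [x \<mapsto> Q])"
    by (intro restrict_ext ext)
  then show ?case using wt_var by blast
next
  case (den_tensor \<Gamma>1 t1 Q1 F1 \<Gamma>2 t2 Q2 F2)
  then have w: "wt \<Gamma>1 t1 Q1" "wt \<Gamma>2 t2 Q2" by auto
  show ?case
  proof (intro conjI impI)
    show "wt (\<Gamma>1 ++ \<Gamma>2) (Tensor t1 t2) (QTensor Q1 Q2)" using w den_tensor.hyps(3) by (rule wt_tensor)
    assume "expression (Tensor t1 t2) \<or> \<Gamma>1 ++ \<Gamma>2 = Map.empty"
    then have e: "expression t1 \<or> \<Gamma>1 = Map.empty" "expression t2 \<or> \<Gamma>2 = Map.empty" by auto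
    have F: "F1 = restrict (mapp (amp t1)) (chilb \<Gamma>1)" "F2 = restrict (mapp (amp t2)) (chilb \<Gamma>2)"
      using den_tensor.IH e by blast+
    show "(\<lambda>f\<in>chilb (\<Gamma>1 ++ \<Gamma>2). op_tensor F1 F2 (split_ctx \<Gamma>1 \<Gamma>2 f)) =
        restrict (mapp (amp (Tensor t1 t2))) (chilb (\<Gamma>1 ++ \<Gamma>2))"
      unfolding F by (rule restrict_ext, rule den_tensor_mapp[OF w den_tensor.hyps(3) e])
  qed
next
  case (den_inl \<Gamma> t Q1 F Q2)
  have F: "expression (Inl t) \<or> \<Gamma> = Map.empty \<Longrightarrow> F = restrict (mapp (amp t)) (chilb \<Gamma>)"
    using den_inl.IH unfolding expression.simps by blast
  show ?case
  proof (intro conjI impI)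
    assume "expression (Inl t) \<or> \<Gamma> = Map.empty"
    then show "compose (chilb \<Gamma>) inj_l F = restrict (mapp (amp (Inl t))) (chilb \<Gamma>)"
      unfolding compose_def by (intro restrict_ext) (simp add: F mapp_inj_l amp_fun)
  qed (use den_inl.IH wt_inl in blast)
next
  case (den_inr \<Gamma> t Q2 F Q1)
  have F: "expression (Inr t) \<or> \<Gamma> = Map.empty \<Longrightarrow> F = restrict (mapp (amp t)) (chilb \<Gamma>)"
    using den_inr.IH unfolding expression.simps by blast
  show ?case
  proof (intro conjI impI)
    assume "expression (Inr t) \<or> \<Gamma> = Map.empty"
    then show "compose (chilb \<Gamma>) inj_r F = restrict (mapp (amp (Inr t))) (chilb \<Gamma>)"
      unfolding compose_def by (intro restrict_ext) (simp add: F mapp_inj_r amp_fun)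
  qed (use den_inr.IH wt_inr in blast)
next
  case den_zero
  show ?case by (auto simp: chilb_def mapp_closed fun_eq_iff intro!: restrict_ext wt_zero)
next
  case (den_succ \<Gamma> t F)
  have F: "expression (Succ t) \<or> \<Gamma> = Map.empty \<Longrightarrow> F = restrict (mapp (amp t)) (chilb \<Gamma>)"
    using den_succ.IH unfolding expression.simps by blast
  show ?case
  proof (intro conjI impI)
    assume "expression (Succ t) \<or> \<Gamma> = Map.empty"
    then show "compose (chilb \<Gamma>) shift F = restrict (mapp (amp (Succ t))) (chilb \<Gamma>)"
      unfolding compose_def by (intro restrict_ext) (simp add: F mapp_shift amp_fun)
  qed (use den_succ.IH wt_succ in blast)
next
  case (den_sum \<Gamma> ts Q F)
  have w: "wt \<Gamma> (snd (ts ! i)) Q" if "i < length ts" for i using den_sum.IH that by blast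
  show ?case
  proof (intro conjI impI)
    show "wt \<Gamma> (Sum ts) Q" using typed_wt[OF den_sum.hyps(1)] .
    assume a: "expression (Sum ts) \<or> \<Gamma> = Map.empty"
    then have e: "expression (snd (ts ! i)) \<or> \<Gamma> = Map.empty" if "i < length ts" for i using that by auto
    then have F: "F i = restrict (mapp (amp (snd (ts ! i)))) (chilb \<Gamma>)" if "i < length ts" for i
      using den_sum.IH that by blast
    show "(\<lambda>f\<in>chilb \<Gamma>. \<lambda>k. \<Sum>i<length ts. fst (ts ! i) * F i f k) = restrict (mapp (amp (Sum ts))) (chilb \<Gamma>)"
    proof (intro restrict_ext ext)
      fix f k assume f: "f \<in> chilb \<Gamma>"
      let ?C = "\<Union>i<length ts. {\<rho>\<in>cix \<Gamma>. amp (snd (ts ! i)) \<rho> k \<noteq> 0}"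
      have C: "finite ?C" using column_finite[OF w e] by blast
      have f0: "f \<rho> = 0" if "\<rho> \<notin> cix \<Gamma>" for \<rho>
        by (rule ell2_zero[OF f[unfolded chilb_def] that])
      have "mapp (amp (snd (ts ! i))) f k = (\<Sum>\<rho>\<in>?C. f \<rho> * amp (snd (ts ! i)) \<rho> k)" if "i < length ts" for i
        by (rule mapp_eq_sum[OF C]) (use f0 that in blast)
      then have "(\<Sum>i<length ts. fst (ts ! i) * F i f k) =
          (\<Sum>i<length ts. \<Sum>\<rho>\<in>?C. f \<rho> * (fst (ts ! i) * amp (snd (ts ! i)) \<rho> k))"
        using F f by (intro sum.cong refl) (simp add: sum_distrib_left mult.left_commute)
      also have "\<dots> = (\<Sum>\<rho>\<in>?C. f \<rho> * amp (Sum ts) \<rho> k)"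
        unfolding amp_Sum_nth by (subst sum.swap) (simp only: sum_distrib_left)
      also have "\<dots> = mapp (amp (Sum ts)) f k"
      proof (rule mapp_eq_sum[symmetric, OF C])
        fix \<rho> assume "\<rho> \<notin> ?C"
        moreover have "amp (Sum ts) \<rho> k = 0" if "\<And>i. i < length ts \<Longrightarrow> amp (snd (ts ! i)) \<rho> k = 0"
          using that unfolding amp_Sum_nth by simp
        ultimately show "f \<rho> = 0 \<or> amp (Sum ts) \<rho> k = 0" using f0 by blast
      qed
      finally show "(\<Sum>i<length ts. fst (ts ! i) * F i f k) = mapp (amp (Sum ts)) f k" .
    qed
  qed
next
  case (den_app u Q1 Q2 T \<Gamma> t F)
  then have u: "\<tturnstile> u \<Colon> U(Q1, Q2)" "T = restrict (mapp (umat u)) (hilb Q1)" and w: "wt \<Gamma> t Q1" by auto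
  show ?case
  proof (intro conjI impI)
    show "wt \<Gamma> (App u t) Q2" using u(1) w by (rule wt_app)
    assume "expression (App u t) \<or> \<Gamma> = Map.empty"
    then have G: "\<Gamma> = Map.empty" by simp
    then have F: "F = restrict (mapp (amp t)) (chilb \<Gamma>)" using den_app.IH by blast
    show "compose (chilb \<Gamma>) T F = restrict (mapp (amp (App u t))) (chilb \<Gamma>)"
      unfolding compose_def
    proof (intro restrict_ext ext)
      fix f k assume f: "f \<in> chilb \<Gamma>"
      then have f': "f \<in> ell2 {Map.empty}" by (simp add: chilb_def G)
      \<comment> \<open>In the empty context \<open>F f\<close> is a scalar multiple of one finitely
        supported vector, hence lies in the domain of \<open>T\<close>, and the scalar can be moved
        through the matrix.\<close>
      have supp: "finite {i. amp t Map.empty i \<noteq> 0}" "{i. amp t Map.empty i \<noteq> 0} \<subseteq> ix Q1"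
        using amp_supp[of \<Gamma> t Q1 Map.empty] w unfolding G by simp_all
      have eq: "F f = (\<lambda>i. f Map.empty * amp t Map.empty i)"
        using f unfolding F by (simp add: fun_eq_iff mapp_closed[OF f'])
      have "F f \<in> hilb Q1"
        unfolding eq hilb_def by (rule finite_support_ell2) (use supp in \<open>auto elim: rev_finite_subset\<close>)
      then have "T (F f) k = mapp (umat u) (F f) k" by (simp add: u(2))
      also have "\<dots> = f Map.empty * mapp (umat u) (amp t Map.empty) k"
        unfolding eq by (rule mapp_scaled[OF supp(1)])
      also have "\<dots> = mapp (amp (App u t)) f k" by (simp add: mapp_closed[OF f'])
      finally show "T (F f) k = mapp (amp (App u t)) f k" .
    qed
  qed
next
  case (uden_clauses cs Q1 Q2 \<Delta> B E)
  have onb: "ONBe Q1 (set (map fst cs))" "ONBe Q2 (set (map snd cs))"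
    using utyped_clauses[OF uden_clauses.hyps(1)] ONB_ONBe by auto
  have ex: "expression (fst (cs ! c))" "expression (snd (cs ! c))" if "c < length cs" for c
    using ONBe_expression[OF onb(1)] ONBe_expression[OF onb(2)] that by auto
  have "(\<Sum>c<length cs. E c (adj (cix (\<Delta> c)) (ix Q1) (B c) f) k) = mapp (umat (Clauses cs)) f k"
    if "f \<in> hilb Q1" for f k
    by (rule uden_clauses_mapp[OF uden_clauses.hyps(1) _ _ _ that]) (use uden_clauses.IH ex in blast)+
  then have "(\<lambda>f\<in>hilb Q1. \<lambda>k. \<Sum>c<length cs. E c (adj (cix (\<Delta> c)) (ix Q1) (B c) f) k) =
      restrict (mapp (umat (Clauses cs))) (hilb Q1)"
    by (intro restrict_ext ext)
  then show ?case using uden_clauses.hyps(1) by blast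
next
  case (uden_inv u Q1 Q2 T)
  then have u: "\<tturnstile> u \<Colon> U(Q1, Q2)" "T = restrict (mapp (umat u)) (hilb Q1)" by auto
  note M = umat_unitary[OF u(1)]
  have "adj (ix Q1) (ix Q2) T = restrict (mapp (umat (UInv u))) (hilb Q2)"
    unfolding adj_def hilb_def
  proof (intro restrict_ext ext)
    fix y a assume y: "y \<in> ell2 (ix Q2)"
    show "(if a \<in> ix Q1 then inner2 (T (ket a)) y else 0) = mapp (umat (UInv u)) y a"
    proof (cases "a \<in> ix Q1")
      case True
      then have "T (ket a) = umat u a" using ket_ell2[OF True] by (simp add: u(2) hilb_def mapp_ket)
      then show ?thesis
        using True inner2_ip[OF unitaryD(1)[OF M True]]
        by (simp add: mapp_def ip_def madj_def mult.commute)
    next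
      case False
      have z: "y k * madj (umat u) k a = 0" for k
        using ell2_zero[OF y] unitaryD(4)[OF M] False by (auto simp: madj_def)
      have "mapp (umat (UInv u)) y a = 0" unfolding mapp_def umat.simps using z by (rule Sum_any_zero)
      then show ?thesis using False by simp
    qed
  qed
  then show ?case using u(1) ty_inv by blast
next
  case (uden_comp u1 Q1 Q2 T1 u2 Q3 T2)
  then have u: "\<tturnstile> u1 \<Colon> U(Q1, Q2)" "\<tturnstile> u2 \<Colon> U(Q2, Q3)"
    and T: "T1 = restrict (mapp (umat u1)) (hilb Q1)" "T2 = restrict (mapp (umat u2)) (hilb Q2)" by auto
  have "T2 (T1 f) = mapp (umat (UComp u2 u1)) f" if f: "f \<in> hilb Q1" for f
  proof -
    have f': "f \<in> ell2 (ix Q1)" using f by (simp add: hilb_def)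
    have "mapp (umat u1) f \<in> hilb Q2"
      unfolding hilb_def by (rule mapp_ell2[OF umat_unitary[OF u(1)] f'])
    then have "T2 (T1 f) = mapp (umat u2) (mapp (umat u1) f)" using f by (simp add: T)
    also have "\<dots> = mapp (umat (UComp u2 u1)) f"
      using mapp_assoc[OF umat_unitary[OF u(1)] umat_unitary[OF u(2)]] ell2_zero[OF f'] by simp
    finally show ?thesis .
  qed
  then have "compose (hilb Q1) T2 T1 = restrict (mapp (umat (UComp u2 u1))) (hilb Q1)"
    unfolding compose_def by (intro restrict_ext)
  then show ?case using u ty_comp by blast
next
  case (uden_utensor u1 Q1 Q2 T1 u2 Q3 Q4 T2)
  then have u: "\<tturnstile> u1 \<Colon> U(Q1, Q2)" "\<tturnstile> u2 \<Colon> U(Q3, Q4)"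
    and T: "T1 = restrict (mapp (umat u1)) (hilb Q1)" "T2 = restrict (mapp (umat u2)) (hilb Q3)" by auto
  have "(\<lambda>f\<in>hilb (QTensor Q1 Q3). op_tensor T1 T2 (uncurry_idx f)) =
      restrict (mapp (umat (UTensor u1 u2))) (hilb (QTensor Q1 Q3))"
    unfolding T umat.simps by (rule restrict_ext, rule uden_tensor_mapp[OF umat_unitary[OF u(1)] umat_unitary[OF u(2)]])
  then show ?case using u ty_utensor by blast
next
  case (uden_uplus u1 Q1 Q2 T1 u2 Q3 Q4 T2)
  then have u: "\<tturnstile> u1 \<Colon> U(Q1, Q2)" "\<tturnstile> u2 \<Colon> U(Q3, Q4)"
    and T: "T1 = restrict (mapp (umat u1)) (hilb Q1)" "T2 = restrict (mapp (umat u2)) (hilb Q3)" by auto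
  have "(\<lambda>f\<in>hilb (QPlus Q1 Q3). op_plus T1 T2 f) =
      restrict (mapp (umat (UPlus u1 u2))) (hilb (QPlus Q1 Q3))"
    unfolding T umat.simps by (rule restrict_ext, rule uden_plus_mapp)
  then show ?case using u ty_uplus by blast
next
  case (uden_ctrl u Q T)
  then have u: "\<tturnstile> u \<Colon> U(Q, Q)" and T: "T = restrict (mapp (umat u)) (hilb Q)" by auto
  have "(\<lambda>f\<in>hilb (QTensor qbit Q). \<lambda>k. op_tensor (projector (IInl IStar)) (\<lambda>g. g) (uncurry_idx f) k +
      op_tensor (projector (IInr IStar)) T (uncurry_idx f) k) =
      restrict (mapp (umat (UCtrl u))) (hilb (QTensor qbit Q))"
    unfolding T umat.simps by (rule restrict_ext, rule ext, rule uden_ctrl_mapp)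
  then show ?case using u ty_ctrl by blast
qed

text \<open>A denotation exists for every typed term and \<open>den_mapp\<close> makes it unique, so
  the definite description in \<open>sem\<close> is meaningful.\<close>

lemma sem_closed:
  assumes "Map.empty \<turnstile> t \<Colon> Q"
  shows "\<lbrakk>Map.empty \<turnstile> t \<Colon> Q\<rbrakk> = restrict (mapp (amp t)) (chilb Map.empty)"
proof -
  obtain F where F: "den Map.empty t Q F" using typed_imp_den(1)[OF assms] by blast
  have eq: "G = restrict (mapp (amp t)) (chilb Map.empty)" if "den Map.empty t Q G" for G
    using den_mapp[OF that] by blast
  show ?thesis unfolding sem_def by (rule the_equality) (use F eq in metis, use eq in blast)
qed

lemma sem_eq_iff:
  assumes "Map.empty \<turnstile> s \<Colon> Q" "Map.empty \<turnstile> t \<Colon> Q"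
  shows "\<lbrakk>Map.empty \<turnstile> s \<Colon> Q\<rbrakk> = \<lbrakk>Map.empty \<turnstile> t \<Colon> Q\<rbrakk> \<longleftrightarrow> amp s Map.empty = amp t Map.empty"
proof
  \<comment> \<open>The space of the empty context is one-dimensional, so an operator on it is
    determined by its value at the ket of the empty valuation.\<close>
  have k: "ket Map.empty \<in> chilb Map.empty" unfolding chilb_def by (rule ket_ell2) simp
  assume "\<lbrakk>Map.empty \<turnstile> s \<Colon> Q\<rbrakk> = \<lbrakk>Map.empty \<turnstile> t \<Colon> Q\<rbrakk>"
  then have "restrict (mapp (amp s)) (chilb Map.empty) (ket Map.empty) = restrict (mapp (amp t)) (chilb Map.empty) (ket Map.empty)"
    unfolding sem_closed[OF assms(1)] sem_closed[OF assms(2)] by simp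
  then show "amp s Map.empty = amp t Map.empty" using k by (simp add: mapp_ket)
next
  assume eq: "amp s Map.empty = amp t Map.empty"
  show "\<lbrakk>Map.empty \<turnstile> s \<Colon> Q\<rbrakk> = \<lbrakk>Map.empty \<turnstile> t \<Colon> Q\<rbrakk>"
    unfolding sem_closed[OF assms(1)] sem_closed[OF assms(2)]
  proof (intro restrict_ext ext)
    fix f k assume "f \<in> chilb Map.empty"
    then have f: "f \<in> ell2 {Map.empty}" by (simp add: chilb_def)
    show "mapp (amp s) f k = mapp (amp t) f k" by (simp add: mapp_closed[OF f] eq)
  qed
qed

section \<open>Normal forms\<close>

definition bsum :: "(idx \<Rightarrow> complex) \<Rightarrow> idx list \<Rightarrow> tm" where
  "bsum v L = Sum (map (\<lambda>i. (v i, bt i)) L)"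

definition unit_vec :: "(idx \<Rightarrow> complex) \<Rightarrow> qty \<Rightarrow> bool" where
  "unit_vec v Q \<longleftrightarrow> finite {i. v i \<noteq> 0} \<and> {i. v i \<noteq> 0} \<subseteq> ix Q \<and> ip v v = 1"

lemma unit_vec_closed: "Map.empty \<turnstile> t \<Colon> Q \<Longrightarrow> unit_vec (amp t Map.empty) Q"
  using closed_supp closed_norm by (simp add: unit_vec_def)

lemma unit_vec_row: "unitary_mat (ix Q1) (ix Q2) M \<Longrightarrow> i \<in> ix Q1 \<Longrightarrow> unit_vec (M i) Q2"
  using unitaryD(1,3)[of "ix Q1" "ix Q2" M i] isometricD(3)[of "ix Q1" "ix Q2" M i i]
  by (auto simp: unit_vec_def unitary_mat_def)

lemma amp_bsum: "distinct L \<Longrightarrow> {i. v i \<noteq> 0} \<subseteq> set L \<Longrightarrow> amp (bsum v L) \<rho> = v"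
  unfolding bsum_def amp_Sum_map by (rule ext) (auto simp: ket_apply if_distrib cong: if_cong)

lemma typed_sum_distinct:
  assumes "distinct L" "finite {i. v i \<noteq> 0}" "{i. v i \<noteq> 0} \<subseteq> set L" "ip v v = 1"
    and "\<And>i. i \<in> set L \<Longrightarrow> \<Gamma> \<turnstile> C i \<Colon> Q"
    and "\<And>i j. i \<in> set L \<Longrightarrow> j \<in> set L \<Longrightarrow> i \<noteq> j \<Longrightarrow> C i \<bottom>\<^sub>t C j"
  shows "\<Gamma> \<turnstile> Sum (map (\<lambda>i. (v i, C i)) L) \<Colon> Q"
proof (rule ty_sum)
  let ?ts = "map (\<lambda>i. (v i, C i)) L"
  show "\<forall>i<length ?ts. \<Gamma> \<turnstile> snd (?ts ! i) \<Colon> Q" using assms(5) by simp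
  show "\<forall>i<length ?ts. \<forall>j<length ?ts. i \<noteq> j \<longrightarrow> snd (?ts ! i) \<bottom>\<^sub>t snd (?ts ! j)"
    using assms(1,6) by (simp add: nth_eq_iff_index_eq)
  have "(\<Sum>i<length ?ts. (cmod (fst (?ts ! i)))\<^sup>2) = (\<Sum>i\<leftarrow>L. (cmod (v i))\<^sup>2)"
    by (simp add: sum_list_sum_nth atLeast0LessThan)
  also have "\<dots> = (\<Sum>i\<in>set L. (cmod (v i))\<^sup>2)" using assms(1) by (simp add: sum_list_distinct_conv_sum_set)
  finally have eq: "(\<Sum>i<length ?ts. (cmod (fst (?ts ! i)))\<^sup>2) = (\<Sum>i\<in>set L. (cmod (v i))\<^sup>2)" .
  have "ip v v = of_real (\<Sum>i\<in>set L. (cmod (v i))\<^sup>2)" by (rule ip_self) (use assms(3) in auto)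
  then have "(\<Sum>i\<in>set L. (cmod (v i))\<^sup>2) = 1" using assms(4) by (metis of_real_eq_1_iff)
  then show "(\<Sum>i<length ?ts. (cmod (fst (?ts ! i)))\<^sup>2) = 1" using eq by simp
qed

lemma bsum_typed:
  assumes "distinct L" "set L \<subseteq> ix Q" "{i. v i \<noteq> 0} \<subseteq> set L" "ip v v = 1"
  shows "Map.empty \<turnstile> bsum v L \<Colon> Q"
  unfolding bsum_def
proof (rule typed_sum_distinct[OF assms(1) _ assms(3,4)])
  show "finite {i. v i \<noteq> 0}" using assms(3) finite_subset by blast
qed (use assms(2) bt_typed bt_orth in blast)+

text \<open>The converse of \<open>orth_ip_zero\<close> for sums of basis values: orthogonal vectors
  give syntactically orthogonal terms. On basis values syntactic orthogonality is inequality, so the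
  rule for sums over a common family applies.\<close>

lemma bsum_orth:
  assumes "distinct L" "distinct L'" "set L \<subseteq> ix Q" "set L' \<subseteq> ix Q"
    and "{i. v i \<noteq> 0} \<subseteq> set L" "{i. w i \<noteq> 0} \<subseteq> set L'" "ip v w = 0"
  shows "bsum v L \<bottom>\<^sub>t bsum w L'"
proof -
  let ?A = "set L \<union> set L'"
  have "finite ?A" by simp
  \<comment> \<open>The rule \<open>orth_sums\<close> indexes its family by natural numbers;
    \<open>f\<close> numbers the indices occurring in either list, and its inverse \<open>?g\<close>
    names the summands.\<close>
  then obtain n f where f: "f ` ?A = {i. i < (n::nat)}" "inj_on f ?A"
    using finite_imp_inj_to_nat_seg by metis
  let ?g = "inv_into ?A f"
  have g: "?g (f i) = i" if "i \<in> ?A" for i using f(2) that by simp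
  have gA: "?g m \<in> ?A" if "m < n" for m using f(1) that by (metis inv_into_into mem_Collect_eq)
  have ginj: "?g m \<noteq> ?g m'" if "m < n" "m' < n" "m \<noteq> m'" for m m'
    using f(1) that by (metis f_inv_into_f mem_Collect_eq)
  have "Sum (map (\<lambda>j. (v (?g j), bt (?g j))) (map f L)) \<bottom>\<^sub>t Sum (map (\<lambda>k. (w (?g k), bt (?g k))) (map f L'))"
  proof (rule orth_sums[where I = "{i. i < n}"])
    show "\<forall>i\<in>{i. i < n}. \<forall>j\<in>{i. i < n}. i \<noteq> j \<longrightarrow> bt (?g i) \<bottom>\<^sub>t bt (?g j)"
    proof (intro ballI impI)
      fix i j assume a: "i \<in> {i. i < n}" "j \<in> {i. i < n}" "i \<noteq> j"
      have "?A \<subseteq> ix Q" using assms(3,4) by simp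
      then have "?g i \<in> ix Q" "?g j \<in> ix Q" using gA[of i] gA[of j] a(1,2) by auto
      moreover have "?g i \<noteq> ?g j" using ginj[of i j] a by simp
      ultimately show "bt (?g i) \<bottom>\<^sub>t bt (?g j)" by (rule bt_orth)
    qed
    show "distinct (map f L)" "distinct (map f L')"
      using assms(1,2) f(2) by (auto simp: distinct_map inj_on_Un)
    show "set (map f L) \<subseteq> {i. i < n}" "set (map f L') \<subseteq> {i. i < n}" using f(1) by auto
    have "set (map f L) \<inter> set (map f L') = f ` (set L \<inter> set L')"
      using f(2) inj_on_image_Int[of f ?A "set L" "set L'"] by simp
    moreover have inj: "inj_on f (set L \<inter> set L')" by (rule inj_on_subset[OF f(2)]) blast
    ultimately have "(\<Sum>i\<in>set (map f L) \<inter> set (map f L'). cnj (v (?g i)) * w (?g i)) =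
        (\<Sum>i\<in>set L \<inter> set L'. cnj (v (?g (f i))) * w (?g (f i)))"
      by (simp add: sum.reindex)
    also have "\<dots> = (\<Sum>i\<in>set L \<inter> set L'. cnj (v i) * w i)"
      by (intro sum.cong refl) (use g in auto)
    also have "\<dots> = ip v w" by (rule ip_eq_sum[symmetric]) (use assms(5,6) in auto)
    finally show "(\<Sum>i\<in>set (map f L) \<inter> set (map f L'). cnj (v (?g i)) * w (?g i)) = 0" using assms(7) by simp
  qed simp
  moreover have "map (\<lambda>j. (v (?g j), bt (?g j))) (map f L) = map (\<lambda>i. (v i, bt i)) L"
    "map (\<lambda>j. (w (?g j), bt (?g j))) (map f L') = map (\<lambda>i. (w i, bt i)) L'"
    using g by simp_all
  ultimately show ?thesis unfolding bsum_def by (simp only:)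
qed

text \<open>The counterpart of \<open>match_env\<close>: a nonzero coordinate already implies a
  match, so a clause for a given input can be found through the matrix instead of by analysing
  patterns.\<close>

lemma match_basis:
  "wt \<Gamma> b Q \<Longrightarrow> basis_value b \<Longrightarrow> \<rho> \<in> cix \<Gamma> \<Longrightarrow> amp b \<rho> i \<noteq> 0 \<Longrightarrow> match (env_subst \<rho>) b (bt i)"
proof (induction arbitrary: \<rho> i rule: wt.induct)
  case wt_star
  then show ?case using match_star by (auto simp: env_subst_def)
next
  case (wt_var x Q)
  then obtain j where "\<rho> = [x \<mapsto> j]" unfolding cix_single by blast
  then have "\<rho> = [x \<mapsto> i]" using wt_var.prems(3) by (auto split: if_splits)
  moreover have "env_subst [x \<mapsto> i] = [x \<mapsto> bt i]" by (rule ext) (simp add: env_subst_def)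
  ultimately show ?case using match_var[OF basis_value_bt] by metis
next
  case (wt_tensor \<Gamma>1 t1 Q1 \<Gamma>2 t2 Q2)
  obtain a b where i: "i = IPair a b" using wt_tensor.prems(3) by (auto simp: tvec_nonzero)
  note cr = cix_restrict[OF wt_tensor.hyps(3) wt_tensor.prems(2)]
  let ?r1 = "\<rho> |` dom \<Gamma>1" and ?r2 = "\<rho> |` dom \<Gamma>2"
  have "amp (Tensor t1 t2) \<rho> = tvec (amp t1 ?r1) (amp t2 ?r2)"
    using amp_Tensor_add[OF wt_tensor.hyps(1,2) cr(1,2) wt_tensor.hyps(3)] cr(3) by simp
  then have "amp t1 ?r1 a \<noteq> 0" "amp t2 ?r2 b \<noteq> 0" using wt_tensor.prems(3) i by auto
  then have "match (env_subst ?r1) t1 (bt a)" "match (env_subst ?r2) t2 (bt b)"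
    using wt_tensor.IH cr(1,2) wt_tensor.prems(1) by simp_all
  moreover have "dom (env_subst ?r1) \<inter> dom (env_subst ?r2) = {}"
  proof -
    have "dom (env_subst \<sigma>) = dom \<sigma>" for \<sigma> by (auto simp: env_subst_def dom_def)
    then show ?thesis using cr(1,2) wt_tensor.hyps(3) by (simp add: cix_iff)
  qed
  ultimately have "match (env_subst ?r1 ++ env_subst ?r2) (Tensor t1 t2) (Tensor (bt a) (bt b))" by (rule match_tensor)
  then show ?case unfolding i by (simp add: env_subst_add[symmetric] cr(3))
next
  case (wt_inl \<Gamma> t Q1 Q2)
  then obtain j where "i = IInl j" "amp t \<rho> j \<noteq> 0" by (auto simp: inj_l_nonzero)
  then show ?case using wt_inl match_inl by simp
next
  case (wt_inr \<Gamma> t Q2 Q1)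
  then obtain j where "i = IInr j" "amp t \<rho> j \<noteq> 0" by (auto simp: inj_r_nonzero)
  then show ?case using wt_inr match_inr by simp
next
  case wt_zero
  then show ?case using match_zero by (auto simp: env_subst_def)
next
  case (wt_succ \<Gamma> t)
  then obtain n where "i = INum (Suc n)" "amp t \<rho> (INum n) \<noteq> 0" by (auto simp: shift_nonzero)
  then show ?case using wt_succ match_succ by fastforce
qed auto

section \<open>Normalization relative to the order on basis values\<close>

context
  fixes r :: "(tm \<times> tm) set"
  assumes lin: "linear_order_on {b. basis_value b} r"
begin

abbreviation before :: "idx \<Rightarrow> idx \<Rightarrow> bool" where
  "before i j \<equiv> (bt i, bt j) \<in> r \<and> bt i \<noteq> bt j"

lemma ex_sorted: "finite A \<Longrightarrow> \<exists>L. set L = A \<and> distinct L \<and> sorted_wrt before L"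
proof (induction A rule: finite_induct)
  case empty
  show ?case by (intro exI[of _ "[]"]) simp
next
  case (insert x A)
  then obtain L where L: "set L = A" "distinct L" "sorted_wrt before L" by blast
  have tr: "trans r" and tot: "total_on {b. basis_value b} r"
    using lin by (auto simp: linear_order_on_def partial_order_on_def preorder_on_def)
  let ?P = "\<lambda>y. (bt y, bt x) \<in> r"
  \<comment> \<open>Inserts \<open>x\<close> after the elements below it and before the others;
    totality of \<open>r\<close> places the latter above \<open>x\<close>.\<close>
  let ?L = "filter ?P L @ x # filter (\<lambda>y. \<not> ?P y) L"
  have 1: "before y x" if "y \<in> A" "?P y" for y using that insert.hyps by (auto simp: bt_inject)
  have 2: "before x z" if "z \<in> A" "\<not> ?P z" for z
  proof -
    have "bt x \<noteq> bt z" using that insert.hyps by (auto simp: bt_inject)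
    then show ?thesis using tot that basis_value_bt unfolding total_on_def by blast
  qed
  have 3: "before y z" if "y \<in> A" "?P y" "z \<in> A" "\<not> ?P z" for y z
    using 1[OF that(1,2)] 2[OF that(3,4)] that transD[OF tr] by metis
  have "sorted_wrt before ?L"
    unfolding sorted_wrt_append sorted_wrt.simps
    using 1 2 3 L(1) sorted_wrt_filter[OF L(3)] by auto
  moreover have "distinct ?L" "set ?L = insert x A" using L insert.hyps by auto
  ultimately show ?case by blast
qed

definition enum :: "(idx \<Rightarrow> complex) \<Rightarrow> idx list" where
  "enum v = (SOME L. set L = {i. v i \<noteq> 0} \<and> distinct L \<and> sorted_wrt before L)"

text \<open>Sorted and without zero coefficients, so that it is a value and the rule for inverses
  can be applied to it.\<close>

definition nf :: "(idx \<Rightarrow> complex) \<Rightarrow> tm" where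
  "nf v = bsum v (enum v)"

lemma enum: "finite {i. v i \<noteq> 0} \<Longrightarrow> set (enum v) = {i. v i \<noteq> 0} \<and> distinct (enum v) \<and> sorted_wrt before (enum v)"
  unfolding enum_def by (rule someI_ex) (rule ex_sorted)

lemma nf_value: "finite {i. v i \<noteq> 0} \<Longrightarrow> is_value r (nf v)"
  unfolding is_value_def nf_def bsum_def
  using enum[of v] basis_value_bt by (intro exI conjI refl) (auto simp: sorted_wrt_map comp_def)

lemma nf_typed: "unit_vec v Q \<Longrightarrow> Map.empty \<turnstile> nf v \<Colon> Q"
  unfolding nf_def using enum[of v] by (intro bsum_typed) (auto simp: unit_vec_def)

lemma amp_nf: "finite {i. v i \<noteq> 0} \<Longrightarrow> amp (nf v) \<rho> = v"
  unfolding nf_def using enum[of v] by (intro amp_bsum) auto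

lemma nf_orth:
  assumes "unit_vec v Q" "unit_vec w Q" "ip v w = 0"
  shows "nf v \<bottom>\<^sub>t nf w"
  unfolding nf_def
  by (rule bsum_orth[where Q = Q]) (use assms enum[of v] enum[of w] in \<open>auto simp: unit_vec_def\<close>)

lemma bsum_permute:
  assumes "Map.empty \<turnstile> bsum v L \<Colon> Q" "distinct L" "distinct L'" "set L' = set L"
  shows "eqn r Map.empty (bsum v L) (bsum v L') Q"
proof -
  have "mset L' = mset L" using assms set_eq_iff_mset_eq_distinct by blast
  then have "mset (map (\<lambda>i. (v i, bt i)) L') = mset (map (\<lambda>i. (v i, bt i)) L)" by (simp only: mset_map)
  then obtain p where "p permutes {..<length (map (\<lambda>i. (v i, bt i)) L)}"
    "permute_list p (map (\<lambda>i. (v i, bt i)) L) = map (\<lambda>i. (v i, bt i)) L'"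
    by (rule mset_eq_permutation)
  then show ?thesis using eq_permute[of Map.empty "map (\<lambda>i. (v i, bt i)) L" Q p] assms(1) unfolding bsum_def by simp
qed

text \<open>The equation for zero coefficients removes only a last summand, whence the induction
  from the right. The shorter sums stay well-formed since the removed coefficients do not change the
  norm.\<close>

lemma bsum_drop_zeros:
  assumes "distinct (L @ Z)" "set (L @ Z) \<subseteq> ix Q" "{i. v i \<noteq> 0} \<subseteq> set L" "ip v v = 1"
  shows "eqn r Map.empty (bsum v (L @ Z)) (bsum v L) Q"
  using assms
proof (induction Z rule: rev_induct)
  case Nil
  then show ?case using bsum_typed by (auto intro: eq_refl)
next
  case (snoc z Z)
  have "v z = 0" using snoc.prems by auto
  then have eq: "bsum v (L @ Z @ [z]) = Sum (map (\<lambda>i. (v i, bt i)) (L @ Z) @ [(0, bt z)])" by (simp add: bsum_def)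
  have "Map.empty \<turnstile> bsum v (L @ Z @ [z]) \<Colon> Q" by (rule bsum_typed) (use snoc.prems in auto)
  then have "eqn r Map.empty (bsum v (L @ Z @ [z])) (bsum v (L @ Z)) Q"
    unfolding eq by (subst bsum_def) (rule eq_zero)
  moreover have "eqn r Map.empty (bsum v (L @ Z)) (bsum v L) Q" using snoc by auto
  ultimately show ?case by (rule eq_trans)
qed

definition normal :: "tm \<Rightarrow> qty \<Rightarrow> bool" where
  "normal t Q \<longleftrightarrow> eqn r Map.empty t (nf (amp t Map.empty)) Q"

text \<open>By soundness provably equal terms have the same coordinates, hence the same normal
  form.\<close>

lemma normal_trans: "eqn r Map.empty s t Q \<Longrightarrow> normal t Q \<Longrightarrow> normal s Q"
  unfolding normal_def using eqn_sound[of r Map.empty s t Q] eq_trans by auto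

lemma normal_eqn: "normal s Q \<Longrightarrow> normal t Q \<Longrightarrow> amp s Map.empty = amp t Map.empty \<Longrightarrow> eqn r Map.empty s t Q"
  unfolding normal_def using eq_trans eq_sym by metis

text \<open>A permutation moves the zero coefficients to the end and sorts the others; then the
  zeros are dropped.\<close>

lemma bsum_normal:
  assumes "distinct L" "set L \<subseteq> ix Q" "{i. v i \<noteq> 0} \<subseteq> set L" "ip v v = 1"
  shows "normal (bsum v L) Q"
proof -
  have fin: "finite {i. v i \<noteq> 0}" using assms(3) finite_subset by blast
  let ?Z = "filter (\<lambda>i. v i = 0) L"
  have L': "distinct (enum v @ ?Z)" "set (enum v @ ?Z) = set L" "{i. v i \<noteq> 0} \<subseteq> set (enum v)"
    using assms(1,3) enum[OF fin] by auto
  have "eqn r Map.empty (bsum v L) (bsum v (enum v @ ?Z)) Q"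
    by (rule bsum_permute[OF bsum_typed[OF assms] assms(1) L'(1,2)])
  moreover have "eqn r Map.empty (bsum v (enum v @ ?Z)) (bsum v (enum v)) Q"
    by (rule bsum_drop_zeros) (use L' assms(2,4) in auto)
  ultimately show ?thesis
    unfolding normal_def amp_bsum[OF assms(1,3)] nf_def by (rule eq_trans)
qed

lemma bt_normal: "i \<in> ix Q \<Longrightarrow> normal (bt i) Q"
proof -
  assume i: "i \<in> ix Q"
  have "normal (bsum (ket i) [i]) Q"
    by (rule bsum_normal) (use i in \<open>auto simp: ip_ket_left ket_apply\<close>)
  moreover have b: "bsum (ket i) [i] = Sum [(1, bt i)]" by (simp add: bsum_def ket_apply)
  moreover have "Map.empty \<turnstile> bsum (ket i) [i] \<Colon> Q"
    by (rule bsum_typed) (use i in \<open>auto simp: ip_ket_left ket_apply\<close>)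
  then have "eqn r Map.empty (bt i) (Sum [(1, bt i)]) Q" unfolding b by (rule eq_sym[OF eq_single])
  ultimately show ?thesis using normal_trans by simp
qed

text \<open>Each summand is replaced by its expansion over one common list of basis values, after
  which the distributive law collects coefficients. The result has norm one because the original sum
  does, so it is normal by \<open>bsum_normal\<close>.\<close>

lemma sum_normal:
  assumes ty: "Map.empty \<turnstile> Sum ts \<Colon> Q" and norm: "\<And>p. p \<in> set ts \<Longrightarrow> normal (snd p) Q"
  shows "normal (Sum ts) Q"
proof -
  define m where "m = length ts"
  define \<alpha> where "\<alpha> i = fst (ts ! i)" for i
  define t where "t i = snd (ts ! i)" for i
  define v where "v i = amp (t i) Map.empty" for i
  have ts: "ts = map (\<lambda>i. (\<alpha> i, t i)) [0..<m]"
    by (rule nth_equalityI) (auto simp: m_def \<alpha>_def t_def)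
  have t: "Map.empty \<turnstile> t i \<Colon> Q" "normal (t i) Q" if "i < m" for i
    using typed_sum_summand[OF ty, of "ts ! i"] norm[of "ts ! i"] that by (auto simp: m_def t_def)
  have a1: "(\<Sum>i<m. (cmod (\<alpha> i))\<^sup>2) = 1" and orth: "\<And>i j. i < m \<Longrightarrow> j < m \<Longrightarrow> i \<noteq> j \<Longrightarrow> t i \<bottom>\<^sub>t t j"
    using ty by (auto elim!: typed_sumE simp: m_def t_def \<alpha>_def)
  have v: "unit_vec (v i) Q" if "i < m" for i using unit_vec_closed[OF t(1)[OF that]] by (simp add: v_def)
  have vo: "ip (v i) (v j) = 0" if "i < m" "j < m" "i \<noteq> j" for i j
    unfolding v_def
    by (rule orth_ip_zero[OF orth[OF that] t(1)[OF that(1)] t(1)[OF that(2)], of "max (size (t i)) (size (t j))"])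
      (auto intro: closed_norm)
  \<comment> \<open>The union of the supports: over this list all summands use the same basis values
    in the same order, as the distributive law with shared inner terms requires.\<close>
  let ?A = "\<Union>i<m. {k. v i k \<noteq> 0}"
  have "finite ?A" using v by (auto simp: unit_vec_def)
  then obtain L where L: "set L = ?A" "distinct L" using finite_distinct_list by metis
  have LQ: "set L \<subseteq> ix Q" using L(1) v by (auto simp: unit_vec_def)
  have sub: "{k. v i k \<noteq> 0} \<subseteq> set L" if "i < m" for i using L(1) that by auto
  have ipv: "ip (v i) (v i) = 1" if "i < m" for i using v[OF that] by (simp add: unit_vec_def)
  have st: "eqn r Map.empty (t i) (bsum (v i) L) Q" if "i < m" for i
    by (rule normal_eqn[OF t(2)[OF that] bsum_normal[OF L(2) LQ sub[OF that] ipv[OF that]]])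
      (simp only: amp_bsum[OF L(2) sub[OF that]], simp only: v_def)
  let ?S = "Sum (map (\<lambda>i. (\<alpha> i, bsum (v i) L)) [0..<m])"
  \<comment> \<open>Congruence alone does not make the rewritten sum well-formed. Its summands are
    orthogonal because the old ones are orthogonal as vectors, and on sums of basis values this
    gives back syntactic orthogonality.\<close>
  have "Map.empty \<turnstile> ?S \<Colon> Q"
  proof (rule ty_sum)
    let ?ss = "map (\<lambda>i. (\<alpha> i, bsum (v i) L)) [0..<m]"
    show "\<forall>i<length ?ss. Map.empty \<turnstile> snd (?ss ! i) \<Colon> Q" using bsum_typed[OF L(2) LQ sub ipv] by simp
    show "(\<Sum>i<length ?ss. (cmod (fst (?ss ! i)))\<^sup>2) = 1" using a1 by simp
    show "\<forall>i<length ?ss. \<forall>j<length ?ss. i \<noteq> j \<longrightarrow> snd (?ss ! i) \<bottom>\<^sub>t snd (?ss ! j)"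
      using bsum_orth[OF L(2) L(2) LQ LQ sub sub vo] by simp
  qed
  moreover have bL: "bsum w L = Sum (map (\<lambda>j. (w (L ! j), bt (L ! j))) [0..<length L])" for w
    unfolding bsum_def by (rule arg_cong[of _ _ Sum], rule nth_equalityI) auto
  ultimately have e1: "eqn r Map.empty ?S (Sum (map (\<lambda>j. (\<Sum>i<m. \<alpha> i * v i (L ! j), bt (L ! j))) [0..<length L])) Q"
    unfolding bL by (intro eq_distrib)
  have e2: "eqn r Map.empty (Sum ts) ?S Q"
    unfolding ts using eq_sum_cong[of Map.empty \<alpha> t m Q r "\<lambda>i. bsum (v i) L"] ty st unfolding ts by blast
  have e3: "eqn r Map.empty (Sum ts) (bsum (\<lambda>k. \<Sum>i<m. \<alpha> i * v i k) L) Q"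
    unfolding bL[of "\<lambda>k. \<Sum>i<m. \<alpha> i * v i k"] by (rule eq_trans[OF e2 e1])
  have amp: "amp (Sum ts) Map.empty = (\<lambda>k. \<Sum>i<m. \<alpha> i * v i k)"
    unfolding amp_Sum_nth by (simp add: m_def \<alpha>_def v_def t_def)
  have "normal (bsum (\<lambda>k. \<Sum>i<m. \<alpha> i * v i k) L) Q"
  proof (rule bsum_normal[OF L(2) LQ])
    show "{k. (\<Sum>i<m. \<alpha> i * v i k) \<noteq> 0} \<subseteq> set L"
    proof
      fix k assume "k \<in> {k. (\<Sum>i<m. \<alpha> i * v i k) \<noteq> 0}"
      then obtain i where "i < m" "\<alpha> i * v i k \<noteq> 0" using sum.not_neutral_contains_not_neutral by blast
      then show "k \<in> set L" using sub by auto
    qed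
    show "ip (\<lambda>k. \<Sum>i<m. \<alpha> i * v i k) (\<lambda>k. \<Sum>i<m. \<alpha> i * v i k) = 1"
      using closed_norm[OF ty] unfolding amp .
  qed
  then show ?thesis by (rule normal_trans[OF e3])
qed

lemma sum_map_normal:
  assumes v: "unit_vec v Q'" and L: "set L = {i. v i \<noteq> 0}" "distinct L"
    and C: "\<And>i. i \<in> ix Q' \<Longrightarrow> Map.empty \<turnstile> C i \<Colon> Q" "\<And>i. i \<in> ix Q' \<Longrightarrow> normal (C i) Q"
    and orth: "\<And>i j. i \<in> ix Q' \<Longrightarrow> j \<in> ix Q' \<Longrightarrow> i \<noteq> j \<Longrightarrow> C i \<bottom>\<^sub>t C j"
  shows "Map.empty \<turnstile> Sum (map (\<lambda>i. (v i, C i)) L) \<Colon> Q" "normal (Sum (map (\<lambda>i. (v i, C i)) L)) Q"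
proof -
  have sub: "i \<in> ix Q'" if "i \<in> set L" for i using v L(1) that by (auto simp: unit_vec_def)
  show ty: "Map.empty \<turnstile> Sum (map (\<lambda>i. (v i, C i)) L) \<Colon> Q"
    by (rule typed_sum_distinct) (use v L C(1) orth sub in \<open>auto simp: unit_vec_def\<close>)
  show "normal (Sum (map (\<lambda>i. (v i, C i)) L)) Q"
    by (rule sum_normal[OF ty]) (use C(2) sub in auto)
qed

text \<open>By linearity it is enough to treat basis values in the hole: \<open>t\<close> is
  replaced by its normal form, the sum is moved out of the context, and the resulting sum of normal
  terms is normal. The hypothesis \<open>orth\<close> keeps that sum well-formed.\<close>

lemma context_normal:
  assumes t: "Map.empty \<turnstile> t \<Colon> Q'" "normal t Q'"
    and cong: "\<And>s t. eqn r Map.empty s t Q' \<Longrightarrow> eqn r Map.empty (C s) (C t) Q"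
    and typed: "\<And>t. Map.empty \<turnstile> t \<Colon> Q' \<Longrightarrow> Map.empty \<turnstile> C t \<Colon> Q"
    and linear: "\<And>ts. Map.empty \<turnstile> C (Sum ts) \<Colon> Q \<Longrightarrow>
      eqn r Map.empty (C (Sum ts)) (Sum (map (\<lambda>(\<alpha>, t). (\<alpha>, C t)) ts)) Q"
    and orth: "\<And>s t. s \<bottom>\<^sub>t t \<Longrightarrow> C s \<bottom>\<^sub>t C t"
    and basis: "\<And>i. i \<in> ix Q' \<Longrightarrow> normal (C (bt i)) Q"
  shows "normal (C t) Q"
proof -
  let ?v = "amp t Map.empty"
  have v: "unit_vec ?v Q'" by (rule unit_vec_closed[OF t(1)])
  then have E: "set (enum ?v) = {i. ?v i \<noteq> 0}" "distinct (enum ?v)" using enum by (auto simp: unit_vec_def)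
  have "eqn r Map.empty (C t) (C (nf ?v)) Q" by (rule cong[OF t(2)[unfolded normal_def]])
  moreover have "eqn r Map.empty (C (nf ?v)) (Sum (map (\<lambda>i. (?v i, C (bt i))) (enum ?v))) Q"
    using linear[OF typed[OF nf_typed[OF v, unfolded nf_def bsum_def]]] by (simp add: nf_def bsum_def comp_def)
  moreover have "normal (Sum (map (\<lambda>i. (?v i, C (bt i))) (enum ?v))) Q"
    by (rule sum_map_normal(2)[OF v E]) (use typed bt_typed basis orth bt_orth in blast)+
  ultimately show ?thesis using normal_trans by blast
qed

lemma inl_normal:
  assumes "Map.empty \<turnstile> t \<Colon> Q1" "normal t Q1"
  shows "normal (Inl t) (QPlus Q1 Q2)"
  by (rule context_normal[OF assms, of Inl])
    (use eq_inl_cong ty_inl eq_inl_sum orth_inl bt_normal[of "IInl _" "QPlus Q1 Q2"] in \<open>simp_all del: split_paired_All\<close>)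

lemma inr_normal:
  assumes "Map.empty \<turnstile> t \<Colon> Q2" "normal t Q2"
  shows "normal (Inr t) (QPlus Q1 Q2)"
  by (rule context_normal[OF assms, of Inr])
    (use eq_inr_cong ty_inr eq_inr_sum orth_inr bt_normal[of "IInr _" "QPlus Q1 Q2"] in \<open>simp_all del: split_paired_All\<close>)

lemma succ_normal:
  assumes "Map.empty \<turnstile> t \<Colon> QNat" "normal t QNat"
  shows "normal (Succ t) QNat"
proof (rule context_normal[OF assms, of Succ])
  fix i assume "i \<in> ix QNat"
  then obtain n where "i = INum n" by auto
  then show "normal (Succ (bt i)) QNat" using bt_normal[of "INum (Suc n)" QNat] by simp
qed (use eq_succ_cong ty_succ eq_succ_sum orth_succ in simp_all)

text \<open>The context argument is used twice, first for the left factor with \<open>t\<close>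
  fixed, then for the right factor next to a basis value.\<close>

lemma tensor_normal:
  assumes s: "Map.empty \<turnstile> s \<Colon> Q1" "normal s Q1" and t: "Map.empty \<turnstile> t \<Colon> Q2" "normal t Q2"
  shows "normal (Tensor s t) (QTensor Q1 Q2)"
proof (rule context_normal[OF s, of "\<lambda>s. Tensor s t"])
  have ty: "Map.empty \<turnstile> Tensor a b \<Colon> QTensor Q1 Q2" if "Map.empty \<turnstile> a \<Colon> Q1" "Map.empty \<turnstile> b \<Colon> Q2" for a b
    using ty_tensor[OF that] by simp
  show "Map.empty \<turnstile> Tensor a t \<Colon> QTensor Q1 Q2" if "Map.empty \<turnstile> a \<Colon> Q1" for a by (rule ty[OF that t(1)])
  show "eqn r Map.empty (Tensor a t) (Tensor b t) (QTensor Q1 Q2)" if "eqn r Map.empty a b Q1" for a b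
    using eq_tensor_cong_left[OF that t(1)] by simp
  fix i assume i: "i \<in> ix Q1"
  show "normal (Tensor (bt i) t) (QTensor Q1 Q2)"
  proof (rule context_normal[OF t, of "Tensor (bt i)"])
    show "Map.empty \<turnstile> Tensor (bt i) b \<Colon> QTensor Q1 Q2" if "Map.empty \<turnstile> b \<Colon> Q2" for b
      by (rule ty[OF bt_typed[OF i] that])
    show "eqn r Map.empty (Tensor (bt i) a) (Tensor (bt i) b) (QTensor Q1 Q2)" if "eqn r Map.empty a b Q2" for a b
      using eq_tensor_cong_right[OF bt_typed[OF i] that] by simp
    show "normal (Tensor (bt i) (bt j)) (QTensor Q1 Q2)" if "j \<in> ix Q2" for j
      using bt_normal[of "IPair i j" "QTensor Q1 Q2"] i that by simp
  qed (rule eq_tensor_sum_right orth_tensor_right; assumption)+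
qed (rule eq_tensor_sum_left orth_tensor_left; assumption)+

lemma app_normal:
  assumes u: "\<tturnstile> u \<Colon> U(Q1, Q2)" and "\<And>i. i \<in> ix Q1 \<Longrightarrow> normal (App u (bt i)) Q2"
    and t: "Map.empty \<turnstile> t \<Colon> Q1" "normal t Q1"
  shows "normal (App u t) Q2"
  by (rule context_normal[OF t, of "App u"]) (rule eq_app_cong[OF u] ty_app[OF u] eq_app_sum orth_app assms(2); assumption)+

text \<open>
  The only rule for \<open>u\<^sup>*\<close> applies to the values \<open>nf (umat u i)\<close>.  Since \<open>u\<close> is unitary, these form an
  orthonormal basis, in which \<open>bt k\<close> has the coefficients \<open>cnj (umat u i k)\<close>.
\<close>

lemma inv_normal:
  assumes u: "\<tturnstile> u \<Colon> U(Q1, Q2)" and un: "\<And>i. i \<in> ix Q1 \<Longrightarrow> normal (App u (bt i)) Q2"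
    and k: "k \<in> ix Q2"
  shows "normal (App (UInv u) (bt k)) Q1"
proof -
  note M = umat_unitary[OF u]
  let ?c = "madj (umat u) k"
  have c: "unit_vec ?c Q1" by (rule unit_vec_row[OF unitary_adj[OF M] k])
  have E: "set (enum ?c) = {i. ?c i \<noteq> 0}" "distinct (enum ?c)" using c enum unfolding unit_vec_def by auto
  have row: "unit_vec (umat u i) Q2" if "i \<in> ix Q1" for i by (rule unit_vec_row[OF M that])
  have fin: "finite {k. umat u i k \<noteq> 0}" if "i \<in> ix Q1" for i by (rule unitaryD(1)[OF M that])
  have row_orth: "nf (umat u i) \<bottom>\<^sub>t nf (umat u j)" if "i \<in> ix Q1" "j \<in> ix Q1" "i \<noteq> j" for i j
    by (rule nf_orth[OF row[OF that(1)] row[OF that(2)]])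
      (use M isometricD(3)[of "ix Q1" "ix Q2" "umat u" i j] that in \<open>auto simp: unitary_mat_def\<close>)
  have nfn: "normal (nf (umat u i)) Q2" if "i \<in> ix Q1" for i
    unfolding normal_def amp_nf[OF fin[OF that]] by (rule eq_refl[OF nf_typed[OF row[OF that]]])
  let ?S = "Sum (map (\<lambda>i. (?c i, nf (umat u i))) (enum ?c))"
  have S: "Map.empty \<turnstile> ?S \<Colon> Q2" "normal ?S Q2"
    by (rule sum_map_normal[OF c E]; use nf_typed row nfn row_orth in blast)+
  have "amp ?S Map.empty k' = ket k k'" for k'
  proof -
    have "amp ?S Map.empty k' = (\<Sum>i\<in>set (enum ?c). ?c i * amp (nf (umat u i)) Map.empty k')"
      by (simp only: amp_Sum_map[OF E(2)])
    also have "\<dots> = (\<Sum>i\<in>set (enum ?c). ?c i * umat u i k')"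
    proof (intro sum.cong refl)
      fix i assume "i \<in> set (enum ?c)"
      then have "i \<in> ix Q1" using E(1) c unfolding unit_vec_def by blast
      then show "?c i * amp (nf (umat u i)) Map.empty k' = ?c i * umat u i k'" using amp_nf[OF fin] by simp
    qed
    also have "\<dots> = mapp (umat u) ?c k'" by (rule mapp_eq_sum[symmetric, OF finite_set]) (use E(1) in blast)
    also have "\<dots> = ket k k'" using unitary_mapp_adj[OF unitary_adj[OF M] k] by simp
    finally show ?thesis .
  qed
  then have "amp (bt k) Map.empty = amp ?S Map.empty" by auto
  then have "eqn r Map.empty (bt k) ?S Q2" by (rule normal_eqn[OF bt_normal[OF k] S(2)])
  then have "eqn r Map.empty (App (UInv u) (bt k)) (App (UInv u) ?S) Q1"
    by (rule eq_app_cong[OF ty_inv[OF u]])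
  moreover have "eqn r Map.empty (App (UInv u) ?S)
      (Sum (map (\<lambda>(\<alpha>, t). (\<alpha>, App (UInv u) t)) (map (\<lambda>i. (?c i, nf (umat u i))) (enum ?c)))) Q1"
    by (rule eq_app_sum[OF ty_app[OF ty_inv[OF u] S(1)]])
  then have "eqn r Map.empty (App (UInv u) ?S) (Sum (map (\<lambda>i. (?c i, App (UInv u) (nf (umat u i)))) (enum ?c))) Q1"
    by (simp add: comp_def)
  moreover have "normal (App (UInv u) (nf (umat u i))) Q1" if i: "i \<in> ix Q1" for i
  proof (rule normal_trans[OF _ bt_normal[OF i]])
    have "eqn r Map.empty (App u (bt i)) (nf (umat u i)) Q2"
      using un[OF i] unfolding normal_def by (simp add: mapp_ket)
    then show "eqn r Map.empty (App (UInv u) (nf (umat u i))) (bt i) Q1"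
      by (rule eq_inv[OF u basis_value_bt bt_typed[OF i] nf_value[OF fin[OF i]] nf_typed[OF row[OF i]]])
  qed
  then have "normal (Sum (map (\<lambda>i. (?c i, App (UInv u) (nf (umat u i)))) (enum ?c))) Q1"
    by (intro sum_map_normal(2)[OF c E] ty_app[OF ty_inv[OF u]] nf_typed[OF row] orth_app row_orth)
  ultimately show ?thesis using normal_trans by blast
qed

text \<open>That some clause matches is not shown from the syntax of bases but from unitarity: the
  basis vector \<open>i\<close> has a nonzero coordinate in the left-hand basis, and
  \<open>match_basis\<close> turns it into a match.\<close>

lemma clauses_normal:
  assumes u: "\<tturnstile> Clauses cs \<Colon> U(Q1, Q2)" and i: "i \<in> ix Q1"
    and w: "\<And>c. c < length cs \<Longrightarrow> wt (\<Delta> c) (fst (cs ! c)) Q1"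
    and rhs: "\<And>c \<rho>. c < length cs \<Longrightarrow> covers (\<Delta> c) \<rho> \<Longrightarrow> normal (subst (env_subst \<rho>) (snd (cs ! c))) Q2"
  shows "normal (App (Clauses cs) (bt i)) Q2"
proof -
  have onb: "ONB Q1 (set (map fst cs))" "distinct (map fst cs)" using utyped_clauses[OF u] by auto
  let ?I = "{(c, \<rho>). c < length (map fst cs) \<and> \<rho> \<in> cix (\<Delta> c)}"
  have M: "unitary_mat ?I (ix Q1) (family_mat (map fst cs))"
    by (rule family_mat_unitary[OF ONB_ONBe[OF onb(1)] onb(2)]) (use w in simp)
  have "isometric (ix Q1) ?I (madj (family_mat (map fst cs)))" using M by (simp add: unitary_mat_def)
  \<comment> \<open>The columns of the left-hand basis have norm one, so the column at
    \<open>i\<close> cannot vanish.\<close>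
  from isometric_row_nonzero[OF this i] obtain p where "madj (family_mat (map fst cs)) i p \<noteq> 0" ..
  then have p: "family_mat (map fst cs) p i \<noteq> 0" by simp
  then have "p \<in> ?I" using unitaryD(4)[OF M i] by blast
  then obtain c \<rho> where c: "p = (c, \<rho>)" "c < length cs" "\<rho> \<in> cix (\<Delta> c)" by auto
  have nz: "amp (fst (cs ! c)) \<rho> i \<noteq> 0" using p c by (auto simp: family_mat_def split: if_splits)
  have "basis_value (fst (cs ! c))" using ONB_basis_value[OF onb(1)] c(2) by auto
  then have "match (env_subst \<rho>) (fst (cs ! c)) (bt i)" using match_basis[OF w[OF c(2)] _ c(3) nz] by blast
  then have "eqn r Map.empty (App (Clauses cs) (bt i)) (subst (env_subst \<rho>) (snd (cs ! c))) Q2"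
    by (rule eq_clauses[OF u basis_value_bt bt_typed[OF i], rotated]) (use c(2) in simp)
  then show ?thesis by (rule normal_trans) (use rhs[OF c(2)] c(3) in \<open>simp add: cix_iff\<close>)
qed

text \<open>Simultaneous induction on typing derivations. Closing the term by an arbitrary valuation
  makes the hypothesis for the right-hand side of a clause cover exactly what the clause rule
  produces, namely that expression with basis values substituted.\<close>

lemma typed_normal:
  "\<Gamma> \<turnstile> t \<Colon> Q \<Longrightarrow> (\<And>\<rho>. covers \<Gamma> \<rho> \<Longrightarrow> normal (subst (env_subst \<rho>) t) Q)"
  "\<tturnstile> u \<Colon> U(Q1, Q2) \<Longrightarrow> (\<And>i. i \<in> ix Q1 \<Longrightarrow> normal (App u (bt i)) Q2)"
proof (induction rule: typed_utyped.inducts)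
  case ty_star
  then show ?case using bt_normal[of IStar QI] by simp
next
  case (ty_var x Q)
  then obtain i where "i \<in> ix Q" "\<rho> x = Some i" unfolding covers_single by blast
  then show ?case using bt_normal by (simp add: env_subst_def)
next
  case (ty_tensor \<Gamma>1 t1 Q1 \<Gamma>2 t2 Q2)
  then show ?case
    using tensor_normal[OF subst_closed[OF ty_tensor.hyps(1)] _ subst_closed[OF ty_tensor.hyps(2)]]
    by (simp add: covers_add)
next
  case (ty_inl \<Gamma> t Q1 Q2)
  then show ?case using inl_normal subst_closed by simp
next
  case (ty_inr \<Gamma> t Q2 Q1)
  then show ?case using inr_normal subst_closed by simp
next
  case ty_zero
  then show ?case using bt_normal[of "INum 0" QNat] by simp
next
  case (ty_succ \<Gamma> t)
  then show ?case using succ_normal subst_closed by simp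
next
  case (ty_sum ts \<Gamma> Q)
  have "\<Gamma> \<turnstile> Sum ts \<Colon> Q" using ty_sum by (intro typed_utyped.ty_sum) auto
  then have "Map.empty \<turnstile> subst (env_subst \<rho>) (Sum ts) \<Colon> Q" using subst_closed ty_sum.prems by blast
  then show ?case
    unfolding subst.simps
  proof (rule sum_normal)
    fix p assume "p \<in> set (map (\<lambda>(\<alpha>, t). (\<alpha>, subst (env_subst \<rho>) t)) ts)"
    then obtain i where "i < length ts" "snd p = subst (env_subst \<rho>) (snd (ts ! i))"
      by (auto simp: in_set_conv_nth case_prod_unfold)
    then show "normal (snd p) Q" using ty_sum.IH ty_sum.prems by simp
  qed
next
  case (ty_app u Q1 Q2 \<Gamma> t)
  then show ?case using app_normal subst_closed by simp
next
  case (ty_clauses cs \<Delta> Q1 Q2)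
  have "\<tturnstile> Clauses cs \<Colon> U(Q1, Q2)" using ty_clauses by (intro typed_utyped.ty_clauses[of cs \<Delta>]) auto
  then show ?case by (rule clauses_normal[where \<Delta> = \<Delta>]) (use ty_clauses typed_wt in auto)
next
  case (ty_inv u Q1 Q2)
  then show ?case by (intro inv_normal)
next
  case (ty_comp u1 Q1 Q2 u2 Q3)
  have "eqn r Map.empty (App (UComp u2 u1) (bt i)) (App u2 (App u1 (bt i))) Q3"
    by (rule eq_comp[OF ty_comp.hyps basis_value_bt bt_typed[OF ty_comp.prems]])
  moreover have "normal (App u2 (App u1 (bt i))) Q3"
    by (rule app_normal[OF ty_comp.hyps(2) ty_comp.IH(2) ty_app[OF ty_comp.hyps(1) bt_typed[OF ty_comp.prems]]
          ty_comp.IH(1)[OF ty_comp.prems]])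
  ultimately show ?case by (rule normal_trans)
next
  case (ty_utensor u1 Q1 Q2 u2 Q3 Q4)
  then obtain a b where i: "i = IPair a b" "a \<in> ix Q1" "b \<in> ix Q3" by auto
  have "eqn r Map.empty (App (UTensor u1 u2) (Tensor (bt a) (bt b))) (Tensor (App u1 (bt a)) (App u2 (bt b))) (QTensor Q2 Q4)"
    by (rule eq_utensor[OF ty_utensor.hyps basis_value_bt bt_typed[OF i(2)] basis_value_bt bt_typed[OF i(3)]])
  moreover have "normal (Tensor (App u1 (bt a)) (App u2 (bt b))) (QTensor Q2 Q4)"
    by (rule tensor_normal[OF ty_app[OF ty_utensor.hyps(1) bt_typed[OF i(2)]] ty_utensor.IH(1)[OF i(2)]
          ty_app[OF ty_utensor.hyps(2) bt_typed[OF i(3)]] ty_utensor.IH(2)[OF i(3)]])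
  ultimately show ?case unfolding i(1) bt.simps by (rule normal_trans)
next
  case (ty_uplus u1 Q1 Q2 u2 Q3 Q4)
  from ty_uplus.prems consider a where "i = IInl a" "a \<in> ix Q1" | b where "i = IInr b" "b \<in> ix Q3" by auto
  then show ?case
  proof cases
    case (1 a)
    have "eqn r Map.empty (App (UPlus u1 u2) (Inl (bt a))) (Inl (App u1 (bt a))) (QPlus Q2 Q4)"
      by (rule eq_uplus_inl[OF ty_uplus.hyps basis_value_bt bt_typed[OF 1(2)]])
    moreover have "normal (Inl (App u1 (bt a))) (QPlus Q2 Q4)"
      by (rule inl_normal[OF ty_app[OF ty_uplus.hyps(1) bt_typed[OF 1(2)]] ty_uplus.IH(1)[OF 1(2)]])
    ultimately show ?thesis unfolding 1(1) bt.simps by (rule normal_trans)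
  next
    case (2 b)
    have "eqn r Map.empty (App (UPlus u1 u2) (Inr (bt b))) (Inr (App u2 (bt b))) (QPlus Q2 Q4)"
      by (rule eq_uplus_inr[OF ty_uplus.hyps basis_value_bt bt_typed[OF 2(2)]])
    moreover have "normal (Inr (App u2 (bt b))) (QPlus Q2 Q4)"
      by (rule inr_normal[OF ty_app[OF ty_uplus.hyps(2) bt_typed[OF 2(2)]] ty_uplus.IH(2)[OF 2(2)]])
    ultimately show ?thesis unfolding 2(1) bt.simps by (rule normal_trans)
  qed
next
  case (ty_ctrl u Q)
  from ty_ctrl.prems obtain a b where i: "i = IPair a b" "a \<in> ix qbit" "b \<in> ix Q" by auto
  then consider "a = IInl IStar" | "a = IInr IStar" by (auto simp: qbit_def)
  then show ?case
  proof cases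
    case 1
    have "eqn r Map.empty (App (UCtrl u) (Tensor (Inl Star) (bt b))) (Tensor (Inl Star) (bt b)) (QTensor qbit Q)"
      by (rule eq_ctrl_inl[OF ty_ctrl.hyps basis_value_bt bt_typed[OF i(3)]])
    moreover have "normal (Tensor (Inl Star) (bt b)) (QTensor qbit Q)"
      using bt_normal[OF ty_ctrl.prems] unfolding i(1) 1 by simp
    ultimately show ?thesis unfolding i(1) 1 bt.simps by (rule normal_trans)
  next
    case 2
    have "eqn r Map.empty (App (UCtrl u) (Tensor (Inr Star) (bt b))) (Tensor (Inr Star) (App u (bt b))) (QTensor qbit Q)"
      by (rule eq_ctrl_inr[OF ty_ctrl.hyps basis_value_bt bt_typed[OF i(3)]])
    moreover have "normal (Tensor (Inr Star) (App u (bt b))) (QTensor qbit Q)"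
      using tensor_normal[OF bt_typed[OF i(2)] bt_normal[OF i(2)] ty_app[OF ty_ctrl.hyps bt_typed[OF i(3)]] ty_ctrl.IH[OF i(3)]]
      unfolding 2 by simp
    ultimately show ?thesis unfolding i(1) 2 bt.simps by (rule normal_trans)
  qed
qed

lemma subst_empty: "subst Map.empty t = t"
proof (induction t rule: fv.induct)
  case (9 ts)
  then show ?case by (simp add: map_idI case_prod_unfold)
qed auto

lemma closed_normal: "Map.empty \<turnstile> t \<Colon> Q \<Longrightarrow> normal t Q"
proof -
  assume "Map.empty \<turnstile> t \<Colon> Q"
  then have "normal (subst (env_subst Map.empty) t) Q" by (rule typed_normal(1)) simp
  moreover have "env_subst Map.empty = Map.empty" by (simp add: env_subst_def)
  ultimately show ?thesis by (simp add: subst_empty)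
qed

end

theorem theorem2p74:
  fixes r :: "(tm \<times> tm) set" and Q :: qty and t\<^sub>1 t\<^sub>2 :: tm
  assumes "linear_order_on {b. basis_value b} r"
    and "Map.empty \<turnstile> t\<^sub>1 \<Colon> Q"
    and "Map.empty \<turnstile> t\<^sub>2 \<Colon> Q"
  shows "eqn r Map.empty t\<^sub>1 t\<^sub>2 Q \<longleftrightarrow> \<lbrakk>Map.empty \<turnstile> t\<^sub>1 \<Colon> Q\<rbrakk> = \<lbrakk>Map.empty \<turnstile> t\<^sub>2 \<Colon> Q\<rbrakk>"
  unfolding sem_eq_iff[OF assms(2,3)]
proof
  assume "eqn r Map.empty t\<^sub>1 t\<^sub>2 Q"
  then show "amp t\<^sub>1 Map.empty = amp t\<^sub>2 Map.empty" using eqn_sound by simp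
next
  assume "amp t\<^sub>1 Map.empty = amp t\<^sub>2 Map.empty"
  then show "eqn r Map.empty t\<^sub>1 t\<^sub>2 Q"
    using normal_eqn[OF assms(1)] closed_normal[OF assms(1) assms(2)] closed_normal[OF assms(1) assms(3)] by blast
qed

end
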